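(* Suppose $\mathcal{R}$ expands an ordered field. Let $\Omega\subseteq R^m$ and let $\mathcal{S}=\{S_u:u\in\Omega\}$ be a definable family of subsets of $R^n$ with the finite intersection property. The following are equivalent: (1) $\mathcal{S}$ can be extended to a complete definable $n$-type over $R$; (2) there exists a definable downward directed family $\mathcal{S}'$ that is finer than $\mathcal{S}$; (3) there exists a definable curve $\gamma:R^{>0}\to\bigcup\mathcal{S}$ such that for every $u\in\Omega$, $\gamma(t)\in S_u$ for all sufficiently small $t>0$.
   Context: Standing assumptions: $\mathcal{R}=(R,0,+,<,\ldots)$ is an o-minimal expansion of an ordered group, and "definable" means definable in $\mathcal{R}$ with parameters from $R$; $R^{>0}=\{t\in R:t>0\}$. "$\mathcal{R}$ expands an ordered field" means there are definable $\oplus,\otimes:R^2\to R$ such that $(R,<,\oplus,\otimes)$ is a real closed ordered field. A complete $n$-type over $R$ is identified with an ultrafilter in the Boolean algebra of definable subsets of $R^n$; it is definable if for every formula $\phi(v,u)$ (with $|v|=n$, $|u|=k$) the set $\{u\in R^k: \phi(R^n,u)\in p\}$ is definable. $\mathcal{S}$ extends to $p$ if every $S_u$ belongs to $p$. A family of sets is downward directed if it does not contain $\emptyset$ and for any finitely many members there is a member contained in all of them. $\mathcal{S}'$ is finer than $\mathcal{S}$ if every element of $\mathcal{S}$ contains an element of $\mathcal{S}'$. *)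

theory Defs
  imports Main "HOL-Algebra.Polynomial_Divisibility"
begin

(* The library's linordered_ab_group_add is commutative; commutativity is not part of
   the notion of an ordered group. *)

class linordered_group_add = group_add + linorder +
  assumes add_left_mono_group: "a \<le> b \<Longrightarrow> c + a \<le> c + b"
    and add_right_mono_group: "a \<le> b \<Longrightarrow> a + c \<le> b + c"


section \<open>Expansions of ordered groups and their definable sets\<close>

text \<open>
  The underlying set \<open>R\<close> is the type \<open>'a\<close>, whose class supplies \<open>0\<close>, \<open>+\<close> and \<open><\<close>. The
  remaining function and relation symbols of the language are the elements of \<open>'f\<close>
  and \<open>'r\<close>. Interpretations are only ever applied to lists whose length is the arity.
\<close>

record ('a, 'f, 'r) expansion =
  fun_arity :: "'f \<Rightarrow> nat"
  fun_interp :: "'f \<Rightarrow> 'a list \<Rightarrow> 'a"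
  rel_arity :: "'r \<Rightarrow> nat"
  rel_interp :: "'r \<Rightarrow> 'a list \<Rightarrow> bool"

text \<open>
  Terms and formulas with parameters. The constant \<open>0\<close> of the language is \<open>Param 0\<close>.
\<close>

datatype ('a, 'f) trm =
    Var nat
  | Param 'a
  | Plus "('a, 'f) trm" "('a, 'f) trm"
  | App 'f "('a, 'f) trm list"

datatype ('a, 'f, 'r) fm =
    Eq "('a, 'f) trm" "('a, 'f) trm"
  | Less "('a, 'f) trm" "('a, 'f) trm"
  | Rel 'r "('a, 'f) trm list"
  | Neg "('a, 'f, 'r) fm"
  | Conj "('a, 'f, 'r) fm" "('a, 'f, 'r) fm"
  | Ex nat "('a, 'f, 'r) fm"

primrec wf_trm :: "('a, 'f, 'r) expansion \<Rightarrow> ('a, 'f) trm \<Rightarrow> bool" where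
  "wf_trm M (Var i) \<longleftrightarrow> True"
| "wf_trm M (Param a) \<longleftrightarrow> True"
| "wf_trm M (Plus s t) \<longleftrightarrow> wf_trm M s \<and> wf_trm M t"
| "wf_trm M (App f ts) \<longleftrightarrow> length ts = fun_arity M f \<and> list_all (wf_trm M) ts"

primrec wf_fm :: "('a, 'f, 'r) expansion \<Rightarrow> ('a, 'f, 'r) fm \<Rightarrow> bool" where
  "wf_fm M (Eq s t) \<longleftrightarrow> wf_trm M s \<and> wf_trm M t"
| "wf_fm M (Less s t) \<longleftrightarrow> wf_trm M s \<and> wf_trm M t"
| "wf_fm M (Rel r ts) \<longleftrightarrow> length ts = rel_arity M r \<and> list_all (wf_trm M) ts"
| "wf_fm M (Neg \<phi>) \<longleftrightarrow> wf_fm M \<phi>"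
| "wf_fm M (Conj \<phi> \<psi>) \<longleftrightarrow> wf_fm M \<phi> \<and> wf_fm M \<psi>"
| "wf_fm M (Ex i \<phi>) \<longleftrightarrow> wf_fm M \<phi>"

primrec vars_trm :: "('a, 'f) trm \<Rightarrow> nat set" where
  "vars_trm (Var i) = {i}"
| "vars_trm (Param a) = {}"
| "vars_trm (Plus s t) = vars_trm s \<union> vars_trm t"
| "vars_trm (App f ts) = \<Union> (set (map vars_trm ts))"

primrec free_vars :: "('a, 'f, 'r) fm \<Rightarrow> nat set" where
  "free_vars (Eq s t) = vars_trm s \<union> vars_trm t"
| "free_vars (Less s t) = vars_trm s \<union> vars_trm t"
| "free_vars (Rel r ts) = \<Union> (set (map vars_trm ts))"
| "free_vars (Neg \<phi>) = free_vars \<phi>"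
| "free_vars (Conj \<phi> \<psi>) = free_vars \<phi> \<union> free_vars \<psi>"
| "free_vars (Ex i \<phi>) = free_vars \<phi> - {i}"

primrec eval_trm ::
  "('a::plus, 'f, 'r) expansion \<Rightarrow> (nat \<Rightarrow> 'a) \<Rightarrow> ('a, 'f) trm \<Rightarrow> 'a" where
  "eval_trm M e (Var i) = e i"
| "eval_trm M e (Param a) = a"
| "eval_trm M e (Plus s t) = eval_trm M e s + eval_trm M e t"
| "eval_trm M e (App f ts) = fun_interp M f (map (eval_trm M e) ts)"

primrec sat ::
  "('a::{plus, ord}, 'f, 'r) expansion \<Rightarrow> (nat \<Rightarrow> 'a) \<Rightarrow> ('a, 'f, 'r) fm \<Rightarrow> bool" where
  "sat M e (Eq s t) \<longleftrightarrow> eval_trm M e s = eval_trm M e t"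
| "sat M e (Less s t) \<longleftrightarrow> eval_trm M e s < eval_trm M e t"
| "sat M e (Rel r ts) \<longleftrightarrow> rel_interp M r (map (eval_trm M e) ts)"
| "sat M e (Neg \<phi>) \<longleftrightarrow> \<not> sat M e \<phi>"
| "sat M e (Conj \<phi> \<psi>) \<longleftrightarrow> sat M e \<phi> \<and> sat M e \<psi>"
| "sat M e (Ex i \<phi>) \<longleftrightarrow> (\<exists>a. sat M (e(i := a)) \<phi>)"

text \<open>
  \<open>R\<^sup>n\<close> is the set of lists of length \<open>n\<close>; \<open>R\<^sup>m \<times> R\<^sup>n\<close> is identified with \<open>R\<^sup>m\<^sup>+\<^sup>n\<close> by
  concatenation.
\<close>

definition tuples :: "nat \<Rightarrow> 'a list set" where
  "tuples n = {x. length x = n}"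

definition formula_in :: "('a, 'f, 'r) expansion \<Rightarrow> nat \<Rightarrow> ('a, 'f, 'r) fm \<Rightarrow> bool" where
  "formula_in M n \<phi> \<longleftrightarrow> wf_fm M \<phi> \<and> free_vars \<phi> \<subseteq> {..<n}"

text \<open>
  A tuple \<open>x\<close> is used as the valuation \<open>nth x\<close>; its values at indices \<open>\<ge> length x\<close> are
  irrelevant, since \<open>formula_in\<close> bounds the free variables.
\<close>

definition definable ::
  "('a::{plus, ord}, 'f, 'r) expansion \<Rightarrow> nat \<Rightarrow> 'a list set \<Rightarrow> bool" where
  "definable M n A \<longleftrightarrow>
     (\<exists>\<phi>. formula_in M n \<phi> \<and> A = {x \<in> tuples n. sat M (nth x) \<phi>})"

definition definable_op ::
  "('a::{plus, ord}, 'f, 'r) expansion \<Rightarrow> ('a \<Rightarrow> 'a \<Rightarrow> 'a) \<Rightarrow> bool" where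
  "definable_op M g \<longleftrightarrow> definable M 3 {[x, y, g x y] | x y. True}"

definition point_or_interval :: "'a::linorder set \<Rightarrow> bool" where
  "point_or_interval I \<longleftrightarrow>
     (\<exists>a. I = {a}) \<or> (\<exists>a b. I = {a<..<b}) \<or> (\<exists>a. I = {a<..}) \<or> (\<exists>b. I = {..<b}) \<or> I = UNIV"

definition o_minimal :: "('a::linordered_group_add, 'f, 'r) expansion \<Rightarrow> bool" where
  "o_minimal M \<longleftrightarrow>
     (\<forall>A. definable M 1 A \<longrightarrow>
        (\<exists>\<I>. finite \<I> \<and> (\<forall>I\<in>\<I>. point_or_interval I) \<and> {a. [a] \<in> A} = \<Union>\<I>))"


section \<open>Real closed ordered fields\<close>

text \<open>
  The order is that of the type \<open>'a\<close>; the field operations are unrelated to its group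
  structure.
\<close>

definition ordered_field_on :: "('a::linorder) ring \<Rightarrow> bool" where
  "ordered_field_on F \<longleftrightarrow>
     field F \<and> carrier F = UNIV \<and>
     (\<forall>x y z. x < y \<longrightarrow> x \<oplus>\<^bsub>F\<^esub> z < y \<oplus>\<^bsub>F\<^esub> z) \<and>
     (\<forall>x y. \<zero>\<^bsub>F\<^esub> < x \<and> \<zero>\<^bsub>F\<^esub> < y \<longrightarrow> \<zero>\<^bsub>F\<^esub> < x \<otimes>\<^bsub>F\<^esub> y)"

definition real_closed_on :: "('a::linorder) ring \<Rightarrow> bool" where
  "real_closed_on F \<longleftrightarrow>
     ordered_field_on F \<and>
     (\<forall>x. \<zero>\<^bsub>F\<^esub> \<le> x \<longrightarrow> (\<exists>y. y \<otimes>\<^bsub>F\<^esub> y = x)) \<and>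
     (\<forall>p \<in> carrier (poly_ring F). odd (degree p) \<longrightarrow> (\<exists>x. ring.eval F p x = \<zero>\<^bsub>F\<^esub>))"

definition expands_ordered_field ::
  "('a::linordered_group_add, 'f, 'r) expansion \<Rightarrow> bool" where
  "expands_ordered_field M \<longleftrightarrow>
     (\<exists>F. real_closed_on F \<and> definable_op M (add F) \<and> definable_op M (mult F))"


section \<open>Complete definable types\<close>

definition complete_type ::
  "('a::{plus, ord}, 'f, 'r) expansion \<Rightarrow> nat \<Rightarrow> 'a list set set \<Rightarrow> bool" where
  "complete_type M n p \<longleftrightarrow>
     (\<forall>A\<in>p. definable M n A) \<and>
     tuples n \<in> p \<and> {} \<notin> p \<and>
     (\<forall>A\<in>p. \<forall>B\<in>p. A \<inter> B \<in> p) \<and>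
     (\<forall>A\<in>p. \<forall>B. definable M n B \<and> A \<subseteq> B \<longrightarrow> B \<in> p) \<and>
     (\<forall>A. definable M n A \<longrightarrow> A \<in> p \<or> tuples n - A \<in> p)"

definition definable_type ::
  "('a::{plus, ord}, 'f, 'r) expansion \<Rightarrow> nat \<Rightarrow> 'a list set set \<Rightarrow> bool" where
  "definable_type M n p \<longleftrightarrow>
     (\<forall>k \<phi>. formula_in M (n + k) \<phi> \<longrightarrow>
        definable M k {u \<in> tuples k. {v \<in> tuples n. sat M (nth (v @ u)) \<phi>} \<in> p})"


section \<open>Families of sets and curves\<close>

definition definable_family ::
  "('a::{plus, ord}, 'f, 'r) expansion \<Rightarrow> nat \<Rightarrow> nat \<Rightarrow> 'a list set \<Rightarrow>
     ('a list \<Rightarrow> 'a list set) \<Rightarrow> bool" where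
  "definable_family M m n \<Omega> S \<longleftrightarrow>
     definable M m \<Omega> \<and> (\<forall>u\<in>\<Omega>. S u \<subseteq> tuples n) \<and>
     definable M (m + n) {u @ x | u x. u \<in> \<Omega> \<and> x \<in> S u}"

text \<open>
  The empty family has the finite intersection property; a downward directed family
  is nonempty (take \<open>\<F> = {}\<close>).
\<close>

definition finite_intersection_property :: "'b set set \<Rightarrow> bool" where
  "finite_intersection_property \<S> \<longleftrightarrow>
     (\<forall>\<F>. finite \<F> \<and> \<F> \<noteq> {} \<and> \<F> \<subseteq> \<S> \<longrightarrow> \<Inter>\<F> \<noteq> {})"

definition downward_directed :: "'b set set \<Rightarrow> bool" where
  "downward_directed \<S> \<longleftrightarrow>
     {} \<notin> \<S> \<and> (\<forall>\<F>. finite \<F> \<and> \<F> \<subseteq> \<S> \<longrightarrow> (\<exists>B\<in>\<S>. \<forall>A\<in>\<F>. B \<subseteq> A))"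

definition finer :: "'b set set \<Rightarrow> 'b set set \<Rightarrow> bool" where
  "finer \<S>' \<S> \<longleftrightarrow> (\<forall>A\<in>\<S>. \<exists>B\<in>\<S>'. B \<subseteq> A)"

text \<open>
  Curves are maps on \<open>R\<^sup>>\<^sup>0\<close>; the values of \<open>\<gamma>\<close> elsewhere are irrelevant.
\<close>

definition definable_curve ::
  "('a::{plus, ord, zero}, 'f, 'r) expansion \<Rightarrow> nat \<Rightarrow> ('a \<Rightarrow> 'a list) \<Rightarrow> bool" where
  "definable_curve M n \<gamma> \<longleftrightarrow>
     (\<forall>t>0. \<gamma> t \<in> tuples n) \<and> definable M (Suc n) {t # \<gamma> t | t. 0 < t}"

end

theory Submission
  imports Defs
begin

text \<open>
  A curve yields the directed family of its initial pieces and the type of its germ at \<open>0\<close>, so the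
  point is to produce a curve. A definable type is treated as a definable quantifier \<open>G\<close> on \<open>R\<^sup>n\<close>
  (for almost all \<open>x\<close>). A directed family extends to such a quantifier one coordinate at a time:
  over a type of the last \<open>j\<close> coordinates, the preceding one is taken as large as the family
  permits.

  To obtain a curve through all \<open>S u\<close>, with \<open>u\<close> ranging over \<open>R\<^sup>m\<close>, the parameters are removed one
  at a time, \<open>S\<close> being allowed to depend on the curve parameter \<open>s\<close>. By uniform finiteness the set
  of those \<open>v\<close> with \<open>x \<in> S (v # u)\<close> changes at most \<open>k\<close> times along \<open>R\<close>, and the
  points where it changes, as functions of \<open>x\<close>, have limits in \<open>R\<close> or at infinity with respect to \<open>G\<close>. So almost all \<open>x\<close> lie in
  \<open>S (v # u)\<close> simultaneously for all \<open>v\<close> in finitely many closed intervals avoiding these limits,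
  provided that for each such \<open>v\<close> separately almost all \<open>x\<close> lie in it. The field structure lets these intervals grow as \<open>s\<close> tends to \<open>0\<close> so that they eventually
  swallow every \<open>v\<close> with finitely many exceptions, and those are added by hand.
\<close>

section \<open>Definability in higher-order style\<close>

text \<open>A type settles finitely many conditions at once, whereas the point of the curve at
  \<open>s\<close> has to meet infinitely many, one for each \<open>v\<close>. The way out is that
  on an interval where membership in \<open>S (v # u)\<close> almost surely does not change, a
  single \<open>v0\<close> decides every other \<open>v\<close>. The ends of such an interval are
  only approximated, by elements of it chosen definably at scale \<open>s\<close>; they move with
  \<open>s\<close> and may run off to infinity. The field enters here: r \<mapsto> 1/r lets one
  parameter control both the distance to a finite end and the size of an element near infinity. A
  fixed \<open>v\<close> that stays outside the approximating intervals is eventually close to a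
  moving end, and two different elements cannot both be, so each end costs at most one exception. A
  type obtained from a directed family meets a different obstacle: its generating condition speaks
  of all definable final segments, which no formula can quantify over. The same bound on the number
  of changes of truth value replaces them by finitely many, and this makes the extended quantifier
  definable.\<close>

lemma eval_trm_cong: "(\<And>i. i \<in> vars_trm t \<Longrightarrow> e i = e' i) \<Longrightarrow> eval_trm M e t = eval_trm M e' t"
proof (induction t)
  case (App f ts)
  then have "map (eval_trm M e) ts = map (eval_trm M e') ts" by (intro map_cong) auto
  then show ?case by (metis eval_trm.simps(4))
qed auto

lemma sat_cong: "(\<And>i. i \<in> free_vars \<phi> \<Longrightarrow> e i = e' i) \<Longrightarrow> sat M e \<phi> \<longleftrightarrow> sat M e' \<phi>"
proof (induction \<phi> arbitrary: e e')
  case (Eq s t)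
  have "eval_trm M e s = eval_trm M e' s" "eval_trm M e t = eval_trm M e' t"
    by (rule eval_trm_cong, simp add: Eq)+
  then show ?case by simp
next
  case (Less s t)
  have "eval_trm M e s = eval_trm M e' s" "eval_trm M e t = eval_trm M e' t"
    by (rule eval_trm_cong, simp add: Less)+
  then show ?case by simp
next
  case (Rel r ts)
  then have "map (eval_trm M e) ts = map (eval_trm M e') ts"
    by (intro map_cong) (auto intro!: eval_trm_cong)
  then show ?case by (metis sat.simps(3))
next
  case (Neg \<phi>) then show ?case by (metis free_vars.simps(4) sat.simps(4))
next
  case (Conj \<phi> \<psi>)
  have "sat M e \<phi> = sat M e' \<phi>" by (rule Conj.IH(1)) (simp add: Conj.prems)
  moreover have "sat M e \<psi> = sat M e' \<psi>" by (rule Conj.IH(2)) (simp add: Conj.prems)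
  ultimately show ?case by simp
next
  case (Ex i \<phi>)
  have "sat M (e(i := a)) \<phi> = sat M (e'(i := a)) \<phi>" for a
    by (rule Ex.IH) (use Ex.prems in auto)
  then show ?case by simp
qed

lemma finite_vars_trm: "finite (vars_trm t)"
  by (induction t) auto

lemma finite_free_vars: "finite (free_vars \<phi>)"
  by (induction \<phi>) (auto simp: finite_vars_trm)

primrec rename_trm :: "(nat \<Rightarrow> nat) \<Rightarrow> ('a, 'f) trm \<Rightarrow> ('a, 'f) trm" where
  "rename_trm \<sigma> (Var i) = Var (\<sigma> i)"
| "rename_trm \<sigma> (Param a) = Param a"
| "rename_trm \<sigma> (Plus s t) = Plus (rename_trm \<sigma> s) (rename_trm \<sigma> t)"
| "rename_trm \<sigma> (App f ts) = App f (map (rename_trm \<sigma>) ts)"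

text \<open>Bound variables are renamed along with free ones, which avoids any treatment of capture;
  the price is that truth is preserved only for injective \<sigma>.\<close>

primrec rename_fm :: "(nat \<Rightarrow> nat) \<Rightarrow> ('a, 'f, 'r) fm \<Rightarrow> ('a, 'f, 'r) fm" where
  "rename_fm \<sigma> (Eq s t) = Eq (rename_trm \<sigma> s) (rename_trm \<sigma> t)"
| "rename_fm \<sigma> (Less s t) = Less (rename_trm \<sigma> s) (rename_trm \<sigma> t)"
| "rename_fm \<sigma> (Rel r ts) = Rel r (map (rename_trm \<sigma>) ts)"
| "rename_fm \<sigma> (Neg \<phi>) = Neg (rename_fm \<sigma> \<phi>)"
| "rename_fm \<sigma> (Conj \<phi> \<psi>) = Conj (rename_fm \<sigma> \<phi>) (rename_fm \<sigma> \<psi>)"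
| "rename_fm \<sigma> (Ex i \<phi>) = Ex (\<sigma> i) (rename_fm \<sigma> \<phi>)"

lemma wf_rename_trm: "wf_trm M t \<Longrightarrow> wf_trm M (rename_trm \<sigma> t)"
  by (induction t) (auto simp: list_all_iff)

lemma wf_rename_fm: "wf_fm M \<phi> \<Longrightarrow> wf_fm M (rename_fm \<sigma> \<phi>)"
  by (induction \<phi>) (auto simp: list_all_iff wf_rename_trm)

lemma eval_rename_trm: "eval_trm M e (rename_trm \<sigma> t) = eval_trm M (\<lambda>i. e (\<sigma> i)) t"
proof (induction t)
  case (App f ts)
  then have "map (eval_trm M e) (map (rename_trm \<sigma>) ts) = map (eval_trm M (\<lambda>i. e (\<sigma> i))) ts" by auto
  then show ?case by (metis eval_trm.simps(4) rename_trm.simps(4))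
qed auto

lemma sat_rename_fm:
  assumes "inj \<sigma>"
  shows "sat M e (rename_fm \<sigma> \<phi>) \<longleftrightarrow> sat M (\<lambda>i. e (\<sigma> i)) \<phi>"
proof (induction \<phi> arbitrary: e)
  case (Rel r ts)
  have "map (eval_trm M e) (map (rename_trm \<sigma>) ts) = map (eval_trm M (\<lambda>i. e (\<sigma> i))) ts"
    by (auto simp: eval_rename_trm)
  then show ?case by (metis sat.simps(3) rename_fm.simps(3))
next
  case (Ex i \<phi>)
  have "(\<lambda>j. (e(\<sigma> i := a)) (\<sigma> j)) = (\<lambda>j. e (\<sigma> j))(i := a)" for a
    using assms by (auto simp: fun_eq_iff inj_eq)
  then show ?case using Ex by simp
qed (auto simp: eval_rename_trm)

lemma map_upt_Suc_Cons: "map f [0..<Suc n] = f 0 # map (\<lambda>i. f (Suc i)) [0..<n]"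
  by (simp add: upt_conv_Cons map_Suc_upt[symmetric] del: upt_Suc map_Suc_upt)

text \<open>An index out of range yields an unspecified value that depends only on the excess over
  the length. For tuples of fixed length it is thus a constant, and \<open>dfun_nth\<close> needs no
  bound on the index.\<close>

lemma nth_beyond: "length xs \<le> i \<Longrightarrow> xs ! i = [] ! (i - length xs)"
  by (induction xs arbitrary: i) (auto simp: nth_Cons split: nat.split)

section \<open>Definable predicates, functions and tuples on valuations\<close>

locale expn =
  fixes M :: "('a::linordered_group_add, 'f, 'r) expansion"
begin

text \<open>
  The rules \<open>dintros\<close> follow the syntax of a predicate on valuations. A quantified variable is put at
  position \<open>0\<close> of the valuation (a quantified \<open>n\<close>-tuple at the positions below \<open>n\<close>), and the other
  variables are shifted accordingly.
\<close>

definition dpred :: "((nat \<Rightarrow> 'a) \<Rightarrow> bool) \<Rightarrow> bool" where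
  "dpred P \<longleftrightarrow> (\<exists>\<phi>. wf_fm M \<phi> \<and> (\<forall>e. sat M e \<phi> \<longleftrightarrow> P e))"

definition dfun :: "((nat \<Rightarrow> 'a) \<Rightarrow> 'a) \<Rightarrow> bool" where
  "dfun s \<longleftrightarrow> dpred (\<lambda>e. e 0 = s (\<lambda>i. e (Suc i)))"

text \<open>The list of component functions is fixed, so the length of the tuple cannot vary with
  the valuation.\<close>

definition dtup :: "((nat \<Rightarrow> 'a) \<Rightarrow> 'a list) \<Rightarrow> bool" where
  "dtup t \<longleftrightarrow> (\<exists>ts. (\<forall>s\<in>set ts. dfun s) \<and> (\<forall>e. t e = map (\<lambda>s. s e) ts))"

named_theorems dintros

lemma dpred_not [dintros]: "dpred P \<Longrightarrow> dpred (\<lambda>e. \<not> P e)"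
  unfolding dpred_def by (metis sat.simps(4) wf_fm.simps(4))

lemma dpred_conj [dintros]: "dpred P \<Longrightarrow> dpred Q \<Longrightarrow> dpred (\<lambda>e. P e \<and> Q e)"
  unfolding dpred_def by (metis sat.simps(5) wf_fm.simps(5))

lemma dpred_disj [dintros]:
  assumes "dpred P" "dpred Q" shows "dpred (\<lambda>e. P e \<or> Q e)"
  using dpred_not[OF dpred_conj[OF dpred_not[OF assms(1)] dpred_not[OF assms(2)]]] by simp

lemma dpred_imp [dintros]:
  assumes "dpred P" "dpred Q" shows "dpred (\<lambda>e. P e \<longrightarrow> Q e)"
  using dpred_disj[OF dpred_not[OF assms(1)] assms(2)] by simp

lemma dpred_var_eq: "dpred (\<lambda>e. e i = e j)"
  unfolding dpred_def by (rule exI[of _ "Eq (Var i) (Var j)"]) simp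

lemma dpred_const [dintros]: "dpred (\<lambda>e. P)"
proof -
  have T: "dpred (\<lambda>e. True)" using dpred_var_eq[of 0 0] by simp
  show ?thesis using T dpred_not[OF T] by (cases P) auto
qed

lemma dpred_rename_inj:
  assumes "dpred P" "inj \<sigma>" shows "dpred (\<lambda>e. P (\<lambda>i. e (\<sigma> i)))"
  using assms unfolding dpred_def by (metis wf_rename_fm sat_rename_fm)

lemma free_bound: "\<exists>N. \<forall>i\<in>free_vars \<phi>. i < N"
  using finite_nat_set_iff_bounded finite_free_vars by blast

lemma dpred_ex [dintros]:
  assumes "dpred (\<lambda>e. P (e 0) (\<lambda>i. e (Suc i)))"
  shows "dpred (\<lambda>e. \<exists>a. P a e)"
proof -
  obtain \<phi> where f: "wf_fm M \<phi>" "\<And>e. sat M e \<phi> \<longleftrightarrow> P (e 0) (\<lambda>i. e (Suc i))"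
    using assms unfolding dpred_def by blast
  obtain N where N: "\<And>i. i \<in> free_vars \<phi> \<Longrightarrow> i < N" using free_bound[of \<phi>] by blast
  \<comment> \<open>The bound variable 0 is sent to the fresh index \<open>N\<close>, and the
    indices from 1 to \<open>N\<close> move down by one; as a cycle this is injective, so renaming
    is sound.\<close>
  define \<sigma> where "\<sigma> = (\<lambda>i. if i = 0 then N else if i \<le> N then i - 1 else i)"
  have inj: "inj \<sigma>" by (auto simp: inj_def \<sigma>_def split: if_splits)
  have "sat M e (rename_fm \<sigma> (Ex 0 \<phi>)) \<longleftrightarrow> (\<exists>a. P a e)" for e
  proof -
    have "sat M ((\<lambda>i. e (\<sigma> i))(0 := a)) \<phi> \<longleftrightarrow> sat M (case_nat a e) \<phi>" for a
      by (rule sat_cong) (auto simp: \<sigma>_def split: nat.split dest: N)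
    then show ?thesis by (auto simp: sat_rename_fm[OF inj] f simp del: rename_fm.simps)
  qed
  moreover have "wf_fm M (rename_fm \<sigma> (Ex 0 \<phi>))" using f by (intro wf_rename_fm) simp
  ultimately show ?thesis unfolding dpred_def by blast
qed

lemma dpred_all [dintros]:
  assumes "dpred (\<lambda>e. P (e 0) (\<lambda>i. e (Suc i)))"
  shows "dpred (\<lambda>e. \<forall>a. P a e)"
  using dpred_not[OF dpred_ex[of "\<lambda>a e. \<not> P a e", OF dpred_not[OF assms]]] by simp

lemma dpred_ex_tup [dintros]:
  assumes "dpred (\<lambda>e. P (map e [0..<n]) (\<lambda>i. e (i + n)))"
  shows "dpred (\<lambda>e. \<exists>x. length x = n \<and> P x e)"
  using assms
proof (induction n arbitrary: P)
  case 0 then show ?case by simp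
next
  case (Suc n)
  \<comment> \<open>The rotation sends the first entry of the block to position \<open>n\<close>, so
    that the remaining \<open>n\<close> entries start at 0, as the induction hypothesis
    expects.\<close>
  define \<sigma> where "\<sigma> = (\<lambda>i. if i = 0 then n else if i \<le> n then i - 1 else i)"
  have inj: "inj \<sigma>" by (auto simp: inj_def \<sigma>_def split: if_splits)
  have "dpred (\<lambda>e. P (map (\<lambda>i. e (\<sigma> i)) [0..<Suc n]) (\<lambda>i. e (\<sigma> (i + Suc n))))"
    using dpred_rename_inj[OF Suc.prems inj] .
  moreover have "map (\<lambda>i. e (\<sigma> i)) [0..<Suc n] = e n # map e [0..<n]" for e :: "nat \<Rightarrow> 'a"
    by (rule nth_equalityI) (auto simp: \<sigma>_def nth_Cons simp del: upt_Suc split: nat.split)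
  moreover have "(\<lambda>i. e (\<sigma> (i + Suc n))) = (\<lambda>i. e (Suc i + n))" for e :: "nat \<Rightarrow> 'a"
    by (auto simp: \<sigma>_def)
  ultimately have "dpred (\<lambda>e. P (e n # map e [0..<n]) (\<lambda>i. e (Suc i + n)))" by simp
  then have "dpred (\<lambda>e. \<exists>x. length x = n \<and> P (e 0 # x) (\<lambda>i. e (Suc i)))"
    by (intro Suc.IH[of "\<lambda>x e. P (e 0 # x) (\<lambda>i. e (Suc i))"]) simp
  then have "dpred (\<lambda>e. \<exists>a. \<exists>x. length x = n \<and> P (a # x) e)"
    by (rule dpred_ex)
  moreover have "(\<exists>x. length x = Suc n \<and> P x e) \<longleftrightarrow> (\<exists>a. \<exists>x. length x = n \<and> P (a # x) e)" for e
    by (metis length_Suc_conv)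
  ultimately show ?case by simp
qed

lemma dpred_all_tup [dintros]:
  assumes "dpred (\<lambda>e. P (map e [0..<n]) (\<lambda>i. e (i + n)))"
  shows "dpred (\<lambda>e. \<forall>x. length x = n \<longrightarrow> P x e)"
  using dpred_not[OF dpred_ex_tup[of "\<lambda>x e. \<not> P x e", OF dpred_not[OF assms]]] by simp

lemma dpred_all_less [dintros]:
  fixes k :: nat
  assumes "\<And>i. i < k \<Longrightarrow> dpred (P i)" shows "dpred (\<lambda>e. \<forall>i<k. P i e)"
  using assms
proof (induction k)
  case (Suc k)
  then have "dpred (\<lambda>e. (\<forall>i<k. P i e) \<and> P k e)" by (intro dintros) auto
  then show ?case by (simp add: less_Suc_eq all_conj_distrib imp_disjL conj_commute)
qed (simp add: dpred_const)

lemma dpred_ex_less [dintros]: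
  fixes k :: nat
  assumes "\<And>i. i < k \<Longrightarrow> dpred (P i)" shows "dpred (\<lambda>e. \<exists>i<k. P i e)"
  using dpred_not[OF dpred_all_less[of k "\<lambda>i e. \<not> P i e", OF dpred_not[OF assms]]] by simp

text \<open>Injectivity is avoided by not renaming at all: a fresh tuple is quantified and its
  entries are equated with the variables to be substituted.\<close>

lemma dpred_rename:
  assumes "dpred P" shows "dpred (\<lambda>e. P (\<lambda>i. e (\<sigma> i)))"
proof -
  obtain \<phi> where f: "wf_fm M \<phi>" "\<And>e. sat M e \<phi> \<longleftrightarrow> P e"
    using assms unfolding dpred_def by blast
  obtain N where N: "\<And>i. i \<in> free_vars \<phi> \<Longrightarrow> i < N" using free_bound[of \<phi>] by blast
  have "sat M (\<lambda>i. map e [0..<N] ! i) \<phi> \<longleftrightarrow> sat M e \<phi>" for e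
    by (rule sat_cong) (auto dest: N)
  then have "dpred (\<lambda>e. sat M (\<lambda>i. map e [0..<N] ! i) \<phi>)" using assms f by (simp add: f)
  moreover have "dpred (\<lambda>e. \<forall>i<N. map e [0..<N] ! i = e (\<sigma> i + N))"
    by (rule dpred_all_less) (simp add: dpred_var_eq)
  ultimately have "dpred (\<lambda>e. (\<forall>i<N. map e [0..<N] ! i = e (\<sigma> i + N)) \<and> sat M (\<lambda>i. map e [0..<N] ! i) \<phi>)"
    by (intro dpred_conj)
  then have "dpred (\<lambda>e. \<exists>x. length x = N \<and> (\<forall>i<N. x ! i = e (\<sigma> i)) \<and> sat M (\<lambda>i. x ! i) \<phi>)"
    by (rule dpred_ex_tup)
  moreover have "(\<exists>x. length x = N \<and> (\<forall>i<N. x ! i = e (\<sigma> i)) \<and> sat M (\<lambda>i. x ! i) \<phi>)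
       \<longleftrightarrow> P (\<lambda>i. e (\<sigma> i))" (is "?L = ?R") for e
  proof
    assume ?L then obtain x where x: "\<forall>i<N. x ! i = e (\<sigma> i)" "sat M (\<lambda>i. x ! i) \<phi>" by blast
    have "sat M (\<lambda>i. x ! i) \<phi> \<longleftrightarrow> sat M (\<lambda>i. e (\<sigma> i)) \<phi>" by (rule sat_cong) (use x N in auto)
    then show ?R using x f by simp
  next
    assume ?R
    have "sat M (\<lambda>i. map (\<lambda>i. e (\<sigma> i)) [0..<N] ! i) \<phi> \<longleftrightarrow> sat M (\<lambda>i. e (\<sigma> i)) \<phi>"
      by (rule sat_cong) (use N in auto)
    then show ?L using \<open>?R\<close> f by (intro exI[of _ "map (\<lambda>i. e (\<sigma> i)) [0..<N]"]) auto
  qed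
  ultimately show ?thesis by simp
qed

lemma dfun_var [dintros]: "dfun (\<lambda>e. e i)"
  unfolding dfun_def by (rule dpred_var_eq)

lemma dfun_const [dintros]: "dfun (\<lambda>e. c)"
  unfolding dfun_def dpred_def by (rule exI[of _ "Eq (Var 0) (Param c)"]) simp

lemma dfun_rename:
  assumes "dfun s" shows "dfun (\<lambda>e. s (\<lambda>i. e (\<sigma> i)))"
  using dpred_rename[OF assms[unfolded dfun_def], of "case_nat 0 (\<lambda>i. Suc (\<sigma> i))"]
  unfolding dfun_def by simp

lemma dpred_subst:
  assumes "dpred (\<lambda>e. P (e 0) (\<lambda>i. e (Suc i)))" "dfun s"
  shows "dpred (\<lambda>e. P (s e) e)"
proof -
  have "dpred (\<lambda>e. \<exists>a. a = s e \<and> P a e)"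
    by (intro dpred_ex dpred_conj) (use assms in \<open>auto simp: dfun_def\<close>)
  then show ?thesis by simp
qed

lemma dpred_eq [dintros]: "dfun s \<Longrightarrow> dfun t \<Longrightarrow> dpred (\<lambda>e. s e = t e)"
  by (rule dpred_subst[of "\<lambda>a e. a = t e"]) (simp_all add: dfun_def)

lemma dpred_less [dintros]:
  assumes "dfun s" "dfun t" shows "dpred (\<lambda>e. s e < t e)"
proof (rule dpred_subst[of "\<lambda>a e. a < t e"])
  have "dpred (\<lambda>e. e (Suc 0) < e 0)"
    unfolding dpred_def by (rule exI[of _ "Less (Var (Suc 0)) (Var 0)"]) simp
  then show "dpred (\<lambda>e. e 0 < t (\<lambda>i. e (Suc i)))"
    by (rule dpred_subst[of "\<lambda>b e. e 0 < b"]) (rule dfun_rename[OF assms(2)])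
qed fact

lemma dpred_le [dintros]:
  assumes "dfun s" "dfun t" shows "dpred (\<lambda>e. s e \<le> t e)"
  using dpred_not[OF dpred_less[OF assms(2,1)]] by (simp add: not_less)

lemma dpred_comp2:
  assumes "dpred (\<lambda>e. P (e 0) (e 1))" "dfun s" "dfun t"
  shows "dpred (\<lambda>e. P (s e) (t e))"
proof (rule dpred_subst[of "\<lambda>a e. P a (t e)"])
  show "dpred (\<lambda>e. P (e 0) (t (\<lambda>i. e (Suc i))))"
  proof (rule dpred_subst[of "\<lambda>b e. P (e 0) b"])
    show "dpred (\<lambda>e. P (e (Suc 0)) (e 0))"
      using dpred_rename[OF assms(1), of "case_nat 1 (\<lambda>i. 0)"] by simp
  qed (rule dfun_rename[OF assms(3)])
qed fact

lemma dtup_Nil [dintros]: "dtup (\<lambda>e. [])"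
  unfolding dtup_def by (rule exI[of _ "[]"]) simp

lemma dtup_Cons [dintros]: "dfun s \<Longrightarrow> dtup t \<Longrightarrow> dtup (\<lambda>e. s e # t e)"
  unfolding dtup_def
proof (elim exE conjE)
  fix ts assume "dfun s" "\<forall>s\<in>set ts. dfun s" "\<forall>e. t e = map (\<lambda>s. s e) ts"
  then show "\<exists>ts. (\<forall>s\<in>set ts. dfun s) \<and> (\<forall>e. s e # t e = map (\<lambda>s. s e) ts)"
    by (intro exI[of _ "s # ts"]) auto
qed

lemma dtup_append [dintros]: "dtup s \<Longrightarrow> dtup t \<Longrightarrow> dtup (\<lambda>e. s e @ t e)"
  unfolding dtup_def
proof (elim exE conjE)
  fix ss ts assume "\<forall>s\<in>set ss. dfun s" "\<forall>e. s e = map (\<lambda>s. s e) ss"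
    "\<forall>s\<in>set ts. dfun s" "\<forall>e. t e = map (\<lambda>s. s e) ts"
  then show "\<exists>ts. (\<forall>s\<in>set ts. dfun s) \<and> (\<forall>e. s e @ t e = map (\<lambda>s. s e) ts)"
    by (intro exI[of _ "ss @ ts"]) auto
qed

lemma dtup_block [dintros]: "dtup (\<lambda>e. map (\<lambda>i. e (f i)) xs)"
  unfolding dtup_def
  by (rule exI[of _ "map (\<lambda>i e. e (f i)) xs"]) (simp add: dfun_var)

lemma dtup_const [dintros]: "dtup (\<lambda>e. x)"
  unfolding dtup_def by (rule exI[of _ "map (\<lambda>c e. c) x"]) (simp add: dfun_const comp_def)

lemma dtup_rename:
  assumes "dtup t" shows "dtup (\<lambda>e. t (\<lambda>i. e (\<sigma> i)))"
proof -
  obtain ts where ts: "\<forall>s\<in>set ts. dfun s" "\<And>e. t e = map (\<lambda>s. s e) ts"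
    using assms unfolding dtup_def by blast
  show ?thesis unfolding dtup_def
    by (rule exI[of _ "map (\<lambda>s e. s (\<lambda>i. e (\<sigma> i))) ts"]) (use ts dfun_rename in auto)
qed

lemma dtup_length: "dtup t \<Longrightarrow> length (t e) = length (t e')"
  unfolding dtup_def by auto

lemma dpred_tup_eq_block:
  assumes "dtup t" shows "dpred (\<lambda>e. map e [0..<k] = t (\<lambda>i. e (i + k)))"
proof -
  obtain ts where ts: "\<forall>s\<in>set ts. dfun s" "\<And>e. t e = map (\<lambda>s. s e) ts"
    using assms unfolding dtup_def by blast
  have "dpred (\<lambda>e. length ts = k \<and> (\<forall>i<k. e i = t (\<lambda>i. e (i + k)) ! i))"
  proof (cases "length ts = k")
    case True
    have "dpred (\<lambda>e. e i = t (\<lambda>i. e (i + k)) ! i)" if "i < k" for i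
    proof -
      have "dfun (ts ! i)" using ts True that by simp
      then have "dpred (\<lambda>e. e i = (ts ! i) (\<lambda>i. e (i + k)))"
        by (rule dpred_eq[OF dfun_var dfun_rename])
      then show ?thesis using True that by (simp add: ts(2))
    qed
    then show ?thesis by (intro dpred_conj dpred_all_less dpred_const)
  qed (simp add: dpred_const)
  moreover have "(length ts = k \<and> (\<forall>i<k. e i = t (\<lambda>i. e (i + k)) ! i)) \<longleftrightarrow> map e [0..<k] = t (\<lambda>i. e (i + k))" for e
    by (auto simp: list_eq_iff_nth_eq ts(2))
  ultimately show ?thesis by simp
qed

lemma dpred_subst_tup:
  assumes "dpred (\<lambda>e. P (map e [0..<k]) (\<lambda>i. e (i + k)))" "dtup t" "\<And>e. length (t e) = k"
  shows "dpred (\<lambda>e. P (t e) e)"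
proof -
  have "dpred (\<lambda>e. \<exists>x. length x = k \<and> x = t e \<and> P x e)"
    by (intro dpred_ex_tup dpred_conj) (use assms in \<open>auto intro: dpred_tup_eq_block\<close>)
  then show ?thesis using assms(3) by simp
qed

lemma dpred_tup_eq [dintros]:
  assumes "dtup s" "dtup t" shows "dpred (\<lambda>e. s e = t e)"
  by (rule dpred_subst_tup[of "\<lambda>x e. x = t e", OF dpred_tup_eq_block[OF assms(2)] assms(1)
        dtup_length[OF assms(1)]])

lemma dpred_comp_tup:
  assumes "dpred (\<lambda>e. P (map e [0..<k]))" "dtup t" "\<And>x. P x \<Longrightarrow> length x = k"
  shows "dpred (\<lambda>e. P (t e))"
proof (cases "length (t undefined) = k")
  case True
  then have "length (t e) = k" for e using dtup_length[OF assms(2)] by metis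
  then show ?thesis using dpred_subst_tup[of "\<lambda>x e. P x" k t] assms by simp
next
  case False
  then have "\<not> P (t e)" for e using dtup_length[OF assms(2)] assms(3) by metis
  then show ?thesis by (simp add: dpred_const)
qed

lemma dpred_definable [dintros]:
  assumes "dtup t" "definable M k A"
  shows "dpred (\<lambda>e. t e \<in> A)"
proof (rule dpred_comp_tup[OF _ assms(1)])
  obtain \<phi> where f: "formula_in M k \<phi>" "A = {x \<in> tuples k. sat M (nth x) \<phi>}"
    using assms(2) unfolding definable_def by blast
  have "sat M (nth (map e [0..<k])) \<phi> \<longleftrightarrow> sat M e \<phi>" for e
    by (rule sat_cong) (use f in \<open>auto simp: formula_in_def\<close>)
  then show "dpred (\<lambda>e. map e [0..<k] \<in> A)" using f unfolding dpred_def 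
    by (auto simp: tuples_def formula_in_def)
  show "\<And>x. x \<in> A \<Longrightarrow> length x = k" using f by (simp add: tuples_def)
qed

text \<open>The formula behind \<open>P\<close> may mention variables from \<open>k\<close> on
  although they have no influence. They are removed by existential quantification, the highest
  first.\<close>

lemma exists_closing_formula:
  assumes "dpred P" "\<And>e e'. (\<And>i. i < k \<Longrightarrow> e i = e' i) \<Longrightarrow> P e \<longleftrightarrow> P e'"
  shows "\<exists>\<phi>. formula_in M k \<phi> \<and> (\<forall>e. sat M e \<phi> \<longleftrightarrow> P e)"
proof -
  obtain \<phi> where f: "wf_fm M \<phi>" "\<And>e. sat M e \<phi> \<longleftrightarrow> P e"
    using assms unfolding dpred_def by blast
  obtain N where N: "\<And>i. i \<in> free_vars \<phi> \<Longrightarrow> i < N" using free_bound[of \<phi>] by blast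
  have *: "\<exists>\<psi>. wf_fm M \<psi> \<and> (\<forall>i\<in>free_vars \<psi>. i < k + (N - m)) \<and> (\<forall>e. sat M e \<psi> \<longleftrightarrow> P e)" for m
  proof (induction m)
    case 0 then show ?case using f N by force
  next
    case (Suc m)
    then obtain \<psi> where p: "wf_fm M \<psi>" "\<forall>i\<in>free_vars \<psi>. i < k + (N - m)" "\<And>e. sat M e \<psi> \<longleftrightarrow> P e" by blast
    show ?case
    proof (cases "m < N")
      case True
      let ?j = "k + (N - Suc m)"
      have "P (e(?j := a)) = P e" for e a by (rule assms(2)) auto
      then have "\<forall>e. sat M e (Ex ?j \<psi>) \<longleftrightarrow> P e" using p by simp
      moreover have "\<forall>i\<in>free_vars (Ex ?j \<psi>). i < ?j" using p(2) True by fastforce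
      ultimately show ?thesis using p by (intro exI[of _ "Ex ?j \<psi>"]) auto
    next
      case False then show ?thesis using p by auto
    qed
  qed
  from *[of N] show ?thesis by (auto simp: formula_in_def subset_iff)
qed

lemma definableI:
  assumes "dpred (\<lambda>e. map e [0..<k] \<in> A)" "A \<subseteq> tuples k"
  shows "definable M k A"
proof -
  have "\<exists>\<phi>. formula_in M k \<phi> \<and> (\<forall>e. sat M e \<phi> \<longleftrightarrow> map e [0..<k] \<in> A)"
  proof (rule exists_closing_formula[OF assms(1)])
    fix e e' :: "nat \<Rightarrow> 'a" assume "\<And>i. i < k \<Longrightarrow> e i = e' i"
    then have "map e [0..<k] = map e' [0..<k]" by (intro map_cong) auto
    then show "map e [0..<k] \<in> A \<longleftrightarrow> map e' [0..<k] \<in> A" by (rule arg_cong)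
  qed
  then obtain \<phi> where f: "formula_in M k \<phi>" "\<And>e. sat M e \<phi> \<longleftrightarrow> map e [0..<k] \<in> A" by blast
  have "map (nth x) [0..<k] = x" if "length x = k" for x using that by (metis map_nth)
  then have "A = {x \<in> tuples k. sat M (nth x) \<phi>}" using f(2) assms(2) by (auto simp: tuples_def)
  then show ?thesis using f(1) unfolding definable_def by blast
qed

lemma dfun_nth [dintros]:
  assumes "dtup t" shows "dfun (\<lambda>e. t e ! i)"
proof -
  obtain ts where ts: "\<forall>s\<in>set ts. dfun s" "\<And>e. t e = map (\<lambda>s. s e) ts"
    using assms unfolding dtup_def by blast
  show ?thesis
  proof (cases "i < length ts")
    case True then show ?thesis using ts by simp
  next
    case False
    then have "(\<lambda>e. t e ! i) = (\<lambda>e. [] ! (i - length ts))" using ts(2) nth_beyond by (metis length_map not_le)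
    then show ?thesis by (simp add: dfun_const)
  qed
qed

lemma dpred_length: "dtup t \<Longrightarrow> dpred (\<lambda>e. length (t e) = k)"
proof -
  assume "dtup t"
  then have "(\<lambda>e. length (t e) = k) = (\<lambda>e. length (t undefined) = k)" using dtup_length by metis
  then show ?thesis by (simp add: dpred_const)
qed

lemma definable_subset: "definable M k A \<Longrightarrow> A \<subseteq> tuples k"
  unfolding definable_def by (elim exE conjE) simp

lemma dpred_subst_env:
  assumes "dpred P" "\<And>i. dfun (s i)"
  shows "dpred (\<lambda>e. P (\<lambda>i. s i e))"
proof -
  obtain \<phi> where f: "wf_fm M \<phi>" "\<And>e. sat M e \<phi> \<longleftrightarrow> P e"
    using assms unfolding dpred_def by blast
  obtain N where N: "\<And>i. i \<in> free_vars \<phi> \<Longrightarrow> i < N" using free_bound[of \<phi>] by blast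
  have 1: "sat M (\<lambda>i. map e [0..<N] ! i) \<phi> \<longleftrightarrow> P e" for e
    unfolding f(2)[symmetric] by (rule sat_cong) (auto dest: N)
  have 2: "dtup (\<lambda>e. map (\<lambda>i. s i e) [0..<N])"
    unfolding dtup_def by (rule exI[of _ "map s [0..<N]"]) (use assms in auto)
  have "dpred (\<lambda>e. sat M (\<lambda>i. map (\<lambda>i. s i e) [0..<N] ! i) \<phi>)"
    by (rule dpred_subst_tup[OF _ 2]) (use assms in \<open>simp_all add: 1\<close>)
  moreover have "sat M (\<lambda>i. map (\<lambda>i. s i e) [0..<N] ! i) \<phi> \<longleftrightarrow> sat M (\<lambda>i. s i e) \<phi>" for e
    by (rule sat_cong) (auto dest: N)
  ultimately show ?thesis by (simp add: f)
qed

lemma dpred_section: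
  assumes "dpred (\<lambda>e. Q (e 0) (\<lambda>i. e (Suc i)))"
  shows "dpred (\<lambda>e'. Q (e' 0) e)"
proof -
  have "dfun (case_nat (\<lambda>e'. e' 0) (\<lambda>i e'. e i) j)" for j
    by (cases j) (simp_all add: dfun_var dfun_const)
  from dpred_subst_env[of "\<lambda>e. Q (e 0) (\<lambda>i. e (Suc i))", OF assms, of "case_nat (\<lambda>e'. e' 0) (\<lambda>i e'. e i)", OF this]
  show ?thesis by simp
qed

lemma dpred_section_tup:
  assumes "dpred (\<lambda>e. T (map e [0..<n]) (\<lambda>i. e (i + n)))"
  shows "dpred (\<lambda>e'. T (map e' [0..<n]) e)"
proof -
  let ?s = "\<lambda>i. if i < n then (\<lambda>e'. e' i) else (\<lambda>e'. e (i - n))"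
  have eq: "map (\<lambda>i. ?s i e') [0..<n] = map e' [0..<n]" for e' :: "nat \<Rightarrow> 'a"
    by (rule map_cong) auto
  have "dfun (?s i)" for i by (simp add: dfun_var dfun_const)
  from dpred_subst_env[OF assms, of ?s, OF this] show ?thesis unfolding eq by simp
qed

lemma dpred_comp1: "dpred (\<lambda>e. P (e 0)) \<Longrightarrow> dfun s \<Longrightarrow> dpred (\<lambda>e. P (s e))"
  by (rule dpred_subst)

lemma dfun_comp1:
  assumes "dfun (\<lambda>e. f (e 0))" "dfun s" shows "dfun (\<lambda>e. f (s e))"
  using dpred_comp2[of "\<lambda>a b. a = f b", OF _ dfun_var[of 0] dfun_rename[OF assms(2), of Suc]] assms(1)
  unfolding dfun_def by simp

lemma dpred_card_ge:
  assumes "dpred (\<lambda>e. Q (e 0) (\<lambda>i. e (Suc i)))" "\<And>e. finite {a. Q a e}"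
  shows "dpred (\<lambda>e. k \<le> card {a. Q a e})"
proof -
  have "dpred (\<lambda>e. (\<forall>i<k. Q (map e [0..<k] ! i) (\<lambda>i. e (i + k))) \<and> (\<forall>i<k. \<forall>j<i. map e [0..<k] ! i \<noteq> map e [0..<k] ! j))"
  proof (intro dpred_conj dpred_all_less dpred_not)
    fix i assume "i < k"
    then show "dpred (\<lambda>e. Q (map e [0..<k] ! i) (\<lambda>i. e (i + k)))"
      using dpred_rename[OF assms(1), of "case_nat i (\<lambda>i. i + k)"] by simp
    fix j assume "j < i"
    then show "dpred (\<lambda>e. map e [0..<k] ! i = map e [0..<k] ! j)"
      using \<open>i < k\<close> dpred_var_eq by simp
  qed
  then have "dpred (\<lambda>e. \<exists>x. length x = k \<and> (\<forall>i<k. Q (x ! i) e) \<and> (\<forall>i<k. \<forall>j<i. x ! i \<noteq> x ! j))"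
    by (rule dpred_ex_tup)
  moreover have "(\<exists>x. length x = k \<and> (\<forall>i<k. Q (x ! i) e) \<and> (\<forall>i<k. \<forall>j<i. x ! i \<noteq> x ! j)) \<longleftrightarrow> k \<le> card {a. Q a e}"
    (is "?L = ?R") for e
  proof
    assume ?L
    then obtain x where x: "length x = k" "\<forall>i<k. Q (x ! i) e" "\<forall>i<k. \<forall>j<i. x ! i \<noteq> x ! j" by blast
    have "distinct x" using x by (metis distinct_conv_nth linorder_neqE_nat)
    moreover have "set x \<subseteq> {a. Q a e}" using x by (auto simp: in_set_conv_nth)
    ultimately show ?R using card_mono[OF assms(2)] x by (metis distinct_card)
  next
    assume ?R
    then obtain Y where Y: "Y \<subseteq> {a. Q a e}" "card Y = k" "finite Y"
      using obtain_subset_with_card_n by metis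
    then obtain x where x: "set x = Y" "distinct x" using finite_distinct_list by blast
    have "length x = k" using x Y distinct_card by metis
    moreover have "Q (x ! i) e" if "i < k" for i
    proof -
      have "x ! i \<in> Y" using that calculation x(1) nth_mem[of i x] by simp
      then show ?thesis using Y(1) by blast
    qed
    moreover have "x ! i \<noteq> x ! j" if "i < k" "j < i" for i j
      using x(2) that calculation(1) by (simp add: nth_eq_iff_index_eq)
    ultimately show ?L by (intro exI[of _ x]) simp
  qed
  ultimately show ?thesis by simp
qed

lemma dpred_card_eq:
  assumes "dpred (\<lambda>e. Q (e 0) (\<lambda>i. e (Suc i)))" "\<And>e. finite {a. Q a e}"
  shows "dpred (\<lambda>e. card {a. Q a e} = k)"
proof -
  have "dpred (\<lambda>e. k \<le> card {a. Q a e} \<and> \<not> Suc k \<le> card {a. Q a e})"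
    by (intro dpred_conj dpred_not dpred_card_ge[of Q, OF assms])
  moreover have "(\<lambda>e. k \<le> card {a. Q a e} \<and> \<not> Suc k \<le> card {a. Q a e}) = (\<lambda>e. card {a. Q a e} = k)"
    by auto
  ultimately show ?thesis by simp
qed

end

section \<open>O-minimal structures expanding an ordered field\<close>

text \<open>Makes the lemmas on type class fields available for operations that are not those of the
  type. Inverse, sign and absolute value are defined so as to meet the class axioms, in particular
  with inverse 0 at 0.\<close>

lemma linordered_field_of_ordered_field_on:
  fixes F :: "('a::linorder) ring"
  assumes "ordered_field_on F"
  shows "class.linordered_field (\<lambda>x y. x \<otimes>\<^bsub>F\<^esub> (if y = \<zero>\<^bsub>F\<^esub> then \<zero>\<^bsub>F\<^esub> else inv\<^bsub>F\<^esub> y))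
    (\<lambda>x. if x = \<zero>\<^bsub>F\<^esub> then \<zero>\<^bsub>F\<^esub> else inv\<^bsub>F\<^esub> x) (mult F) \<one>\<^bsub>F\<^esub> (add F) \<zero>\<^bsub>F\<^esub>
    (a_minus F) (a_inv F) (\<le>) (<)
    (\<lambda>x. if x = \<zero>\<^bsub>F\<^esub> then \<zero>\<^bsub>F\<^esub> else if \<zero>\<^bsub>F\<^esub> < x then \<one>\<^bsub>F\<^esub> else a_inv F \<one>\<^bsub>F\<^esub>)
    (\<lambda>x. if x < \<zero>\<^bsub>F\<^esub> then a_inv F x else x)"
proof -
  interpret field F using assms unfolding ordered_field_on_def by blast
  have c [simp]: "x \<in> carrier F" for x using assms unfolding ordered_field_on_def by blast
  have add: "x \<oplus>\<^bsub>F\<^esub> z < y \<oplus>\<^bsub>F\<^esub> z" if "x < y" for x y z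
    using that assms unfolding ordered_field_on_def by blast
  have mult: "\<zero>\<^bsub>F\<^esub> < x \<otimes>\<^bsub>F\<^esub> y" if "\<zero>\<^bsub>F\<^esub> < x" "\<zero>\<^bsub>F\<^esub> < y" for x y
    using that assms unfolding ordered_field_on_def by blast
  have inv: "inv\<^bsub>F\<^esub> x \<otimes>\<^bsub>F\<^esub> x = \<one>\<^bsub>F\<^esub>" "x \<otimes>\<^bsub>F\<^esub> inv\<^bsub>F\<^esub> x = \<one>\<^bsub>F\<^esub>" if "x \<noteq> \<zero>\<^bsub>F\<^esub>" for x
    using that field_Units Units_l_inv Units_r_inv by simp_all
  have mult2: "x \<otimes>\<^bsub>F\<^esub> z < y \<otimes>\<^bsub>F\<^esub> z" if "x < y" "\<zero>\<^bsub>F\<^esub> < z" for x y z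
  proof -
    have "\<zero>\<^bsub>F\<^esub> < y \<ominus>\<^bsub>F\<^esub> x" using add[OF that(1), of "\<ominus>\<^bsub>F\<^esub> x"] by (simp add: r_neg minus_eq)
    from mult[OF this that(2)]
    have "\<zero>\<^bsub>F\<^esub> \<oplus>\<^bsub>F\<^esub> x \<otimes>\<^bsub>F\<^esub> z < ((y \<ominus>\<^bsub>F\<^esub> x) \<otimes>\<^bsub>F\<^esub> z) \<oplus>\<^bsub>F\<^esub> x \<otimes>\<^bsub>F\<^esub> z" by (rule add)
    also have "((y \<ominus>\<^bsub>F\<^esub> x) \<otimes>\<^bsub>F\<^esub> z) \<oplus>\<^bsub>F\<^esub> x \<otimes>\<^bsub>F\<^esub> z = y \<otimes>\<^bsub>F\<^esub> z"
      by (simp add: l_distr[symmetric] minus_eq a_assoc l_neg)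
    finally show ?thesis by simp
  qed
  have le: "x \<oplus>\<^bsub>F\<^esub> z \<le> y \<oplus>\<^bsub>F\<^esub> z" if "x \<le> y" for x y z using add[of x y z] that by (auto simp: le_less)
  have neg1: "x \<oplus>\<^bsub>F\<^esub> (y \<oplus>\<^bsub>F\<^esub> \<ominus>\<^bsub>F\<^esub> x) = y" for x y
    using a_lcomm[of x y "\<ominus>\<^bsub>F\<^esub> x"] by (simp add: r_neg)
  have neg2: "x \<oplus>\<^bsub>F\<^esub> (\<ominus>\<^bsub>F\<^esub> y \<oplus>\<^bsub>F\<^esub> \<ominus>\<^bsub>F\<^esub> z) = x \<oplus>\<^bsub>F\<^esub> \<ominus>\<^bsub>F\<^esub> (y \<oplus>\<^bsub>F\<^esub> z)" for x y z
    by (simp add: minus_add)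
  have mult3: "x \<otimes>\<^bsub>F\<^esub> z \<le> y \<otimes>\<^bsub>F\<^esub> z" "x \<otimes>\<^bsub>F\<^esub> z \<noteq> y \<otimes>\<^bsub>F\<^esub> z"
    if "x \<le> y" "x \<noteq> y" "\<zero>\<^bsub>F\<^esub> \<le> z" "\<zero>\<^bsub>F\<^esub> \<noteq> z" for x y z
    using mult2[OF order.not_eq_order_implies_strict[OF that(2,1)]
      order.not_eq_order_implies_strict[OF that(4,3)]] by auto
  show ?thesis
    by unfold_locales
      (auto simp: a_ac m_ac l_distr r_distr minus_eq l_neg r_neg inv less_le le neg1 neg2 dest: mult3)
qed

section \<open>Infima and boundaries of definable subsets of the line\<close>

text \<open>Each of the three alternatives survives adding one more interval; in the last one the
  minimum of the two infima is the new infimum.\<close>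

lemma glb_of_union_of_intervals:
  fixes \<I> :: "'a::linorder set set"
  assumes "finite \<I>" "\<forall>I\<in>\<I>. point_or_interval I"
    and dense: "\<And>a b::'a. a < b \<Longrightarrow> \<exists>c. a < c \<and> c < b"
    and unb: "\<And>a::'a. \<exists>c. c < a"
  shows "\<Union>\<I> = {} \<or> (\<forall>c. \<exists>a\<in>\<Union>\<I>. a < c) \<or> (\<exists>m. (\<forall>a\<in>\<Union>\<I>. m \<le> a) \<and> (\<forall>y>m. \<exists>a\<in>\<Union>\<I>. a < y))"
  using assms(1,2)
proof (induction \<I> rule: finite_induct)
  case (insert I \<I>)
  have I: "I = {} \<or> (\<forall>c. \<exists>a\<in>I. a < c) \<or> (\<exists>m. (\<forall>a\<in>I. m \<le> a) \<and> (\<forall>y>m. \<exists>a\<in>I. a < y))"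
  proof -
    have "point_or_interval I" using insert.prems by simp
    then consider a where "I = {a}" | a b where "I = {a<..<b}" | a where "I = {a<..}" | b where "I = {..<b}" | "I = UNIV"
      unfolding point_or_interval_def by blast
    then show ?thesis
    proof cases
      case 1 then show ?thesis by auto
    next
      case (2 a b)
      show ?thesis
      proof (cases "a < b")
        case True
        have "\<exists>x\<in>I. x < y" if "a < y" for y
          using dense[of a "min y b"] that True 2 by auto
        then show ?thesis using 2 by (auto intro!: exI[of _ a])
      qed (use 2 in auto)
    next
      case (3 a)
      have "\<exists>x\<in>I. x < y" if "a < y" for y using dense[of a y] that 3 by auto
      then show ?thesis using 3 by (auto intro!: exI[of _ a])
    next
      case (4 b)
      have "\<exists>a\<in>I. a < c" for c using unb[of "min b c"] 4 by auto
      then show ?thesis by blast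
    next
      case 5 then show ?thesis using unb by auto
    qed
  qed
  have J: "\<Union>\<I> = {} \<or> (\<forall>c. \<exists>a\<in>\<Union>\<I>. a < c) \<or> (\<exists>m. (\<forall>a\<in>\<Union>\<I>. m \<le> a) \<and> (\<forall>y>m. \<exists>a\<in>\<Union>\<I>. a < y))"
    using insert by simp
  let ?K = "\<Union>\<I>"
  consider "I = {}" | "?K = {}" | "\<forall>c. \<exists>a\<in>I. a < c" | "\<forall>c. \<exists>a\<in>?K. a < c"
    | m m' where "\<forall>a\<in>I. m \<le> a" "\<forall>y>m. \<exists>a\<in>I. a < y" "\<forall>a\<in>?K. m' \<le> a" "\<forall>y>m'. \<exists>a\<in>?K. a < y"
    using I J by (elim disjE exE conjE) simp_all
  then show ?case
  proof cases
    case 1 then show ?thesis using J by simp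
  next
    case 2
    then have e: "\<Union>(insert I \<I>) = I" unfolding Union_insert 2 by simp
    show ?thesis unfolding e using I .
  next
    case 3
    then have "\<forall>c. \<exists>a\<in>\<Union>(insert I \<I>). a < c" by (meson UnionI insertI1)
    then show ?thesis by blast
  next
    case 4
    then have "\<forall>c. \<exists>a\<in>\<Union>(insert I \<I>). a < c" by (metis UnCI Union_insert)
    then show ?thesis by blast
  next
    case (5 m m')
    have "min m m' \<le> a" if "a \<in> \<Union>(insert I \<I>)" for a
      using that 5(1,3) by (auto simp: min_le_iff_disj)
    moreover have "\<exists>a\<in>\<Union>(insert I \<I>). a < y" if "min m m' < y" for y
    proof -
      have "m < y \<or> m' < y" using that by (simp add: min_less_iff_disj)
      then show ?thesis using 5(2,4) by (metis UnCI Union_insert)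
    qed
    ultimately show ?thesis by blast
  qed
qed simp

text \<open>Two structures live on the same type: plain \<open>0\<close> and \<open>+\<close> belong
  to the group, bold and subscripted operations to the field. Only the order is common to
  both.\<close>

locale o_minimal_field = expn M +
  fld: linordered_field div\<^sub>F inv\<^sub>F times\<^sub>F one\<^sub>F plus\<^sub>F zero\<^sub>F minus\<^sub>F neg\<^sub>F "(\<le>)" "(<)" sgn\<^sub>F abs\<^sub>F
  for M :: "('a::linordered_group_add, 'f, 'r) expansion"
    and div\<^sub>F :: "'a \<Rightarrow> 'a \<Rightarrow> 'a" and inv\<^sub>F :: "'a \<Rightarrow> 'a" and times\<^sub>F :: "'a \<Rightarrow> 'a \<Rightarrow> 'a" (infixl "\<^bold>*" 70)
    and one\<^sub>F :: 'a and plus\<^sub>F :: "'a \<Rightarrow> 'a \<Rightarrow> 'a" (infixl "\<^bold>+" 65) and zero\<^sub>F :: 'a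
    and minus\<^sub>F :: "'a \<Rightarrow> 'a \<Rightarrow> 'a" (infixl "\<^bold>-" 65) and neg\<^sub>F :: "'a \<Rightarrow> 'a"
    and sgn\<^sub>F :: "'a \<Rightarrow> 'a" and abs\<^sub>F :: "'a \<Rightarrow> 'a" +
  assumes o_min: "o_minimal M"
    and definable_plus: "definable_op M (\<^bold>+)"
    and definable_times: "definable_op M (\<^bold>*)"
begin

lemma dfun_op:
  assumes "definable_op M g" "dfun s" "dfun t" shows "dfun (\<lambda>e. g (s e) (t e))"
proof -
  have "dpred (\<lambda>e. [s (\<lambda>i. e (Suc i)), t (\<lambda>i. e (Suc i)), e 0] \<in> {[x, y, g x y] | x y. True})"
    using assms(1) dfun_rename[OF assms(2), of Suc] dfun_rename[OF assms(3), of Suc]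
    unfolding definable_op_def by (intro dpred_definable dtup_Cons dtup_Nil dfun_var)
  then show ?thesis unfolding dfun_def by simp
qed

lemma dfun_plus [dintros]: "dfun s \<Longrightarrow> dfun t \<Longrightarrow> dfun (\<lambda>e. s e \<^bold>+ t e)"
  by (rule dfun_op[OF definable_plus])

lemma dfun_times [dintros]: "dfun s \<Longrightarrow> dfun t \<Longrightarrow> dfun (\<lambda>e. s e \<^bold>* t e)"
  by (rule dfun_op[OF definable_times])

lemma dfun_minus [dintros]:
  assumes "dfun s" "dfun t" shows "dfun (\<lambda>e. s e \<^bold>- t e)"
proof -
  have "dpred (\<lambda>e. e 0 \<^bold>+ t (\<lambda>i. e (Suc i)) = s (\<lambda>i. e (Suc i)))"
    by (intro dpred_eq dfun_plus dfun_var dfun_rename[OF assms(1), of Suc] dfun_rename[OF assms(2), of Suc])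
  then show ?thesis unfolding dfun_def by (simp add: fld.eq_diff_eq)
qed

lemma dense: "a < b \<Longrightarrow> \<exists>c. a < c \<and> c < (b::'a)"
  by (rule fld.dense)

lemma ex_less: "\<exists>c. c < (a::'a)"
  by (rule fld.lt_ex)

lemma ex_greater: "\<exists>c. (a::'a) < c"
  by (rule fld.gt_ex)

lemma infinite_interval: "a < (b::'a) \<Longrightarrow> infinite {a<..<b}"
  using fld.infinite_Ioo[of a b]
  by (simp add: ord.greaterThanLessThan_def ord.greaterThan_def ord.lessThan_def greaterThanLessThan_def greaterThan_def lessThan_def)

lemma union_of_intervals:
  assumes "dpred (\<lambda>e. Q (e 0))"
  shows "\<exists>\<I>. finite \<I> \<and> (\<forall>I\<in>\<I>. point_or_interval I) \<and> {a. Q a} = \<Union>\<I>"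
proof -
  have "definable M 1 {[a] | a. Q a}"
    by (rule definableI) (use assms in \<open>auto simp: tuples_def\<close>)
  then show ?thesis using o_min unfolding o_minimal_def by fastforce
qed

lemma infinite_imp_interval:
  assumes "dpred (\<lambda>e. Q (e 0))" "infinite {a. Q a}"
  shows "\<exists>u v. u < v \<and> (\<forall>w. u < w \<and> w < v \<longrightarrow> Q w)"
proof -
  obtain \<I> where I: "finite \<I>" "\<forall>I\<in>\<I>. point_or_interval I" "{a. Q a} = \<Union>\<I>"
    using union_of_intervals[OF assms(1)] by blast
  then obtain I where "I \<in> \<I>" "infinite I" using assms(2) finite_Union[of \<I>] by metis
  then have sub: "\<And>w. w \<in> I \<Longrightarrow> Q w" and "point_or_interval I" using I by auto
  then consider a where "I = {a}" | a b where "I = {a<..<b}" | a where "I = {a<..}" | b where "I = {..<b}" | "I = UNIV"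
    unfolding point_or_interval_def by blast
  then show ?thesis
  proof cases
    case 1 then show ?thesis using \<open>infinite I\<close> by simp
  next
    case (2 a b)
    then have "a < b" using \<open>infinite I\<close> by (cases "a < b") auto
    then show ?thesis using 2 sub by auto
  next
    case (3 a) then show ?thesis using sub ex_greater[of a] by auto
  next
    case (4 b) then show ?thesis using sub ex_less[of b] by auto
  next
    case 5 then show ?thesis using sub ex_less by blast
  qed
qed

lemma infinite_iff_interval:
  assumes "dpred (\<lambda>e. Q (e 0))"
  shows "infinite {a. Q a} \<longleftrightarrow> (\<exists>u v. u < v \<and> (\<forall>w. u < w \<and> w < v \<longrightarrow> Q w))"
proof
  assume "\<exists>u v. u < v \<and> (\<forall>w. u < w \<and> w < v \<longrightarrow> Q w)"
  then obtain u v where "u < v" "{u<..<v} \<subseteq> {a. Q a}" by (metis greaterThanLessThan_iff mem_Collect_eq subsetI)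
  then show "infinite {a. Q a}" using infinite_interval infinite_super by blast
qed (rule infinite_imp_interval[OF assms])

text \<open>For a definable subset of the line, being infinite means containing an interval, so
  "infinitely many" is a first-order quantifier.\<close>

lemma dpred_infinite [dintros]:
  assumes "dpred (\<lambda>e. Q (e 0) (\<lambda>i. e (Suc i)))"
  shows "dpred (\<lambda>e. infinite {a. Q a e})"
proof -
  have "dpred (\<lambda>e. Q (e 0) (\<lambda>i. e (i + 3)))"
    using dpred_rename[OF assms, of "case_nat 0 (\<lambda>i. i + 3)"] by simp
  then have "dpred (\<lambda>e. \<exists>u v. u < v \<and> (\<forall>w. u < w \<and> w < v \<longrightarrow> Q w e))"
    by (intro dintros) (simp_all add: numeral_3_eq_3)
  then show ?thesis using infinite_iff_interval[OF dpred_section[OF assms]] by simp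
qed

text \<open>O-minimality stands in for Dedekind completeness. Nothing is claimed about the cut point
  \<open>m\<close> itself.\<close>

lemma upper_set_cut:
  assumes "dpred (\<lambda>e. U (e 0))" and up: "\<And>x y. U x \<Longrightarrow> x \<le> y \<Longrightarrow> U y" and "U b" "\<not> U a"
  shows "\<exists>m. \<forall>y. (m < y \<longrightarrow> U y) \<and> (y < m \<longrightarrow> \<not> U y)"
proof -
  obtain \<I> where I: "finite \<I>" "\<forall>I\<in>\<I>. point_or_interval I" "{a. U a} = \<Union>\<I>"
    using union_of_intervals[OF assms(1)] by blast
  have "{a. U a} = {} \<or> (\<forall>c. \<exists>a\<in>{a. U a}. a < c) \<or> (\<exists>m. (\<forall>a\<in>{a. U a}. m \<le> a) \<and> (\<forall>y>m. \<exists>a\<in>{a. U a}. a < y))"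
    using glb_of_union_of_intervals[OF I(1,2) dense ex_less] I(3) by simp
  moreover have "\<not> (\<forall>c. \<exists>x\<in>{a. U a}. x < c)" using assms(4) up[of _ a] by (meson less_imp_le mem_Collect_eq)
  moreover have "{a. U a} \<noteq> {}" using assms(3) by blast
  ultimately obtain m where "\<forall>a. U a \<longrightarrow> m \<le> a" "\<forall>y>m. \<exists>a. U a \<and> a < y"
    by auto
  then show ?thesis using up by (metis less_imp_le not_le)
qed

definition boundary :: "('a \<Rightarrow> bool) \<Rightarrow> 'a \<Rightarrow> bool" where
  "boundary Q y \<longleftrightarrow> (\<forall>u v. u < y \<and> y < v \<longrightarrow> (\<exists>w. u < w \<and> w < v \<and> Q w) \<and> (\<exists>w. u < w \<and> w < v \<and> \<not> Q w))"

lemma dpred_boundary [dintros]: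
  assumes "dpred (\<lambda>e. Q (e 0) (\<lambda>i. e (Suc i)))" "dfun s"
  shows "dpred (\<lambda>e. boundary (\<lambda>a. Q a e) (s e))"
proof (rule dpred_subst[OF _ assms(2)])
  have "dpred (\<lambda>e. Q (e 0) (\<lambda>i. e (Suc (Suc (Suc (Suc i))))))"
    using dpred_rename[OF assms(1), of "case_nat 0 (\<lambda>i. i + 4)"] by (simp add: numeral_eq_Suc)
  then show "dpred (\<lambda>e. boundary (\<lambda>a. Q a (\<lambda>i. e (Suc i))) (e 0))"
    unfolding boundary_def by (intro dintros)
qed

text \<open>Infinitely many boundary points would fill an interval. On it \<open>Q\<close> or its
  negation holds infinitely often, hence on a subinterval, whose points are then not boundary
  points.\<close>

lemma finite_boundary:
  assumes "dpred (\<lambda>e. Q (e 0))" shows "finite {y. boundary Q y}"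
proof (rule ccontr)
  have *: False if Q: "dpred (\<lambda>e. Q (e 0))" and inf: "infinite {w. u < w \<and> w < v \<and> Q w}" 
    and b: "\<And>w. u < w \<Longrightarrow> w < v \<Longrightarrow> boundary Q w" for u v and Q
  proof -
    have "dpred (\<lambda>e. u < e 0 \<and> e 0 < v \<and> Q (e 0))" using Q by (intro dintros)
    then obtain u' v' where "u' < v'" and i: "\<And>w. u' < w \<Longrightarrow> w < v' \<Longrightarrow> u < w \<and> w < v \<and> Q w"
      using infinite_imp_interval[OF _ inf] by blast
    then obtain w where "u' < w" "w < v'" using dense by blast
    then show False using b[of w] i unfolding boundary_def by blast
  qed
  assume "infinite {y. boundary Q y}"
  moreover have "dpred (\<lambda>e. boundary Q (e 0))"
    by (rule dpred_boundary[OF _ dfun_var]) (use assms in simp)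
  ultimately obtain u v where "u < v" and b: "\<And>w. u < w \<Longrightarrow> w < v \<Longrightarrow> boundary Q w"
    using infinite_imp_interval by blast
  have eq: "{u<..<v} = {w. u < w \<and> w < v \<and> Q w} \<union> {w. u < w \<and> w < v \<and> \<not> Q w}" by auto
  then have "infinite {w. u < w \<and> w < v \<and> Q w} \<or> infinite {w. u < w \<and> w < v \<and> \<not> Q w}"
    using infinite_interval[OF \<open>u < v\<close>] unfolding eq by simp
  moreover have "boundary (\<lambda>w. \<not> Q w) w" if "u < w" "w < v" for w using b[OF that] unfolding boundary_def by blast
  ultimately show False using *[OF assms _ b] *[OF dpred_not[OF assms]] by blast
qed

lemma boundary_between:
  assumes Q: "dpred (\<lambda>e. Q (e 0))" and "a < b" "Q a \<noteq> Q b"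
  shows "\<exists>y. a \<le> y \<and> y \<le> b \<and> boundary Q y"
proof -
  have *: "\<exists>y. a \<le> y \<and> y \<le> b \<and> boundary Q y" if Q: "dpred (\<lambda>e. Q (e 0))" and ab: "a < b" "Q a" "\<not> Q b" for Q
  proof -
    \<comment> \<open>The cut of \<open>U\<close> is the infimum of the failures of \<open>Q\<close>
      from \<open>a\<close> on; it is the boundary point sought.\<close>
    define U where "U y \<longleftrightarrow> (\<exists>z. a \<le> z \<and> z \<le> y \<and> \<not> Q z)" for y
    have "dpred (\<lambda>e. U (e 0))" unfolding U_def using Q by (intro dintros)
    moreover have "U b" "\<not> U a" using ab unfolding U_def by (auto intro: exI[of _ b])
    moreover have "U y" if "U x" "x \<le> y" for x y using that unfolding U_def by (meson order_trans)
    ultimately obtain m where m: "\<And>y. m < y \<Longrightarrow> U y" "\<And>y. y < m \<Longrightarrow> \<not> U y"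
      using upper_set_cut[of U b a] by blast
    have am: "a \<le> m" using m(1) \<open>\<not> U a\<close> by (meson not_le)
    have mb: "m \<le> b" using m(2) \<open>U b\<close> by (meson not_le)
    have below: "Q w" if "a \<le> w" "w < m" for w using m(2)[OF that(2)] that unfolding U_def by blast
    have "boundary Q m" unfolding boundary_def
    proof (intro allI impI, elim conjE)
      fix u v assume uv: "u < m" "m < v"
      have 1: "\<exists>w. u < w \<and> w < v \<and> Q w"
      proof (cases "a = m")
        case True then show ?thesis using uv ab by auto
      next
        case False
        then have "max u a < m" using uv am by auto
        then obtain w where "max u a < w" "w < m" using dense by blast
        then show ?thesis using below[of w] uv by auto
      qed
      obtain y where y: "m < y" "y < v" using dense uv by blast
      from m(1)[OF y(1)] obtain z where z: "a \<le> z" "z \<le> y" "\<not> Q z" unfolding U_def by blast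
      then have "m \<le> z" using below by (meson not_le)
      then have "u < z \<and> z < v \<and> \<not> Q z" using z y uv by auto
      then show "(\<exists>w. u < w \<and> w < v \<and> Q w) \<and> (\<exists>w. u < w \<and> w < v \<and> \<not> Q w)" using 1 by blast
    qed
    then show ?thesis using am mb by blast
  qed
  have "boundary (\<lambda>w. \<not> Q w) y \<longleftrightarrow> boundary Q y" for y unfolding boundary_def by auto
  then show ?thesis using *[OF Q] *[OF dpred_not[OF Q]] assms(2,3) by (cases "Q a") auto
qed

section \<open>Definable choice\<close>

text \<open>For finite \<open>B\<close>, a finite set that meets every component of the complement of \<open>B\<close>.\<close>

definition sample :: "('a \<Rightarrow> bool) \<Rightarrow> 'a \<Rightarrow> bool" where
  "sample B c \<longleftrightarrow> B c \<or> (\<exists>l r. B l \<and> B r \<and> c = inv\<^sub>F (one\<^sub>F \<^bold>+ one\<^sub>F) \<^bold>* (l \<^bold>+ r)) \<or>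
     (\<exists>l. B l \<and> (c = l \<^bold>+ one\<^sub>F \<or> c = l \<^bold>- one\<^sub>F)) \<or> c = zero\<^sub>F"

lemma dpred_sample [dintros]:
  assumes "dpred (\<lambda>e. B (e 0) (\<lambda>i. e (Suc i)))" "dfun s"
  shows "dpred (\<lambda>e. sample (\<lambda>a. B a e) (s e))"
proof (rule dpred_subst[OF _ assms(2)])
  have 1: "dpred (\<lambda>e. B (e i) (\<lambda>i. e (i + k)))" for i k
    using dpred_rename[OF assms(1), of "case_nat i (\<lambda>i. i + k)"] by simp
  show "dpred (\<lambda>e. sample (\<lambda>a. B a (\<lambda>i. e (Suc i))) (e 0))"
    unfolding sample_def
    by (intro dintros) (use 1[of _ 1] 1[of _ 2] 1[of _ 3] in \<open>simp_all add: numeral_eq_Suc\<close>)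
qed

lemma finite_sample:
  assumes "finite {b. B b}" shows "finite {c. sample B c}"
proof -
  have "{c. sample B c} = {b. B b} \<union> (\<lambda>(l, r). inv\<^sub>F (one\<^sub>F \<^bold>+ one\<^sub>F) \<^bold>* (l \<^bold>+ r)) ` ({b. B b} \<times> {b. B b})
     \<union> (\<lambda>l. l \<^bold>+ one\<^sub>F) ` {b. B b} \<union> (\<lambda>l. l \<^bold>- one\<^sub>F) ` {b. B b} \<union> {zero\<^sub>F}"
    unfolding sample_def by auto
  then show ?thesis using assms by simp
qed

lemma midpoint: "l < r \<Longrightarrow> l < inv\<^sub>F (one\<^sub>F \<^bold>+ one\<^sub>F) \<^bold>* (l \<^bold>+ r) \<and> inv\<^sub>F (one\<^sub>F \<^bold>+ one\<^sub>F) \<^bold>* (l \<^bold>+ r) < r"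
  using fld.less_half_sum[of l r] fld.gt_half_sum[of l r]
  by (simp add: fld.divide_inverse fld.mult_commute)

text \<open>The neighbours of \<open>z\<close> in the finite set determine the candidate: their
  midpoint, a shift by one past a single neighbour, or the field zero if there are none. The
  conclusion says that no point of the set separates \<open>c\<close> from \<open>z\<close>.\<close>

lemma sample_meets:
  assumes "finite {b. B b}"
  shows "\<exists>c. sample B c \<and> (c = z \<or> (\<forall>b. B b \<longrightarrow> b < z \<and> b < c \<or> z < b \<and> c < b))"
proof (cases "B z")
  case True then show ?thesis unfolding sample_def by blast
next
  case False
  define L R where "L = {b. B b \<and> b < z}" "R = {b. B b \<and> z < b}"
  have fin: "finite L" "finite R" using assms unfolding L_R_def by auto
  have LR: "b \<in> L \<or> b \<in> R" if "B b" for b using that False unfolding L_R_def by (cases b z rule: linorder_cases) auto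
  have mem: "B b \<and> b < z" if "b \<in> L" for b using that unfolding L_R_def by simp
  have memR: "B b \<and> z < b" if "b \<in> R" for b using that unfolding L_R_def by simp
  show ?thesis
  proof (cases "L = {}"; cases "R = {}")
    assume "L = {}" "R = {}"
    then show ?thesis using LR unfolding sample_def by (intro exI[of _ zero\<^sub>F]) auto
  next
    assume "L = {}" "R \<noteq> {}"
    have "Min R \<^bold>- one\<^sub>F < b" if "b \<in> R" for b
      using Min_le[OF fin(2) that] fld.diff_less_eq fld.less_add_one fld.le_less_trans by (meson fld.less_le_trans)
    then show ?thesis using LR memR \<open>L = {}\<close> Min_in[OF fin(2) \<open>R \<noteq> {}\<close>] unfolding sample_def
      by (intro exI[of _ "Min R \<^bold>- one\<^sub>F"]) blast
  next
    assume "L \<noteq> {}" "R = {}"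
    have "b < Max L \<^bold>+ one\<^sub>F" if "b \<in> L" for b
      using Max_ge[OF fin(1) that] fld.less_add_one by (meson fld.le_less_trans)
    then show ?thesis using LR mem \<open>R = {}\<close> Max_in[OF fin(1) \<open>L \<noteq> {}\<close>] unfolding sample_def
      by (intro exI[of _ "Max L \<^bold>+ one\<^sub>F"]) blast
  next
    assume ne: "L \<noteq> {}" "R \<noteq> {}"
    let ?c = "inv\<^sub>F (one\<^sub>F \<^bold>+ one\<^sub>F) \<^bold>* (Max L \<^bold>+ Min R)"
    have B: "B (Max L)" "B (Min R)" "Max L < Min R" using Max_in[OF fin(1) ne(1)] Min_in[OF fin(2) ne(2)] mem memR by fastforce+
    have "b < ?c" if "b \<in> L" for b using Max_ge[OF fin(1) that] midpoint[OF B(3)] by auto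
    moreover have "?c < b" if "b \<in> R" for b using Min_le[OF fin(2) that] midpoint[OF B(3)] by auto
    ultimately show ?thesis using LR mem memR B unfolding sample_def by (intro exI[of _ ?c]) blast
  qed
qed

text \<open>The least satisfying member of a finite candidate set that is determined by
  \<open>Q\<close> alone; being canonical, it depends definably on the parameters of
  \<open>Q\<close>. The field zero is an arbitrary default.\<close>

definition choice :: "('a \<Rightarrow> bool) \<Rightarrow> 'a" where
  "choice Q = (if \<exists>a. Q a then LEAST c. sample (boundary Q) c \<and> Q c else zero\<^sub>F)"

text \<open>\<open>Q\<close> cannot change between \<open>z\<close> and the sample point on the same
  side of all boundary points.\<close>

lemma sample_meets_pred:
  assumes "dpred (\<lambda>e. Q (e 0))" "Q z" shows "\<exists>c. sample (boundary Q) c \<and> Q c"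
proof -
  obtain c where c: "sample (boundary Q) c" "c = z \<or> (\<forall>b. boundary Q b \<longrightarrow> b < z \<and> b < c \<or> z < b \<and> c < b)"
    using sample_meets[OF finite_boundary[OF assms(1)]] by blast
  have "Q c"
  proof (rule ccontr)
    assume n: "\<not> Q c"
    then have "c < z \<or> z < c" using assms by (cases c z rule: linorder_cases) auto
    then obtain y where "boundary Q y" "min c z \<le> y" "y \<le> max c z"
      using boundary_between[OF assms(1), of c z] boundary_between[OF assms(1), of z c] n assms(2) by fastforce
    then show False using c n assms(2) by (auto simp: min_def max_def split: if_splits)
  qed
  then show ?thesis using c by blast
qed

lemma choice_least:
  assumes "dpred (\<lambda>e. Q (e 0))" "\<exists>a. Q a"
  shows "sample (boundary Q) (choice Q) \<and> Q (choice Q) \<and> (\<forall>c. sample (boundary Q) c \<and> Q c \<longrightarrow> choice Q \<le> c)"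
proof -
  let ?A = "{c. sample (boundary Q) c \<and> Q c}"
  have A: "finite ?A" "?A \<noteq> {}"
    using finite_sample[OF finite_boundary[OF assms(1)]] sample_meets_pred assms by auto
  have "choice Q = Min ?A" unfolding choice_def using assms(2)
    by (simp, intro Least_equality) (use Min_in[OF A] Min_le[OF A(1)] in auto)
  then show ?thesis using Min_in[OF A] Min_le[OF A(1)] by auto
qed

lemma choice_in: "dpred (\<lambda>e. Q (e 0)) \<Longrightarrow> Q a \<Longrightarrow> Q (choice Q)"
  using choice_least by blast

lemma dfun_choice [dintros]:
  assumes "dpred (\<lambda>e. Q (e 0) (\<lambda>i. e (Suc i)))"
  shows "dfun (\<lambda>e. choice (\<lambda>a. Q a e))"
proof -
  have eq: "c = choice (\<lambda>a. Q a e) \<longleftrightarrow>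
     (\<not> (\<exists>a. Q a e) \<and> c = zero\<^sub>F) \<or>
     sample (boundary (\<lambda>a. Q a e)) c \<and> Q c e \<and> (\<forall>d. sample (boundary (\<lambda>a. Q a e)) d \<and> Q d e \<longrightarrow> c \<le> d)" for c e
    using choice_least[OF dpred_section[OF assms, of e]] unfolding choice_def by (smt (verit) antisym)
  have 1: "dpred (\<lambda>e. Q (e i) (\<lambda>i. e (i + k)))" for i k
    using dpred_rename[OF assms(1), of "case_nat i (\<lambda>i. i + k)"] by simp
  have 2: "dpred (\<lambda>e. sample (boundary (\<lambda>a. Q a (\<lambda>i. e (i + k)))) (e j))" for j k
  proof -
    have "dpred (\<lambda>e. Q (e 0) (\<lambda>i. e (Suc (Suc (i + k)))))"
      using 1[of 0 "Suc (Suc k)"] by simp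
    then show ?thesis by (intro dintros)
  qed
  show ?thesis unfolding dfun_def eq
    by (intro dintros) (use 1[of _ 1] 1[of _ 2] 1[of _ 3] 1[of _ 4] in \<open>simp_all add: numeral_eq_Suc\<close>)
qed

section \<open>Constants separating two definable functions\<close>

text \<open>If \<open>f\<close> has finitely many values on \<open>J\<close>, their extremes serve;
  otherwise the image contains an interval, and \<open>a\<close> and \<open>b\<close> are taken
  inside it. That both bounds are values of \<open>f\<close> matters: it turns a pointwise
  inequality such as g < h into a positive lower bound for the difference.\<close>

lemma bounded_on_infinite_subset:
  assumes J: "dpred (\<lambda>e. J (e 0))" "infinite {z. J z}" and f: "dfun (\<lambda>e. f (e 0))"
  shows "\<exists>a b. (\<exists>z. J z \<and> f z = a) \<and> (\<exists>z. J z \<and> f z = b) \<and> infinite {z. J z \<and> a \<le> f z \<and> f z \<le> b}"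
proof (cases "finite (f ` {z. J z})")
  case True
  have ne: "f ` {z. J z} \<noteq> {}" using J(2) by (metis finite.emptyI image_is_empty)
  define a b where "a = Min (f ` {z. J z})" "b = Max (f ` {z. J z})"
  have "a \<in> f ` {z. J z}" "b \<in> f ` {z. J z}" unfolding a_b_def using Min_in[OF True ne] Max_in[OF True ne] by auto
  moreover have "{z. J z \<and> a \<le> f z \<and> f z \<le> b} = {z. J z}"
    unfolding a_b_def using Min_le[OF True] Max_ge[OF True] by auto
  ultimately show ?thesis using J(2) by (intro exI[of _ a] exI[of _ b]) auto
next
  case False
  have "f ` {z. J z} = {y. \<exists>z. J z \<and> f z = y}" by auto
  then have "infinite {y. \<exists>z. J z \<and> f z = y}" using False by simp
  moreover have "dpred (\<lambda>e. \<exists>z. J z \<and> f z = e 0)"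
    by (intro dintros dpred_comp1[OF J(1)] dfun_comp1[OF f])
  ultimately obtain c d where "c < d" and cd: "\<And>y. c < y \<Longrightarrow> y < d \<Longrightarrow> \<exists>z. J z \<and> f z = y"
    using infinite_imp_interval[of "\<lambda>y. \<exists>z. J z \<and> f z = y"] by blast
  obtain a where a: "c < a" "a < d" using dense[OF \<open>c < d\<close>] by blast
  obtain b where b: "a < b" "b < d" using dense[OF a(2)] by blast
  have "{a<..<b} \<subseteq> f ` {z. J z \<and> a \<le> f z \<and> f z \<le> b}"
  proof
    fix y assume "y \<in> {a<..<b}"
    then have "c < y" "y < d" using a b by (auto intro: less_trans)
    then obtain z where "J z" "f z = y" using cd by blast
    then show "y \<in> f ` {z. J z \<and> a \<le> f z \<and> f z \<le> b}" using \<open>y \<in> {a<..<b}\<close> by auto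
  qed
  then have "infinite {z. J z \<and> a \<le> f z \<and> f z \<le> b}"
    using infinite_interval[OF b(1)] finite_surj by blast
  moreover have "\<exists>z. J z \<and> f z = a" "\<exists>z. J z \<and> f z = b" using cd a b by auto
  ultimately show ?thesis by blast
qed

lemma ex_small: "zero\<^sub>F < a \<Longrightarrow> \<exists>\<epsilon>. zero\<^sub>F < \<epsilon> \<and> \<epsilon> \<^bold>+ \<epsilon> < a"
proof -
  assume "zero\<^sub>F < a"
  then obtain x where x: "zero\<^sub>F < x" "x < a" using dense by blast
  then have "zero\<^sub>F < min x (a \<^bold>- x)" by (simp add: fld.less_diff_eq)
  then obtain \<epsilon> where e: "zero\<^sub>F < \<epsilon>" "\<epsilon> < min x (a \<^bold>- x)" using dense by blast
  then have "\<epsilon> \<^bold>+ \<epsilon> < x \<^bold>+ (a \<^bold>- x)" using fld.add_strict_mono[of \<epsilon> x \<epsilon> "a \<^bold>- x"] by simp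
  moreover have "x \<^bold>+ (a \<^bold>- x) = a" by (metis fld.add.commute fld.diff_add_cancel)
  ultimately show ?thesis using e by auto
qed

text \<open>
  After shrinking \<open>J\<close>, \<open>h - g\<close> exceeds some \<open>2\<epsilon> > 0\<close>. If \<open>m\<close> is the least essential value of \<open>g\<close>, then
  \<open>g\<close> takes values in \<open>[m - \<epsilon>, m + \<epsilon>)\<close> infinitely often, and \<open>c = m + \<epsilon>\<close> works there.
\<close>

lemma separating_constant:
  assumes J: "dpred (\<lambda>e. J (e 0))" "infinite {z. J z}"
    and g: "dfun (\<lambda>e. g (e 0))" and h: "dfun (\<lambda>e. h (e 0))" and gh: "\<And>z. J z \<Longrightarrow> g z < h z"
  shows "\<exists>c. infinite {z. J z \<and> g z < c \<and> c < h z}"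
proof -
  obtain a b where a: "\<exists>z. J z \<and> h z \<^bold>- g z = a" "infinite {z. J z \<and> a \<le> h z \<^bold>- g z \<and> h z \<^bold>- g z \<le> b}"
    using bounded_on_infinite_subset[of J "\<lambda>z. h z \<^bold>- g z", OF J dfun_minus[OF h g]] by blast
  have "zero\<^sub>F < a" using a(1) gh by auto
  then obtain \<epsilon> where eps: "zero\<^sub>F < \<epsilon>" "\<epsilon> \<^bold>+ \<epsilon> < a" using ex_small by blast
  define J1 where "J1 z \<longleftrightarrow> J z \<and> a \<le> h z \<^bold>- g z" for z
  have J1d: "dpred (\<lambda>e. J1 (e 0))"
    unfolding J1_def by (intro dintros J(1) dfun_comp1[OF g] dfun_comp1[OF h])
  have J1i: "infinite {z. J1 z}"
    by (rule infinite_super[OF _ a(2)]) (auto simp: J1_def)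
  \<comment> \<open>Between \<open>a'\<close> and \<open>b'\<close> the function \<open>g\<close>
    takes bounded values for infinitely many \<open>z\<close>, so that \<open>U\<close> is neither
    empty nor everything and has a cut.\<close>
  obtain a' b' where a': "\<exists>z. J1 z \<and> g z = a'" "infinite {z. J1 z \<and> a' \<le> g z \<and> g z \<le> b'}"
    using bounded_on_infinite_subset[OF J1d J1i g] by blast
  define U where "U c \<longleftrightarrow> infinite {z. J1 z \<and> a' \<le> g z \<and> g z < c}" for c
  have "dpred (\<lambda>e. U (e 0))"
    unfolding U_def by (intro dintros dpred_comp1[OF J1d] dfun_comp1[OF g])
  moreover have "U y" if "U x" "x \<le> y" for x y
    using that(1) unfolding U_def by (rule infinite_super[rotated]) (use that(2) in auto)
  moreover have "\<not> U a'"
  proof -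
    have emp: "{z. J1 z \<and> a' \<le> g z \<and> g z < a'} = {}" by auto
    show ?thesis unfolding U_def emp by simp
  qed
  moreover have "U (b' \<^bold>+ one\<^sub>F)"
    unfolding U_def by (rule infinite_super[OF _ a'(2)]) (use fld.less_add_one fld.le_less_trans in blast)
  ultimately obtain m where m: "\<And>y. m < y \<Longrightarrow> U y" "\<And>y. y < m \<Longrightarrow> \<not> U y"
    using upper_set_cut[of U "b' \<^bold>+ one\<^sub>F" a'] by blast
  have 1: "infinite {z. J1 z \<and> a' \<le> g z \<and> g z < m \<^bold>+ \<epsilon>}" using m(1)[of "m \<^bold>+ \<epsilon>"] eps unfolding U_def by simp
  have 2: "finite {z. J1 z \<and> a' \<le> g z \<and> g z < m \<^bold>- \<epsilon>}"
    using m(2)[of "m \<^bold>- \<epsilon>"] eps unfolding U_def by (simp add: fld.diff_less_eq)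
  have "{z. J1 z \<and> a' \<le> g z \<and> g z < m \<^bold>+ \<epsilon>} - {z. J1 z \<and> a' \<le> g z \<and> g z < m \<^bold>- \<epsilon>}
     \<subseteq> {z. J z \<and> g z < m \<^bold>+ \<epsilon> \<and> m \<^bold>+ \<epsilon> < h z}"
  proof
    fix z assume "z \<in> {z. J1 z \<and> a' \<le> g z \<and> g z < m \<^bold>+ \<epsilon>} - {z. J1 z \<and> a' \<le> g z \<and> g z < m \<^bold>- \<epsilon>}"
    then have z: "J1 z" "g z < m \<^bold>+ \<epsilon>" "m \<^bold>- \<epsilon> \<le> g z" by auto
    have "m \<^bold>+ \<epsilon> \<le> g z \<^bold>+ (\<epsilon> \<^bold>+ \<epsilon>)"
      using z(3) by (simp add: fld.diff_le_eq fld.add_assoc[symmetric])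
    also have "\<dots> < g z \<^bold>+ a" using eps by simp
    also have "\<dots> \<le> h z" using z(1) unfolding J1_def by (simp add: fld.le_diff_eq fld.add_commute)
    finally show "z \<in> {z. J z \<and> g z < m \<^bold>+ \<epsilon> \<and> m \<^bold>+ \<epsilon> < h z}" using z unfolding J1_def by simp
  qed
  then have "infinite {z. J z \<and> g z < m \<^bold>+ \<epsilon> \<and> m \<^bold>+ \<epsilon> < h z}"
    using Diff_infinite_finite[OF 2 1] finite_subset by blast
  then show ?thesis by blast
qed

section \<open>Uniform finiteness\<close>

definition near :: "'a \<Rightarrow> ('a \<Rightarrow> bool) \<Rightarrow> bool" where
  "near z Q \<longleftrightarrow> (\<exists>u v. u < z \<and> z < v \<and> (\<forall>z'. u < z' \<and> z' < v \<longrightarrow> Q z'))"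

lemma near_mono: "near z P \<Longrightarrow> (\<And>z'. P z' \<Longrightarrow> Q z') \<Longrightarrow> near z Q"
  unfolding near_def by blast

lemma near_conj: "near z P \<Longrightarrow> near z Q \<Longrightarrow> near z (\<lambda>z'. P z' \<and> Q z')"
proof -
  assume "near z P" "near z Q"
  then obtain u v u' v' where "u < z" "z < v" "\<forall>z'. u < z' \<and> z' < v \<longrightarrow> P z'"
    "u' < z" "z < v'" "\<forall>z'. u' < z' \<and> z' < v' \<longrightarrow> Q z'" unfolding near_def by blast
  then show ?thesis unfolding near_def by (intro exI[of _ "max u u'"] exI[of _ "min v v'"]) auto
qed

lemma near_imp: "near z P \<Longrightarrow> P z"
  unfolding near_def by blast

lemma infinite_imp_near:
  assumes "dpred (\<lambda>e. J (e 0))" "infinite {z. J z}"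
  shows "\<exists>z. near z J"
proof -
  obtain u v where uv: "u < v" "\<forall>w. u < w \<and> w < v \<longrightarrow> J w" using infinite_imp_interval[OF assms] by blast
  then obtain z where "u < z" "z < v" using dense by blast
  then show ?thesis unfolding near_def using uv by blast
qed

text \<open>Serves to enlarge an interval past its left end without meeting further points of a
  finite fibre.\<close>

lemma gap_left: "finite Y \<Longrightarrow> \<exists>a1. a1 < (a::'a) \<and> (\<forall>y\<in>Y. \<not> (a1 \<le> y \<and> y < a))"
proof (induction Y rule: finite_induct)
  case empty then show ?case using ex_less by blast
next
  case (insert x Y)
  then obtain a1 where a1: "a1 < a" "\<forall>y\<in>Y. \<not> (a1 \<le> y \<and> y < a)" by blast
  show ?case
  proof (cases "x < a")
    case True
    then have "max a1 x < a" using a1 by simp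
    then obtain a2 where "max a1 x < a2" "a2 < a" using dense by blast
    then show ?thesis using a1 by (intro exI[of _ a2]) auto
  qed (use a1 in auto)
qed

lemma gap_right: "finite Y \<Longrightarrow> \<exists>b1. (b::'a) < b1 \<and> (\<forall>y\<in>Y. \<not> (b < y \<and> y \<le> b1))"
proof (induction Y rule: finite_induct)
  case empty then show ?case using ex_greater by blast
next
  case (insert x Y)
  then obtain b1 where b1: "b < b1" "\<forall>y\<in>Y. \<not> (b < y \<and> y \<le> b1)" by blast
  show ?case
  proof (cases "b < x")
    case True
    then have "b < min b1 x" using b1 by simp
    then obtain b2 where "b < b2" "b2 < min b1 x" using dense by blast
    then show ?thesis using b1 by (intro exI[of _ b2]) auto
  qed (use b1 in auto)
qed

primrec choice_tup :: "nat \<Rightarrow> ('a list \<Rightarrow> bool) \<Rightarrow> 'a list" where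
  "choice_tup 0 Q = []"
| "choice_tup (Suc n) Q = (let a = choice (\<lambda>a. \<exists>x. length x = n \<and> Q (a # x)) in a # choice_tup n (\<lambda>x. Q (a # x)))"

lemma dtup_choice_tup [dintros]:
  assumes "dpred (\<lambda>e. Q (map e [0..<n]) (\<lambda>i. e (i + n)))"
  shows "dtup (\<lambda>e. choice_tup n (\<lambda>x. Q x e))"
  using assms
proof (induction n arbitrary: Q)
  case 0 then show ?case by (simp add: dtup_Nil)
next
  case (Suc n)
  have 0: "dpred (\<lambda>e. Q (e 0 # map (\<lambda>i. e (Suc i)) [0..<n]) (\<lambda>i. e (Suc i + n)))"
    using Suc.prems by (simp add: map_upt_Suc_Cons del: upt_Suc)
  define s where "s e = choice (\<lambda>a. \<exists>x. length x = n \<and> Q (a # x) e)" for e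
  have s: "dfun s" unfolding s_def
  proof (rule dfun_choice, rule dpred_ex_tup)
    let ?\<sigma> = "\<lambda>i. if i = 0 then n else if i \<le> n then i - 1 else i"
    have "map (\<lambda>i. e (?\<sigma> (Suc i))) [0..<n] = map e [0..<n]" for e :: "nat \<Rightarrow> 'a" by (rule map_cong) auto
    from dpred_rename[OF 0, of ?\<sigma>, unfolded this] show "dpred (\<lambda>e. Q (e (0 + n) # map e [0..<n]) (\<lambda>i. e (Suc i + n)))"
      by simp
  qed
  have "dtup (\<lambda>e. choice_tup n (\<lambda>x. Q (s e # x) e))"
  proof (rule Suc.IH)
    show "dpred (\<lambda>e. Q (s (\<lambda>i. e (i + n)) # map e [0..<n]) (\<lambda>i. e (i + n)))"
      using dpred_subst[of "\<lambda>a e. Q (a # map e [0..<n]) (\<lambda>i. e (i + n))", OF _ dfun_rename[OF s, of "\<lambda>i. i + n"]] 0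
      by simp
  qed
  then have "dtup (\<lambda>e. s e # choice_tup n (\<lambda>x. Q (s e # x) e))" by (rule dtup_Cons[OF s])
  then show ?case unfolding s_def by (simp add: Let_def)
qed

lemma choice_tup_in:
  assumes "dpred (\<lambda>e. Q (map e [0..<n]))" "length x = n" "Q x"
  shows "length (choice_tup n Q) = n \<and> Q (choice_tup n Q)"
  using assms
proof (induction n arbitrary: Q x)
  case (Suc n)
  have 0: "dpred (\<lambda>e. Q (e 0 # map (\<lambda>i. e (Suc i)) [0..<n]))"
    using Suc.prems by (simp add: map_upt_Suc_Cons del: upt_Suc)
  define a where "a = choice (\<lambda>a. \<exists>x. length x = n \<and> Q (a # x))"
  have "dpred (\<lambda>e. \<exists>x. length x = n \<and> Q (e 0 # x))"
  proof (rule dpred_ex_tup)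
    let ?\<sigma> = "\<lambda>i. if i = 0 then n else if i \<le> n then i - 1 else i"
    have "map (\<lambda>i. e (?\<sigma> (Suc i))) [0..<n] = map e [0..<n]" for e :: "nat \<Rightarrow> 'a" by (rule map_cong) auto
    from dpred_rename[OF 0, of ?\<sigma>, unfolded this] show "dpred (\<lambda>e. Q (e (0 + n) # map e [0..<n]))"
      by simp
  qed
  moreover have "\<exists>x'. length x' = n \<and> Q (hd x # x')"
    using Suc.prems(2,3) by (cases x) auto
  ultimately obtain x' where x': "length x' = n" "Q (a # x')"
    unfolding a_def using choice_in[of "\<lambda>a. \<exists>x. length x = n \<and> Q (a # x)"] by blast
  have "dpred (\<lambda>e. Q (a # map e [0..<n]))"
    by (rule dpred_subst[of "\<lambda>a e. Q (a # map e [0..<n])", OF _ dfun_const]) (use 0 in simp)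
  from Suc.IH[OF this x'] show ?case by (simp add: a_def Let_def)
qed simp

text \<open>A definable choice of tuples is separated coordinate by coordinate, each time at the
  cost of shrinking \<open>J\<close> to an infinite subset. The constants do not depend on
  \<open>z\<close>, so the tuples over any two points near \<open>z0\<close> interlace: entry
  \<open>i\<close> of one lies below entry \<open>i + 1\<close> of the other.\<close>

lemma uniform_separation:
  assumes Ji: "infinite {z. J z}" and J: "dpred (\<lambda>e. J (e 0))"
    and W: "dpred (\<lambda>e. W (e (Suc k)) (map e [0..<Suc k]))"
    and ex: "\<And>z. J z \<Longrightarrow> \<exists>x. length x = Suc k \<and> (\<forall>i<k. x ! i < x ! Suc i) \<and> W z x"
  shows "\<exists>z0 F c. near z0 (\<lambda>z. J z \<and> W z (F z) \<and> (\<forall>i<k. F z ! i < c i \<and> c i < F z ! Suc i))"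
proof -
  define R where "R z x \<longleftrightarrow> (\<forall>i<k. x ! i < x ! Suc i) \<and> W z x" for z x
  have Rd: "dpred (\<lambda>e. R (e (Suc k)) (map e [0..<Suc k]))"
    unfolding R_def by (intro dintros W)
  define F where "F z = choice_tup (Suc k) (R z)" for z
  have F: "R z (F z)" if J: "J z" for z
  proof -
    obtain x where x: "length x = Suc k" "R z x" using ex[OF J] unfolding R_def by blast
    have "dfun (if i = Suc k then (\<lambda>e. z) else (\<lambda>e. e i))" for i by (simp add: dfun_const dfun_var)
    from dpred_subst_env[OF Rd, of "\<lambda>i. if i = Suc k then (\<lambda>e. z) else (\<lambda>e. e i)", OF this]
    have "dpred (\<lambda>e. R z (map (\<lambda>i. (if i = Suc k then (\<lambda>e. z) else (\<lambda>e. e i)) e) [0..<Suc k]))"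
      by (simp del: upt_Suc)
    moreover have eq: "map (\<lambda>i. (if i = Suc k then (\<lambda>e. z) else (\<lambda>e. e i)) e) [0..<Suc k] = map e [0..<Suc k]"
      for e :: "nat \<Rightarrow> 'a" by (rule map_cong) auto
    ultimately have "dpred (\<lambda>e. R z (map e [0..<Suc k]))" unfolding eq by blast
    from choice_tup_in[OF this x] show ?thesis unfolding F_def by blast
  qed
  have Fd: "dtup (\<lambda>e. F (e 0))" unfolding F_def by (rule dtup_choice_tup) (use Rd in simp)
  have Fi: "dfun (\<lambda>e. F (e 0) ! i)" for i by (rule dfun_nth[OF Fd])
  have "\<exists>c. infinite {z. J z \<and> (\<forall>i<j. F z ! i < c i \<and> c i < F z ! Suc i)}" if "j \<le> k" for j
    using that
  proof (induction j)
    case 0 then show ?case using Ji by simp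
  next
    case (Suc j)
    then obtain c where c: "infinite {z. J z \<and> (\<forall>i<j. F z ! i < c i \<and> c i < F z ! Suc i)}" by auto
    have "dpred (\<lambda>e. J (e 0) \<and> (\<forall>i<j. F (e 0) ! i < c i \<and> c i < F (e 0) ! Suc i))"
      by (intro dintros J Fi)
    then obtain d where d: "infinite {z. (J z \<and> (\<forall>i<j. F z ! i < c i \<and> c i < F z ! Suc i)) \<and> F z ! j < d \<and> d < F z ! Suc j}"
      using separating_constant[OF _ c Fi Fi, of j "Suc j"] F Suc.prems unfolding R_def by auto
    show ?case
      by (rule exI[of _ "c(j := d)"], rule infinite_super[OF _ d]) (auto simp: less_Suc_eq)
  qed
  from this[OF order_refl] obtain c where
    c: "infinite {z. J z \<and> (\<forall>i<k. F z ! i < c i \<and> c i < F z ! Suc i)}" by blast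
  moreover have "dpred (\<lambda>e. J (e 0) \<and> (\<forall>i<k. F (e 0) ! i < c i \<and> c i < F (e 0) ! Suc i))"
    by (intro dintros J Fi)
  ultimately obtain z0 where "near z0 (\<lambda>z. J z \<and> (\<forall>i<k. F z ! i < c i \<and> c i < F z ! Suc i))"
    using infinite_imp_near[of "\<lambda>z. J z \<and> (\<forall>i<k. F z ! i < c i \<and> c i < F z ! Suc i)"] by blast
  then have "near z0 (\<lambda>z. J z \<and> W z (F z) \<and> (\<forall>i<k. F z ! i < c i \<and> c i < F z ! Suc i))"
    by (rule near_mono) (use F in \<open>auto simp: R_def\<close>)
  then show ?thesis by blast
qed

section \<open>Local constancy of the size of finite fibres\<close>

text \<open>\<open>A z\<close> is read as the fibre over \<open>z\<close>. The conclusion uses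
  half-open strips because they can be cut at a point and counted additively; the premise uses the
  closed interval because only a gap that includes both its ends can be enlarged on either
  side.\<close>

definition stable_gaps :: "('a \<Rightarrow> 'a \<Rightarrow> bool) \<Rightarrow> 'a \<Rightarrow> bool" where
  "stable_gaps A z \<longleftrightarrow> (\<forall>a b. a < b \<and> (\<forall>y. a \<le> y \<and> y \<le> b \<longrightarrow> \<not> A z y) \<longrightarrow>
     near z (\<lambda>z'. \<forall>y. a \<le> y \<and> y < b \<longrightarrow> \<not> A z' y))"

definition stable_points :: "('a \<Rightarrow> 'a \<Rightarrow> bool) \<Rightarrow> 'a \<Rightarrow> bool" where
  "stable_points A z \<longleftrightarrow>
     (\<forall>a y b. a < y \<and> y < b \<and> A z y \<and> (\<forall>y'. a \<le> y' \<and> y' \<le> b \<and> A z y' \<longrightarrow> y' = y) \<longrightarrow>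
       near z (\<lambda>z'. \<exists>y'. a \<le> y' \<and> y' < b \<and> A z' y' \<and> (\<forall>y''. a \<le> y'' \<and> y'' < b \<and> A z' y'' \<longrightarrow> y'' = y')))"

definition locally_bounded :: "('a \<Rightarrow> 'a \<Rightarrow> bool) \<Rightarrow> 'a \<Rightarrow> bool" where
  "locally_bounded A z \<longleftrightarrow> (\<exists>c d. near z (\<lambda>z'. \<forall>y. A z' y \<longrightarrow> c < y \<and> y < d))"

definition good :: "('a \<Rightarrow> 'a \<Rightarrow> bool) \<Rightarrow> 'a \<Rightarrow> bool" where
  "good A z \<longleftrightarrow> stable_gaps A z \<and> stable_points A z \<and> locally_bounded A z"

context
  fixes A :: "'a \<Rightarrow> 'a \<Rightarrow> bool"
  assumes A: "dpred (\<lambda>e. A (e 0) (e 1))" and fin: "\<And>z. finite {y. A z y}"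
begin

text \<open>Definably chosen bounds of the fibres are themselves bounded on an infinite set of
  \<open>z\<close>, hence near some point.\<close>

lemma finite_not_locally_bounded: "finite {z. \<not> locally_bounded A z}"
proof (rule ccontr)
  define J where "J z \<longleftrightarrow> \<not> locally_bounded A z" for z
  assume "infinite {z. \<not> locally_bounded A z}"
  then have Ji: "infinite {z. J z}" unfolding J_def .
  have Jd: "dpred (\<lambda>e. J (e 0))"
    unfolding J_def locally_bounded_def near_def by (intro dintros dpred_comp2[OF A])
  define f g where "f z = choice (\<lambda>c. \<forall>y. A z y \<longrightarrow> y < c)" "g z = choice (\<lambda>c. \<forall>y. A z y \<longrightarrow> c < y)" for z
  have fd: "dfun (\<lambda>e. f (e 0))" and gd: "dfun (\<lambda>e. g (e 0))"
    unfolding f_g_def by (intro dintros dpred_comp2[OF A])+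
  have f: "A z y \<Longrightarrow> y < f z" for y z
  proof -
    obtain c where "\<forall>y. A z y \<longrightarrow> y < c"
      using fin[of z] ex_greater by (metis Max_ge empty_Collect_eq le_less_trans mem_Collect_eq)
    moreover have "dpred (\<lambda>e. \<forall>y. A z y \<longrightarrow> y < e 0)" by (intro dintros dpred_comp2[OF A])
    ultimately have "\<forall>y. A z y \<longrightarrow> y < f z" unfolding f_g_def using choice_in[of "\<lambda>c. \<forall>y. A z y \<longrightarrow> y < c"] by blast
    then show "A z y \<Longrightarrow> y < f z" by blast
  qed
  have g: "A z y \<Longrightarrow> g z < y" for y z
  proof -
    obtain c where "\<forall>y. A z y \<longrightarrow> c < y"
      using fin[of z] ex_less by (metis Min_le empty_Collect_eq less_le_trans mem_Collect_eq)
    moreover have "dpred (\<lambda>e. \<forall>y. A z y \<longrightarrow> e 0 < y)" by (intro dintros dpred_comp2[OF A])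
    ultimately have "\<forall>y. A z y \<longrightarrow> g z < y" unfolding f_g_def using choice_in[of "\<lambda>c. \<forall>y. A z y \<longrightarrow> c < y"] by blast
    then show "A z y \<Longrightarrow> g z < y" by blast
  qed
  obtain b where "infinite {z. J z \<and> f z \<le> b}"
    using bounded_on_infinite_subset[OF Jd Ji fd] by (smt (verit) Collect_mono_iff infinite_super)
  moreover have J1: "dpred (\<lambda>e. J (e 0) \<and> f (e 0) \<le> b)" by (intro dintros Jd fd)
  ultimately obtain a where "infinite {z. (J z \<and> f z \<le> b) \<and> a \<le> g z}"
    using bounded_on_infinite_subset[of "\<lambda>z. J z \<and> f z \<le> b", OF J1 _ gd] by (smt (verit) Collect_mono_iff infinite_super)
  moreover have J1: "dpred (\<lambda>e. (J (e 0) \<and> f (e 0) \<le> b) \<and> a \<le> g (e 0))" by (intro dintros Jd fd gd)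
  ultimately obtain z where z: "near z (\<lambda>z. (J z \<and> f z \<le> b) \<and> a \<le> g z)"
    using infinite_imp_near[of "\<lambda>z. (J z \<and> f z \<le> b) \<and> a \<le> g z"] by blast
  have "near z (\<lambda>z'. \<forall>y. A z' y \<longrightarrow> a < y \<and> y < b)"
    by (rule near_mono[OF z]) (use f g in fastforce)
  then show False using near_imp[OF z] unfolding J_def locally_bounded_def by blast
qed

text \<open>A failing gap is enlarged on both sides to a four-point tuple, and the tuples are
  separated uniformly. By interlacing, the inner interval of \<open>z0\<close> lies in the outer,
  empty interval of every nearby \<open>z'\<close>, which contradicts the failure at
  \<open>z0\<close>.\<close>

lemma finite_not_stable_gaps: "finite {z. \<not> stable_gaps A z}"
proof (rule ccontr)
  define J where "J z \<longleftrightarrow> \<not> stable_gaps A z" for z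
  define W where "W z x \<longleftrightarrow> (\<forall>y. x ! 0 \<le> y \<and> y \<le> x ! 3 \<longrightarrow> \<not> A z y) \<and>
     \<not> near z (\<lambda>z'. \<forall>y. x ! 1 \<le> y \<and> y < x ! 2 \<longrightarrow> \<not> A z' y)" for z x
  assume "infinite {z. \<not> stable_gaps A z}"
  then have "infinite {z. J z}" unfolding J_def .
  moreover have "dpred (\<lambda>e. J (e 0))"
    unfolding J_def stable_gaps_def near_def by (intro dintros dpred_comp2[OF A])
  moreover have "dpred (\<lambda>e. W (e 4) (map e [0..<4]))"
    unfolding W_def near_def by (intro dintros dpred_comp2[OF A])
  moreover have "\<exists>x. length x = 4 \<and> (\<forall>i<3. x ! i < x ! Suc i) \<and> W z x" if Jz: "J z" for z
  proof -
    obtain a b where ab: "a < b" "\<forall>y. a \<le> y \<and> y \<le> b \<longrightarrow> \<not> A z y"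
      "\<not> near z (\<lambda>z'. \<forall>y. a \<le> y \<and> y < b \<longrightarrow> \<not> A z' y)"
      using Jz unfolding J_def stable_gaps_def by blast
    obtain a1 where a1: "a1 < a" "\<forall>y\<in>{y. A z y}. \<not> (a1 \<le> y \<and> y < a)" using gap_left[OF fin] by blast
    obtain b1 where b1: "b < b1" "\<forall>y\<in>{y. A z y}. \<not> (b < y \<and> y \<le> b1)" using gap_right[OF fin] by blast
    have "\<not> A z y" if "a1 \<le> y" "y \<le> b1" for y using ab a1 b1 that by (metis mem_Collect_eq not_le)
    then show ?thesis unfolding W_def using ab a1 b1
      by (intro exI[of _ "[a1, a, b, b1]"]) (auto simp: less_Suc_eq numeral_eq_Suc)
  qed
  ultimately obtain z0 F c where z0: "near z0 (\<lambda>z. J z \<and> W z (F z) \<and> (\<forall>i<3. F z ! i < c i \<and> c i < F z ! Suc i))"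
    using uniform_separation[of J W 3] by auto
  then have c: "F z0 ! 0 < c 0" "c 0 < F z0 ! 1" "F z0 ! 2 < c 2" "c 2 < F z0 ! 3"
    using near_imp[OF z0] by (auto simp: numeral_eq_Suc)
  have "near z0 (\<lambda>z'. \<forall>y. F z0 ! 1 \<le> y \<and> y < F z0 ! 2 \<longrightarrow> \<not> A z' y)"
  proof (rule near_mono[OF z0], intro allI impI)
    fix z' y assume z': "J z' \<and> W z' (F z') \<and> (\<forall>i<3. F z' ! i < c i \<and> c i < F z' ! Suc i)"
      and y: "F z0 ! 1 \<le> y \<and> y < F z0 ! 2"
    have "F z' ! 0 < c 0" "c 2 < F z' ! 3" using z' by (auto simp: numeral_eq_Suc)
    then have "F z' ! 0 \<le> y" "y \<le> F z' ! 3" using y c by auto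
    then show "\<not> A z' y" using z' unfolding W_def by blast
  qed
  then show False using near_imp[OF z0] unfolding W_def by blast
qed

text \<open>As for gaps, with the isolated point as a fifth entry in the middle: the inner constants
  keep the point of \<open>z'\<close> inside the strip of \<open>z0\<close>, the outer ones keep
  that strip inside the interval where this point is the only one.\<close>

lemma finite_not_stable_points: "finite {z. \<not> stable_points A z}"
proof (rule ccontr)
  define J where "J z \<longleftrightarrow> \<not> stable_points A z" for z
  define W where "W z x \<longleftrightarrow> A z (x ! 2) \<and> (\<forall>y. x ! 0 \<le> y \<and> y \<le> x ! 4 \<and> A z y \<longrightarrow> y = x ! 2) \<and>
     \<not> near z (\<lambda>z'. \<exists>y. x ! 1 \<le> y \<and> y < x ! 3 \<and> A z' y \<and> (\<forall>y'. x ! 1 \<le> y' \<and> y' < x ! 3 \<and> A z' y' \<longrightarrow> y' = y))" for z x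
  assume "infinite {z. \<not> stable_points A z}"
  then have "infinite {z. J z}" unfolding J_def .
  moreover have "dpred (\<lambda>e. J (e 0))"
    unfolding J_def stable_points_def near_def by (intro dintros dpred_comp2[OF A])
  moreover have "dpred (\<lambda>e. W (e 5) (map e [0..<5]))"
    unfolding W_def near_def by (intro dintros dpred_comp2[OF A])
  moreover have "\<exists>x. length x = 5 \<and> (\<forall>i<4. x ! i < x ! Suc i) \<and> W z x" if Jz: "J z" for z
  proof -
    obtain a p b where ab: "a < p" "p < b" "A z p" "\<forall>y'. a \<le> y' \<and> y' \<le> b \<and> A z y' \<longrightarrow> y' = p"
      "\<not> near z (\<lambda>z'. \<exists>y. a \<le> y \<and> y < b \<and> A z' y \<and> (\<forall>y'. a \<le> y' \<and> y' < b \<and> A z' y' \<longrightarrow> y' = y))"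
      using Jz unfolding J_def stable_points_def by blast
    obtain a1 where a1: "a1 < a" "\<forall>y\<in>{y. A z y}. \<not> (a1 \<le> y \<and> y < a)" using gap_left[OF fin] by blast
    obtain b1 where b1: "b < b1" "\<forall>y\<in>{y. A z y}. \<not> (b < y \<and> y \<le> b1)" using gap_right[OF fin] by blast
    have "y = p" if "a1 \<le> y" "y \<le> b1" "A z y" for y
      using ab(4) a1 b1 that by (metis mem_Collect_eq not_le)
    then show ?thesis unfolding W_def using ab a1 b1
      by (intro exI[of _ "[a1, a, p, b, b1]"]) (auto simp: less_Suc_eq numeral_eq_Suc)
  qed
  ultimately obtain z0 F c where z0: "near z0 (\<lambda>z. J z \<and> W z (F z) \<and> (\<forall>i<4. F z ! i < c i \<and> c i < F z ! Suc i))"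
    using uniform_separation[of J W 4] by auto
  then have c: "F z0 ! 0 < c 0" "c 0 < F z0 ! 1" "F z0 ! 1 < c 1" "c 2 < F z0 ! 3" "F z0 ! 3 < c 3" "c 3 < F z0 ! 4"
    using near_imp[OF z0] by (auto simp: numeral_eq_Suc)
  have "near z0 (\<lambda>z'. \<exists>y. F z0 ! 1 \<le> y \<and> y < F z0 ! 3 \<and> A z' y \<and>
     (\<forall>y'. F z0 ! 1 \<le> y' \<and> y' < F z0 ! 3 \<and> A z' y' \<longrightarrow> y' = y))"
  proof (rule near_mono[OF z0])
    fix z' assume z': "J z' \<and> W z' (F z') \<and> (\<forall>i<4. F z' ! i < c i \<and> c i < F z' ! Suc i)"
    have F: "F z' ! 0 < c 0" "c 1 < F z' ! 2" "F z' ! 2 < c 2" "c 3 < F z' ! 4"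
      using z' by (auto simp: numeral_eq_Suc)
    have W: "A z' (F z' ! 2)" "\<And>y. F z' ! 0 \<le> y \<Longrightarrow> y \<le> F z' ! 4 \<Longrightarrow> A z' y \<Longrightarrow> y = F z' ! 2"
      using z' unfolding W_def by blast+
    show "\<exists>y. F z0 ! 1 \<le> y \<and> y < F z0 ! 3 \<and> A z' y \<and> (\<forall>y'. F z0 ! 1 \<le> y' \<and> y' < F z0 ! 3 \<and> A z' y' \<longrightarrow> y' = y)"
    proof (intro exI[of _ "F z' ! 2"] conjI allI impI)
      fix y assume "F z0 ! 1 \<le> y \<and> y < F z0 ! 3 \<and> A z' y"
      then show "y = F z' ! 2" using W(2)[of y] F c by auto
    qed (use W F c in auto)
  qed
  then show False using near_imp[OF z0] unfolding W_def by blast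
qed

lemma finite_not_good: "finite {z. \<not> good A z}"
proof -
  have "{z. \<not> good A z} = {z. \<not> stable_gaps A z} \<union> {z. \<not> stable_points A z} \<union> {z. \<not> locally_bounded A z}"
    unfolding good_def by auto
  then show ?thesis
    using finite_not_stable_gaps finite_not_stable_points finite_not_locally_bounded by simp
qed

text \<open>Induction on the number of points in the strip: a cut \<open>d\<close> just above the
  lowest point leaves one stable point below and a smaller strip above. The ends are kept out of the
  fibre so that the lowest point is interior and an empty strip is a closed gap.\<close>

lemma card_strip_near:
  assumes z: "good A z" and "a < b" "\<not> A z a" "\<not> A z b"
  shows "near z (\<lambda>z'. card {y. a \<le> y \<and> y < b \<and> A z' y} = card {y. a \<le> y \<and> y < b \<and> A z y})"
  using assms(2-)
proof (induction "card {y. a \<le> y \<and> y < b \<and> A z y}" arbitrary: a rule: less_induct)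
  case less
  let ?S = "\<lambda>a b z. {y. a \<le> y \<and> y < b \<and> A z y}"
  have fS: "finite (?S a b z)" for a b z by (rule finite_subset[OF _ fin[of z]]) auto
  show ?case
  proof (cases "?S a b z = {}")
    case True
    then have "\<forall>y. a \<le> y \<and> y \<le> b \<longrightarrow> \<not> A z y" using less.prems by (auto simp: le_less)
    then have "near z (\<lambda>z'. \<forall>y. a \<le> y \<and> y < b \<longrightarrow> \<not> A z' y)"
      using z less.prems unfolding good_def stable_gaps_def by blast
    then show ?thesis
    proof (rule near_mono)
      fix z' assume "\<forall>y. a \<le> y \<and> y < b \<longrightarrow> \<not> A z' y"
      then have "?S a b z' = {}" by auto
      then show "card (?S a b z') = card (?S a b z)" unfolding True by (rule arg_cong)
    qed
  next
    case False
    define p where "p = Min (?S a b z)"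
    have p: "a \<le> p" "p < b" "A z p" using Min_in[OF fS False] unfolding p_def by auto
    have pmin: "p \<le> y" if "a \<le> y" "y < b" "A z y" for y using Min_le[OF fS, of y a b z] that unfolding p_def by auto
    have "a < p" using p less.prems by (metis le_less)
    obtain b1 where b1: "p < b1" "\<forall>y\<in>{y. A z y}. \<not> (p < y \<and> y \<le> b1)" using gap_right[OF fin] by blast
    have "p < min b1 b" using b1 p by simp
    then obtain d where d: "p < d" "d < min b1 b" using dense by blast
    have nd: "\<not> A z y" if "p < y" "y \<le> d" for y using b1 d that by auto
    have "near z (\<lambda>z'. \<exists>y'. a \<le> y' \<and> y' < d \<and> A z' y' \<and> (\<forall>y''. a \<le> y'' \<and> y'' < d \<and> A z' y'' \<longrightarrow> y'' = y'))"
    proof -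
      have "\<forall>y'. a \<le> y' \<and> y' \<le> d \<and> A z y' \<longrightarrow> y' = p"
      proof (intro allI impI)
        fix y assume y: "a \<le> y \<and> y \<le> d \<and> A z y"
        then have "p \<le> y" using pmin[of y] d by auto
        then show "y = p" using nd[of y] y by (cases "p = y") (auto simp: less_le)
      qed
      then show ?thesis using z \<open>a < p\<close> d(1) p(3) unfolding good_def stable_points_def by blast
    qed
    then have 1: "near z (\<lambda>z'. card (?S a d z') = 1)"
    proof (rule near_mono)
      fix z' assume "\<exists>y'. a \<le> y' \<and> y' < d \<and> A z' y' \<and> (\<forall>y''. a \<le> y'' \<and> y'' < d \<and> A z' y'' \<longrightarrow> y'' = y')"
      then obtain y' where "?S a d z' = {y'}" by blast
      then show "card (?S a d z') = 1" by simp
    qed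
    have split: "card (?S a b z') = card (?S a d z') + card (?S d b z')" for z'
    proof -
      have eq: "?S a b z' = ?S a d z' \<union> ?S d b z'" using \<open>a < p\<close> d by auto
      have dis: "?S a d z' \<inter> ?S d b z' = {}" by auto
      show ?thesis unfolding eq by (rule card_Un_disjoint[OF fS fS dis])
    qed
    have "card (?S d b z) < card (?S a b z)" using split[of z] near_imp[OF 1] by simp
    moreover have "d < b" "\<not> A z d" using d nd by auto
    ultimately have "near z (\<lambda>z'. card (?S d b z') = card (?S d b z))"
      using less.hyps[of d] less.prems by blast
    from near_conj[OF 1 this] show ?thesis
      by (rule near_mono) (use split near_imp[OF 1] in simp)
  qed
qed

lemma card_fibre_near:
  assumes "good A z" shows "near z (\<lambda>z'. card {y. A z' y} = card {y. A z y})"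
proof -
  obtain c d where cd: "near z (\<lambda>z'. \<forall>y. A z' y \<longrightarrow> c < y \<and> y < d)"
    using assms unfolding good_def locally_bounded_def by blast
  \<comment> \<open>\<open>b\<close> is taken above both bounds, since c < d is not guaranteed when
    the nearby fibres are empty.\<close>
  obtain b where b: "max c d < b" using ex_greater by blast
  then have "c < b" by simp
  have n: "\<not> A z c" "\<not> A z b" using near_imp[OF cd] b by force+
  show ?thesis
  proof (rule near_mono[OF near_conj[OF card_strip_near[OF assms \<open>c < b\<close> n] cd]], elim conjE)
    fix z' assume e: "card {y. c \<le> y \<and> y < b \<and> A z' y} = card {y. c \<le> y \<and> y < b \<and> A z y}"
      and "\<forall>y. A z' y \<longrightarrow> c < y \<and> y < d"
    then have "{y. A z' y} = {y. c \<le> y \<and> y < b \<and> A z' y}" using b by force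
    moreover have "{y. A z y} = {y. c \<le> y \<and> y < b \<and> A z y}" using near_imp[OF cd] b by force
    ultimately show "card {y. A z' y} = card {y. A z y}" using e by metis
  qed
qed

text \<open>If the sizes differed, the definable set where the size equals that over
  \<open>z1\<close> would have a boundary point in between, contrary to local constancy
  there.\<close>

lemma card_fibre_const:
  assumes "z1 < z2" "\<And>z. z1 \<le> z \<Longrightarrow> z \<le> z2 \<Longrightarrow> good A z"
  shows "card {y. A z1 y} = card {y. A z2 y}"
proof (rule ccontr)
  assume ne: "card {y. A z1 y} \<noteq> card {y. A z2 y}"
  define Q where "Q z \<longleftrightarrow> card {y. A z y} = card {y. A z1 y}" for z
  have "dpred (\<lambda>e. A (e 1) (e 0))" by (rule dpred_comp2[OF A dfun_var dfun_var])
  then have "dpred (\<lambda>e. Q (e 0))"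
    unfolding Q_def by (intro dpred_card_eq[of "\<lambda>y e. A (e 0) y"]) (simp_all add: fin)
  then obtain w where w: "z1 \<le> w" "w \<le> z2" "boundary Q w"
    using boundary_between[of Q z1 z2] assms(1) ne unfolding Q_def by auto
  from card_fibre_near[OF assms(2)[OF w(1,2)]]
  obtain u v where "u < w" "w < v" "\<forall>z. u < z \<and> z < v \<longrightarrow> card {y. A z y} = card {y. A w y}"
    unfolding near_def by blast
  then show False using w(3) unfolding boundary_def Q_def by metis
qed

end

text \<open>
  The cardinality of the fibre is locally constant in the first variable except at finitely many bad
  values. So it suffices to bound it on a finite set of sample values, which is definable from the
  other variables.
\<close>

lemma uniform_finiteness:
  assumes "dpred (\<lambda>e. T (\<lambda>i. e (Suc i)) (e 0))" "\<And>e e'. (\<And>i. i < N \<Longrightarrow> e i = e' i) \<Longrightarrow> T e = T e'"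
    and "\<And>e. finite {y. T e y}"
  shows "\<exists>k. \<forall>e. card {y. T e y} \<le> k"
  using assms
proof (induction N arbitrary: T)
  case 0
  then have "T e = T undefined" for e by blast
  then show ?case by (metis order_refl)
next
  case (Suc N)
  \<comment> \<open>The first parameter is split off as \<open>z\<close>; the others form
    \<open>x\<close> and stay fixed while the fibre over \<open>z\<close> varies.\<close>
  define A where "A x z y = T (case_nat z x) y" for x :: "nat \<Rightarrow> 'a" and z y
  define bad where "bad x z \<longleftrightarrow> \<not> good (A x) z" for x z
  define T' where "T' x y \<longleftrightarrow> (\<exists>z. sample (bad x) z \<and> A x z y)" for x y
  have Asub: "dpred (\<lambda>e. A (\<lambda>i. s i e) (t e) (r e))" if "\<And>i. dfun (s i)" "dfun t" "dfun r" for s t r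
  proof -
    have "dfun (case_nat r (case_nat t s) i)" for i using that by (auto split: nat.split)
    from dpred_subst_env[OF Suc.prems(1), of "case_nat r (case_nat t s)", OF this]
    have "dpred (\<lambda>e. T (\<lambda>i. case_nat t s i e) (r e))" by simp
    moreover have "(\<lambda>i. case_nat t s i e) = case_nat (t e) (\<lambda>i. s i e)" for e by (auto split: nat.split)
    ultimately show ?thesis unfolding A_def by simp
  qed
  have fin: "finite {y. A x z y}" for x z unfolding A_def by (rule Suc.prems(3))
  have sec: "dpred (\<lambda>e. A x (e 0) (e 1))" for x by (rule Asub[of "\<lambda>i e. x i"]) (intro dintros)+
  have bad: "finite {z. bad x z}" for x unfolding bad_def by (rule finite_not_good[OF sec fin])
  have badd: "dpred (\<lambda>e. bad (\<lambda>i. e (\<sigma> i)) (e 0))" for \<sigma>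
    unfolding bad_def good_def stable_gaps_def stable_points_def locally_bounded_def near_def
    by (intro dintros Asub)
  obtain k where k: "\<And>e. card {y. T' e y} \<le> k"
  proof -
    have "dpred (\<lambda>e. T' (\<lambda>i. e (Suc i)) (e 0))"
      unfolding T'_def by (intro dintros Asub badd)
    moreover have "T' e = T' e'" if "\<And>i. i < N \<Longrightarrow> e i = e' i" for e e'
    proof -
      have "T (case_nat z e) = T (case_nat z e')" for z
        by (rule Suc.prems(2)) (use that in \<open>auto split: nat.split\<close>)
      then have "A e = A e'" unfolding A_def by simp
      then show ?thesis unfolding T'_def bad_def by simp
    qed
    moreover have "finite {y. T' e y}" for e
    proof -
      have "{y. T' e y} = (\<Union>z\<in>{z. sample (bad e) z}. {y. A e z y})" unfolding T'_def by auto
      then show ?thesis using finite_sample[OF bad] fin by simp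
    qed
    ultimately have "\<exists>k. \<forall>e. card {y. T' e y} \<le> k" by (rule Suc.IH)
    then show ?thesis using that by blast
  qed
  have "card {y. T e y} \<le> k" for e
  proof -
    define x z where "x = (\<lambda>i. e (Suc i))" "z = e 0"
    have e: "T e = A x z" unfolding A_def x_z_def by (rule arg_cong[of _ _ T]) (auto split: nat.split)
    \<comment> \<open>Unless \<open>c = z\<close>, every bad value lies on the same side of both, so
      none lies between them.\<close>
    obtain c where c: "sample (bad x) c" "c = z \<or> (\<forall>b. bad x b \<longrightarrow> b < z \<and> b < c \<or> z < b \<and> c < b)"
      using sample_meets[OF bad] by blast
    have "card {y. A x z y} = card {y. A x c y}"
    proof (cases c z rule: linorder_cases)
      case less
      then have "good (A x) w" if "c \<le> w" "w \<le> z" for w using c(2) that unfolding bad_def by force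
      from card_fibre_const[OF sec fin less this] show ?thesis by simp
    next
      case greater
      then have "good (A x) w" if "z \<le> w" "w \<le> c" for w using c(2) that unfolding bad_def by force
      from card_fibre_const[OF sec fin greater this] show ?thesis by simp
    qed simp
    also have "\<dots> \<le> card {y. T' x y}"
    proof (rule card_mono)
      have "{y. T' x y} = (\<Union>z\<in>{z. sample (bad x) z}. {y. A x z y})" unfolding T'_def by auto
      then show "finite {y. T' x y}" using finite_sample[OF bad] fin by simp
      show "{y. A x c y} \<subseteq> {y. T' x y}" unfolding T'_def using c(1) by blast
    qed
    also have "\<dots> \<le> k" by (rule k)
    finally show ?thesis unfolding e .
  qed
  then show ?case by blast
qed

section \<open>Changes of truth value along the line\<close>

text \<open>
  \<open>alt i P\<close> is the upper set of those points above which \<open>P\<close> changes its truth value fewer than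
  \<open>i\<close> times; \<open>P\<close> is constant on each difference \<open>alt (Suc i) P - alt i P\<close>.
\<close>

primrec alt :: "nat \<Rightarrow> ('a \<Rightarrow> bool) \<Rightarrow> 'a \<Rightarrow> bool" where
  "alt 0 P y \<longleftrightarrow> False"
| "alt (Suc i) P y \<longleftrightarrow> (\<forall>z. y \<le> z \<and> \<not> alt i P z \<longrightarrow> P z) \<or> (\<forall>z. y \<le> z \<and> \<not> alt i P z \<longrightarrow> \<not> P z)"

lemma alt_up: "alt i P y \<Longrightarrow> y \<le> y' \<Longrightarrow> alt i P y'"
  by (cases i) (auto intro: order_trans)

lemma alt_const:
  assumes "alt (Suc i) P a" "\<not> alt i P a" "alt (Suc i) P b" "\<not> alt i P b"
  shows "P a \<longleftrightarrow> P b"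
proof (cases "a \<le> b")
  case True
  then show ?thesis using assms(1,2,4) unfolding alt.simps by (metis order_refl)
next
  case False
  then show ?thesis using assms(2-4) unfolding alt.simps by (metis order_refl linear)
qed

lemma dpred_alt [dintros]:
  assumes P: "dpred (\<lambda>e. P (e 0) (\<lambda>i. e (Suc i)))" and s: "dfun s"
  shows "dpred (\<lambda>e. alt k (\<lambda>a. P a e) (s e))"
proof (rule dpred_subst[OF _ s])
  show "dpred (\<lambda>e. alt k (\<lambda>a. P a (\<lambda>i. e (Suc i))) (e 0))"
  proof (induction k)
    case 0 then show ?case by (simp add: dpred_const)
  next
    case (Suc k)
    have 1: "dpred (\<lambda>e. alt k (\<lambda>a. P a (\<lambda>i. e (Suc (Suc i)))) (e 0))"
      using dpred_rename[OF Suc.IH, of "case_nat 0 (\<lambda>i. Suc (Suc i))"] by simp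
    have 2: "dpred (\<lambda>e. P (e 0) (\<lambda>i. e (Suc (Suc i))))"
      using dpred_rename[OF P, of "case_nat 0 (\<lambda>i. Suc (Suc i))"] by simp
    show ?case unfolding alt.simps by (intro dintros 1 2)
  qed
qed

text \<open>Descending one level of \<open>alt\<close> moves up to a point of opposite truth value.
  Two levels are spent per boundary point: the point \<open>b\<close> found up to \<open>y1\<close>
  may equal \<open>y1\<close>, and the further step to \<open>y2\<close> separates it from those
  counted later.\<close>

lemma not_alt_imp_boundary:
  assumes P: "dpred (\<lambda>e. P (e 0))" and "\<not> alt (2 * i) P y"
  shows "i \<le> card {b. boundary P b \<and> y \<le> b}"
  using assms(2)
proof (induction i arbitrary: y)
  case (Suc i)
  have step: "\<exists>z>y. \<not> alt j P z \<and> P z \<noteq> P y" if "\<not> alt (Suc j) P y" for j y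
    using that by (metis alt.simps(2) le_less)
  obtain y1 where y1: "y < y1" "\<not> alt (Suc (2 * i)) P y1" "P y1 \<noteq> P y"
    using step[of "Suc (2 * i)" y] Suc.prems by auto
  obtain y2 where y2: "y1 < y2" "\<not> alt (2 * i) P y2" using step[OF y1(2)] by blast
  obtain b where b: "y \<le> b" "b \<le> y1" "boundary P b" using boundary_between[OF P y1(1)] y1(3) by blast
  have fin: "finite {b. boundary P b \<and> y \<le> b}" for y by (rule finite_subset[OF _ finite_boundary[OF P]]) auto
  have "Suc i \<le> card (insert b {b. boundary P b \<and> y2 \<le> b})"
    using Suc.IH[OF y2(2)] b(2) y2(1) fin[of y2] by (subst card_insert_disjoint) auto
  also have "\<dots> \<le> card {b. boundary P b \<and> y \<le> b}"
    by (rule card_mono[OF fin]) (use b y1 y2 in auto)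
  finally show ?case .
qed simp

text \<open>The boundary points form a definable family of finite sets, to which uniform finiteness
  applies.\<close>

theorem uniform_alternation:
  assumes "dpred (\<lambda>e. T (\<lambda>i. e (Suc i)) (e 0))"
  shows "\<exists>k. \<forall>e y. alt k (T e) y"
proof -
  have d: "dpred (\<lambda>e'. T e (e' 0))" for e
    by (rule dpred_section[of "\<lambda>a e. T e a"]) (use assms in simp)
  obtain \<phi> where f: "wf_fm M \<phi>" "\<And>e. sat M e \<phi> \<longleftrightarrow> T (\<lambda>i. e (Suc i)) (e 0)"
    using assms unfolding dpred_def by blast
  obtain N where N: "\<And>i. i \<in> free_vars \<phi> \<Longrightarrow> i < N" using free_bound[of \<phi>] by blast
  have dep: "T e = T e'" if "\<And>i. i < N \<Longrightarrow> e i = e' i" for e e'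
  proof
    fix y
    have "sat M (case_nat y e) \<phi> \<longleftrightarrow> sat M (case_nat y e') \<phi>"
      by (rule sat_cong) (use that N in \<open>auto split: nat.split dest: N\<close>)
    then show "T e y = T e' y" by (simp add: f)
  qed
  have "\<exists>k. \<forall>e. card {y. boundary (T e) y} \<le> k"
  proof (rule uniform_finiteness[of "\<lambda>e. boundary (T e)" N])
    show "dpred (\<lambda>e. boundary (T (\<lambda>i. e (Suc i))) (e 0))"
      using dpred_boundary[of "\<lambda>a e. T (\<lambda>i. e (Suc i)) a", OF _ dfun_var[of 0]]
        dpred_rename[OF assms, of "case_nat 0 (\<lambda>i. Suc (Suc i))"] by simp
    show "finite {y. boundary (T e) y}" for e by (rule finite_boundary[OF d])
  qed (use dep in metis)
  then obtain k where k: "\<And>e. card {y. boundary (T e) y} \<le> k" by blast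
  have "alt (2 * Suc k) (T e) y" for e y
  proof (rule ccontr)
    assume "\<not> alt (2 * Suc k) (T e) y"
    from not_alt_imp_boundary[OF d this] have "Suc k \<le> card {b. boundary (T e) b \<and> y \<le> b}" .
    also have "\<dots> \<le> card {b. boundary (T e) b}"
      by (rule card_mono[OF finite_boundary[OF d]]) auto
    finally show False using k[of e] by simp
  qed
  then show ?thesis by blast
qed

section \<open>Germs at zero\<close>

definition ev :: "('a \<Rightarrow> bool) \<Rightarrow> bool" where
  "ev Q \<longleftrightarrow> (\<exists>\<delta>>0. \<forall>s. 0 < s \<and> s < \<delta> \<longrightarrow> Q s)"

lemma ev_mono: "ev P \<Longrightarrow> (\<And>s. 0 < s \<Longrightarrow> P s \<Longrightarrow> Q s) \<Longrightarrow> ev Q"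
  unfolding ev_def by blast

lemma ev_conj: "ev P \<Longrightarrow> ev Q \<Longrightarrow> ev (\<lambda>s. P s \<and> Q s)"
proof -
  assume "ev P" "ev Q"
  then obtain \<delta> \<delta>' where "\<delta> > 0" "\<forall>s. 0 < s \<and> s < \<delta> \<longrightarrow> P s" "\<delta>' > 0" "\<forall>s. 0 < s \<and> s < \<delta>' \<longrightarrow> Q s"
    unfolding ev_def by blast
  then show ?thesis unfolding ev_def by (intro exI[of _ "min \<delta> \<delta>'"]) simp
qed

lemma ev_True: "(\<And>s. 0 < s \<Longrightarrow> Q s) \<Longrightarrow> ev Q"
  unfolding ev_def using ex_greater by blast

lemma ev_imp_ex: "ev Q \<Longrightarrow> \<exists>s>0. Q s"
  unfolding ev_def using dense by blast

lemma dpred_ev [dintros]: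
  assumes "dpred (\<lambda>e. Q (e 0) (\<lambda>i. e (Suc i)))" shows "dpred (\<lambda>e. ev (\<lambda>s. Q s e))"
proof -
  have "dpred (\<lambda>e. Q (e 0) (\<lambda>i. e (Suc (Suc i))))"
    using dpred_rename[OF assms, of "case_nat 0 (\<lambda>i. Suc (Suc i))"] by simp
  then show ?thesis unfolding ev_def by (intro dintros)
qed

text \<open>Only finitely many boundary points exist, so some interval just to the right of 0
  contains none.\<close>

lemma ev_decides:
  assumes "dpred (\<lambda>e. Q (e 0))" shows "ev Q \<or> ev (\<lambda>s. \<not> Q s)"
proof -
  obtain \<delta> where d: "0 < \<delta>" "\<forall>y\<in>{y. boundary Q y}. \<not> (0 < y \<and> y \<le> \<delta>)"
    using gap_right[OF finite_boundary[OF assms]] by blast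
  have *: "Q s = Q s'" if s: "0 < s" "s < s'" "s' < \<delta>" for s s'
  proof (rule ccontr)
    assume "Q s \<noteq> Q s'"
    then obtain y where "s \<le> y" "y \<le> s'" "boundary Q y" using boundary_between[OF assms s(2)] by blast
    then show False using d s by force
  qed
  obtain s0 where s0: "0 < s0" "s0 < \<delta>" using dense d(1) by blast
  have "Q s = Q s0" if s: "0 < s \<and> s < \<delta>" for s
  proof (cases s s0 rule: linorder_cases)
    case less then show ?thesis by (rule *[OF conjunct1[OF s] _ s0(2)])
  next
    case greater then show ?thesis by (rule *[OF s0(1) _ conjunct2[OF s], symmetric])
  qed simp
  then show ?thesis unfolding ev_def using d(1) by blast
qed

lemma ev_all_less: "(\<And>i. i < k \<Longrightarrow> ev (Q i)) \<Longrightarrow> ev (\<lambda>s. \<forall>i<(k::nat). Q i s)"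
proof (induction k)
  case (Suc k)
  then have "ev (\<lambda>s. (\<forall>i<k. Q i s) \<and> Q k s)" by (intro ev_conj) auto
  then show ?case by (rule ev_mono) (auto simp: less_Suc_eq)
qed (simp add: ev_True)

text \<open>Turns an index that varies with \<open>s\<close> into one that serves all small
  \<open>s\<close>.\<close>

lemma ev_ex_less:
  assumes "\<And>i. i < k \<Longrightarrow> dpred (\<lambda>e. Q i (e 0))" "ev (\<lambda>s. \<exists>i<(k::nat). Q i s)"
  shows "\<exists>i<k. ev (Q i)"
proof (rule ccontr)
  assume "\<not> (\<exists>i<k. ev (Q i))"
  then have "ev (\<lambda>s. \<not> Q i s)" if "i < k" for i using ev_decides[OF assms(1)[OF that]] that by blast
  then have "ev (\<lambda>s. \<forall>i<k. \<not> Q i s)" by (rule ev_all_less)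
  from ev_imp_ex[OF ev_conj[OF this assms(2)]] show False by blast
qed

text \<open>
  With \<open>r = s - 0\<close>, where \<open>0\<close> is the zero of the group and subtraction that of the field:
  \<open>v\<close> lies in the \<open>r\<close>-neighbourhood of \<open>a\<close> or \<open>1/r\<close>-close to infinity.
\<close>

definition close :: "'a \<Rightarrow> 'a \<Rightarrow> 'a \<Rightarrow> bool" where
  "close s v a \<longleftrightarrow> one\<^sub>F \<le> (s \<^bold>- 0) \<^bold>* v \<or> (s \<^bold>- 0) \<^bold>* v \<le> neg\<^sub>F one\<^sub>F \<or> (a \<^bold>- (s \<^bold>- 0) < v \<and> v < a \<^bold>+ (s \<^bold>- 0))"

lemma dpred_close [dintros]: "dfun s \<Longrightarrow> dfun v \<Longrightarrow> dfun a \<Longrightarrow> dpred (\<lambda>e. close (s e) (v e) (a e))"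
  unfolding close_def by (intro dintros)

text \<open>The two zeros may differ: \<delta> is \<epsilon> translated by the zero of the group in
  the addition of the field.\<close>

lemma ev_small: "zero\<^sub>F < \<epsilon> \<Longrightarrow> ev (\<lambda>s. zero\<^sub>F < s \<^bold>- 0 \<and> s \<^bold>- 0 < \<epsilon>)"
  unfolding ev_def by (rule exI[of _ "\<epsilon> \<^bold>+ 0"]) (simp add: fld.diff_less_eq)

lemma ev_not_large: "ev (\<lambda>s. \<not> one\<^sub>F \<le> (s \<^bold>- 0) \<^bold>* v \<and> \<not> (s \<^bold>- 0) \<^bold>* v \<le> neg\<^sub>F one\<^sub>F)"
proof (cases "v = zero\<^sub>F")
  case True then show ?thesis by (intro ev_True) simp
next
  case False
  then have av: "zero\<^sub>F < abs\<^sub>F v" by simp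
  then have "zero\<^sub>F < div\<^sub>F one\<^sub>F (abs\<^sub>F v)" by simp
  from ev_small[OF this] show ?thesis
  proof (rule ev_mono)
    fix s assume s: "zero\<^sub>F < s \<^bold>- 0 \<and> s \<^bold>- 0 < div\<^sub>F one\<^sub>F (abs\<^sub>F v)"
    then have "abs\<^sub>F ((s \<^bold>- 0) \<^bold>* v) < one\<^sub>F"
      using av fld.abs_of_pos[of "s \<^bold>- 0"] by (simp add: fld.pos_less_divide_eq fld.abs_mult)
    then show "\<not> one\<^sub>F \<le> (s \<^bold>- 0) \<^bold>* v \<and> \<not> (s \<^bold>- 0) \<^bold>* v \<le> neg\<^sub>F one\<^sub>F" by (auto simp: fld.abs_less_iff fld.minus_less_iff)
  qed
qed

text \<open>Eventually neither element counts as near infinity, and closeness to a common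
  \<open>a\<close> would put them less than 2r apart. Uniformity in \<open>a\<close> is essential,
  because it is applied to points that move with \<open>s\<close>.\<close>

lemma ev_not_both_close:
  assumes "v \<noteq> v'" shows "ev (\<lambda>s. \<forall>a. \<not> (close s v a \<and> close s v' a))"
proof -
  have *: "ev (\<lambda>s. \<forall>a. \<not> (close s v a \<and> close s v' a))" if "v < v'" for v v'
  proof -
    have "zero\<^sub>F < v' \<^bold>- v" using that by simp
    then obtain \<epsilon> where e: "zero\<^sub>F < \<epsilon>" "\<epsilon> \<^bold>+ \<epsilon> < v' \<^bold>- v" using ex_small by blast
    from ev_conj[OF ev_small[OF e(1)] ev_conj[OF ev_not_large[of v] ev_not_large[of v']]]
    show ?thesis
    proof (rule ev_mono, intro allI notI)
      fix s a
      assume s: "(zero\<^sub>F < s \<^bold>- 0 \<and> s \<^bold>- 0 < \<epsilon>) \<and>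
        (\<not> one\<^sub>F \<le> (s \<^bold>- 0) \<^bold>* v \<and> \<not> (s \<^bold>- 0) \<^bold>* v \<le> neg\<^sub>F one\<^sub>F) \<and>
        \<not> one\<^sub>F \<le> (s \<^bold>- 0) \<^bold>* v' \<and> \<not> (s \<^bold>- 0) \<^bold>* v' \<le> neg\<^sub>F one\<^sub>F"
        and c: "close s v a \<and> close s v' a"
      define r where "r = s \<^bold>- 0"
      have "a \<^bold>- r < v" "v' < a \<^bold>+ r" using s c unfolding close_def r_def by auto
      then have "a < v \<^bold>+ r" "v' \<^bold>+ a < (a \<^bold>+ r) \<^bold>+ (v \<^bold>+ r)"
        using fld.add_strict_mono by (auto simp: fld.diff_less_eq)
      then have "a \<^bold>+ v' < a \<^bold>+ (v \<^bold>+ (r \<^bold>+ r))" by (simp add: fld.add_ac)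
      then have "v' < v \<^bold>+ (r \<^bold>+ r)" by simp
      also have "v \<^bold>+ (r \<^bold>+ r) < v \<^bold>+ (\<epsilon> \<^bold>+ \<epsilon>)"
        using s unfolding r_def by (intro fld.add_strict_left_mono fld.add_strict_mono) blast+
      finally have "v' < v \<^bold>+ (\<epsilon> \<^bold>+ \<epsilon>)" .
      then show False using e(2) by (simp add: fld.less_diff_eq fld.add_commute)
    qed
  qed
  show ?thesis
  proof (cases "v < v'")
    case False
    then have "v' < v" using assms by simp
    from *[OF this] show ?thesis by (rule ev_mono) blast
  qed (rule *)
qed

text \<open>\<open>P\<close> may lack a least element or be unbounded below. After discarding the
  elements that count as near minus infinity, the rest is bounded below by -1/r, and an element less
  than \<open>r\<close> above the infimum serves; if nothing is left, any element of
  \<open>P\<close> does.\<close>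

lemma ex_close_left:
  assumes P: "dpred (\<lambda>e. P (e 0))" "P p" and s: "0 < s"
  shows "\<exists>a. P a \<and> (\<forall>v. P v \<and> v < a \<longrightarrow> close s v a)"
proof -
  define r where "r = s \<^bold>- 0"
  have r: "zero\<^sub>F < r" using s unfolding r_def by simp
  define P1 where "P1 v \<longleftrightarrow> P v \<and> neg\<^sub>F one\<^sub>F < r \<^bold>* v" for v
  show ?thesis
  proof (cases "\<exists>v. P1 v")
    case False
    then have "r \<^bold>* v \<le> neg\<^sub>F one\<^sub>F" if "P v" for v using that unfolding P1_def by auto
    then show ?thesis using P(2) unfolding close_def r_def by blast
  next
    case True
    then obtain v0 where v0: "P1 v0" by blast
    define U where "U y \<longleftrightarrow> (\<exists>v. v \<le> y \<and> P1 v)" for y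
    have "dpred (\<lambda>e. U (e 0))" unfolding U_def P1_def by (intro dintros dpred_comp1[OF P(1)])
    moreover have "U y" if "U x" "x \<le> y" for x y using that unfolding U_def by (meson order_trans)
    moreover have "U v0" unfolding U_def using v0 by blast
    moreover have "\<not> U (neg\<^sub>F (inv\<^sub>F r))"
    proof
      assume "U (neg\<^sub>F (inv\<^sub>F r))"
      then obtain v where v: "v \<le> neg\<^sub>F (inv\<^sub>F r)" "P1 v" unfolding U_def by blast
      then have "r \<^bold>* v \<le> r \<^bold>* neg\<^sub>F (inv\<^sub>F r)" using r by (intro fld.mult_left_mono) auto
      moreover have "r \<^bold>* neg\<^sub>F (inv\<^sub>F r) = neg\<^sub>F one\<^sub>F" using r by (simp add: fld.right_inverse)
      ultimately have "r \<^bold>* v \<le> neg\<^sub>F one\<^sub>F" by simp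
      then show False using v(2) unfolding P1_def by (blast dest: leD)
    qed
    ultimately obtain m where m: "\<And>y. m < y \<Longrightarrow> U y" "\<And>y. y < m \<Longrightarrow> \<not> U y"
      using upper_set_cut[of U v0 "neg\<^sub>F (inv\<^sub>F r)"] by blast
    have "m < m \<^bold>+ r" using r by simp
    then obtain c where c: "m < c" "c < m \<^bold>+ r" using dense by blast
    then obtain a where a: "a \<le> c" "P1 a" using m(1) unfolding U_def by blast
    have "close s v a" if "P v" "v < a" for v
    proof (cases "P1 v")
      case True
      then have "m \<le> v" using m(2)[of v] unfolding U_def by (meson not_le order_refl)
      then have "m \<^bold>+ r \<le> v \<^bold>+ r" by simp
      then have "a < v \<^bold>+ r" using a(1) c(2) by (meson le_less_trans less_le_trans)
      moreover have "v < a \<^bold>+ r" using that(2) r by (metis fld.less_add_same_cancel1 less_trans)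
      ultimately show ?thesis unfolding close_def r_def[symmetric] by (simp add: fld.diff_less_eq)
    next
      case False
      then have "r \<^bold>* v \<le> neg\<^sub>F one\<^sub>F" using that(1) unfolding P1_def by (blast intro: leI)
      then show ?thesis unfolding close_def r_def by blast
    qed
    then show ?thesis using a unfolding P1_def by blast
  qed
qed

text \<open>Reflection exchanges the two sides, which carries the result on lower ends over to upper
  ends.\<close>

lemma close_um: "close s (zero\<^sub>F \<^bold>- v) (zero\<^sub>F \<^bold>- a) \<longleftrightarrow> close s v a"
proof -
  have "(r \<^bold>* neg\<^sub>F v \<le> neg\<^sub>F one\<^sub>F) = (one\<^sub>F \<le> r \<^bold>* v)" "(one\<^sub>F \<le> r \<^bold>* neg\<^sub>F v) = (r \<^bold>* v \<le> neg\<^sub>F one\<^sub>F)" for r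
    using fld.le_minus_iff[of one\<^sub>F "r \<^bold>* v"] by simp_all
  moreover have "(neg\<^sub>F a \<^bold>- r < neg\<^sub>F v) = (v < a \<^bold>+ r)" for r
    using fld.neg_less_iff_less[of "a \<^bold>+ r" v] by (simp add: fld.add_commute)
  moreover have "(neg\<^sub>F v < neg\<^sub>F a \<^bold>+ r) = (a \<^bold>- r < v)" for r
    using fld.neg_less_iff_less[of v "a \<^bold>- r"] by (simp add: fld.add_commute)
  ultimately show ?thesis unfolding close_def by auto
qed

lemma ex_close_right:
  assumes P: "dpred (\<lambda>e. P (e 0))" "P p" and s: "0 < s"
  shows "\<exists>a. P a \<and> (\<forall>v. P v \<and> a < v \<longrightarrow> close s v a)"
proof -
  have "dpred (\<lambda>e. P (zero\<^sub>F \<^bold>- e 0))" by (rule dpred_comp1[OF P(1)]) (intro dintros)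
  from ex_close_left[OF this _ s, of "zero\<^sub>F \<^bold>- p"] P(2)
  obtain a where a: "P (zero\<^sub>F \<^bold>- a)" "\<And>v. P (zero\<^sub>F \<^bold>- v) \<Longrightarrow> v < a \<Longrightarrow> close s v a" by auto
  have "close s v (zero\<^sub>F \<^bold>- a)" if "P v" "zero\<^sub>F \<^bold>- a < v" for v
    using a(2)[of "zero\<^sub>F \<^bold>- v"] that close_um[of s v "zero\<^sub>F \<^bold>- a"] by (simp add: fld.minus_less_iff)
  then show ?thesis using a(1) by blast
qed

section \<open>Definable types as quantifiers\<close>

text \<open>Monotonicity and closure under conjunction are imposed for arbitrary predicates, so that
  definability has to be checked only where \<open>G\<close> decides a predicate or is applied to a
  family.\<close>

definition dquant :: "nat \<Rightarrow> (('a list \<Rightarrow> bool) \<Rightarrow> bool) \<Rightarrow> bool" where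
  "dquant n G \<longleftrightarrow>
     (\<forall>T. dpred (\<lambda>e. T (map e [0..<n]) (\<lambda>i. e (i + n))) \<longrightarrow> dpred (\<lambda>e. G (\<lambda>x. T x e))) \<and>
     (\<forall>P Q. G P \<and> (\<forall>x. length x = n \<and> P x \<longrightarrow> Q x) \<longrightarrow> G Q) \<and>
     (\<forall>P Q. G P \<and> G Q \<longrightarrow> G (\<lambda>x. P x \<and> Q x)) \<and> \<not> G (\<lambda>x. False) \<and>
     (\<forall>P. dpred (\<lambda>e. P (map e [0..<n])) \<longrightarrow> G P \<or> G (\<lambda>x. \<not> P x))"

lemma dpred_dquant:
  assumes "dquant n G" "dpred (\<lambda>e. T (map e [0..<n]) (\<lambda>i. e (i + n)))"
  shows "dpred (\<lambda>e. G (\<lambda>x. T x e))"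
proof -
  have "\<forall>T. dpred (\<lambda>e. T (map e [0..<n]) (\<lambda>i. e (i + n))) \<longrightarrow> dpred (\<lambda>e. G (\<lambda>x. T x e))"
    using assms(1) unfolding dquant_def by (rule conjunct1)
  from mp[OF spec[OF this, of T] assms(2)] show ?thesis .
qed

lemma dquant_mono:
  assumes "dquant n G" "G P" "\<And>x. length x = n \<Longrightarrow> P x \<Longrightarrow> Q x"
  shows "G Q"
proof -
  have "\<forall>P Q. G P \<and> (\<forall>x. length x = n \<and> P x \<longrightarrow> Q x) \<longrightarrow> G Q"
    using assms(1) unfolding dquant_def by (elim conjE)
  from mp[OF spec[OF spec[OF this, of P], of Q]] show ?thesis using assms(2,3) by simp
qed

lemma dquant_conj:
  assumes "dquant n G" "G P" "G Q" shows "G (\<lambda>x. P x \<and> Q x)"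
proof -
  have "\<forall>P Q. G P \<and> G Q \<longrightarrow> G (\<lambda>x. P x \<and> Q x)"
    using assms(1) unfolding dquant_def by (elim conjE)
  from mp[OF spec[OF spec[OF this, of P], of Q]] show ?thesis using assms(2,3) by simp
qed

lemma dquant_decides:
  assumes "dquant n G" "dpred (\<lambda>e. P (map e [0..<n]))" shows "G P \<or> G (\<lambda>x. \<not> P x)"
proof -
  have "\<forall>P. dpred (\<lambda>e. P (map e [0..<n])) \<longrightarrow> G P \<or> G (\<lambda>x. \<not> P x)"
    using assms(1) unfolding dquant_def by (elim conjE)
  from mp[OF spec[OF this, of P] assms(2)] show ?thesis .
qed

lemma dquant_imp_ex:
  assumes "dquant n G" "G P" shows "\<exists>x. length x = n \<and> P x"
proof (rule ccontr)
  assume n: "\<not> (\<exists>x. length x = n \<and> P x)"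
  have "G (\<lambda>x. False)" by (rule dquant_mono[OF assms]) (use n in blast)
  then show False using assms(1) unfolding dquant_def by (elim conjE) (rule notE)
qed

lemma dquant_True: "dquant n G \<Longrightarrow> (\<And>x. length x = n \<Longrightarrow> P x) \<Longrightarrow> G P"
proof -
  assume G: "dquant n G" and P: "\<And>x. length x = n \<Longrightarrow> P x"
  have "G (\<lambda>x. True)"
    using dquant_decides[of n G "\<lambda>x. True", OF G dpred_const] dquant_imp_ex[of n G "\<lambda>x. \<not> True", OF G] by blast
  then show "G P" by (rule dquant_mono[OF G]) (rule P)
qed

lemma dquant_all_less:
  assumes "dquant n G" "\<And>i. i < k \<Longrightarrow> G (P i)" shows "G (\<lambda>x. \<forall>i<(k::nat). P i x)"
  using assms(2)
proof (induction k)
  case 0 then show ?case using dquant_True[OF assms(1)] by simp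
next
  case (Suc k)
  then have "G (\<lambda>x. (\<forall>i<k. P i x) \<and> P k x)" by (intro dquant_conj[OF assms(1)]) auto
  then show ?case by (rule dquant_mono[OF assms(1)]) (auto simp: less_Suc_eq)
qed

section \<open>Curves through definable types\<close>

text \<open>Induction on the number of parameters. The condition left after removing
  \<open>v\<close> speaks of a range of \<open>v\<close> that varies with \<open>s\<close>; this is
  why \<open>S\<close> takes \<open>s\<close> as an argument.\<close>

lemma ex_curve_of_dquant:
  assumes G: "dquant n G"
    and "\<And>u s x. dtup u \<Longrightarrow> dfun s \<Longrightarrow> dtup x \<Longrightarrow> dpred (\<lambda>e. S (u e) (s e) (x e))"
    and "\<And>u. length u = m \<Longrightarrow> ev (\<lambda>s. G (S u s))"
  shows "\<exists>\<gamma>. dtup (\<lambda>e. \<gamma> (e 0)) \<and> (\<forall>u. length u = m \<longrightarrow> ev (\<lambda>s. length (\<gamma> s) = n \<and> S u s (\<gamma> s)))"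
  using assms(2-)
proof (induction m arbitrary: S)
  case 0
  \<comment> \<open>Without parameters a single condition per \<open>s\<close> remains, and
    definable choice picks a point that meets it.\<close>
  define \<gamma> where "\<gamma> s = choice_tup n (S [] s)" for s
  have "dtup (\<lambda>e. \<gamma> (e 0))" unfolding \<gamma>_def by (intro dintros 0(1))
  moreover have "ev (\<lambda>s. length (\<gamma> s) = n \<and> S [] s (\<gamma> s))"
  proof (rule ev_mono[OF 0(2)])
    fix s assume "G (S [] s)"
    then obtain x where "length x = n" "S [] s x" using dquant_imp_ex[OF G] by blast
    moreover have "dpred (\<lambda>e. S [] s (map e [0..<n]))" by (intro dintros 0(1))
    ultimately show "length (\<gamma> s) = n \<and> S [] s (\<gamma> s)" unfolding \<gamma>_def using choice_tup_in by blast
  qed simp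
  ultimately show ?case by auto
next
  case (Suc m)
  note Sd = Suc.prems(1)
  \<comment> \<open>The curve parameter counts among the parameters here, so one bound serves all
    \<open>s\<close>.\<close>
  have "\<exists>k. \<forall>x u s v. length x = n \<longrightarrow> length u = m \<longrightarrow> alt k (\<lambda>v. S (v # u) s x) v"
  proof -
    have "dpred (\<lambda>e. S (e 0 # map (\<lambda>i. e (Suc (Suc i + n))) [0..<m]) (e (Suc n)) (map (\<lambda>i. e (Suc i)) [0..<n]))"
      by (intro Sd dintros)
    then obtain k where k: "\<And>e v. alt k (\<lambda>v. S (v # map (\<lambda>i. e (Suc i + n)) [0..<m]) (e n) (map e [0..<n])) v"
      using uniform_alternation[of "\<lambda>e v. S (v # map (\<lambda>i. e (Suc i + n)) [0..<m]) (e n) (map e [0..<n])"] by auto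
    have "alt k (\<lambda>v. S (v # u) s x) v" if "length x = n" "length u = m" for x u s v
    proof -
      have "map (\<lambda>i. (x @ s # u) ! (Suc i + n)) [0..<m] = u" "map (\<lambda>i. (x @ s # u) ! i) [0..<n] = x"
        "(x @ s # u) ! n = s" using that by (auto intro!: nth_equalityI simp: nth_append)
      then show ?thesis using k[of "\<lambda>i. (x @ s # u) ! i" v] by simp
    qed
    then show ?thesis by blast
  qed
  then obtain k where k: "\<And>x u s v. length x = n \<Longrightarrow> length u = m \<Longrightarrow> alt k (\<lambda>v. S (v # u) s x) v"
    by blast
  \<comment> \<open>\<open>P i\<close> thus collects the \<open>v\<close> that for almost all
    \<open>x\<close> lie in the \<open>i\<close>-th piece of the line.\<close>
  define C where "C i u s v \<longleftrightarrow> G (\<lambda>x. alt i (\<lambda>v. S (v # u) s x) v)" for i u s v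
  define P where "P i u s v \<longleftrightarrow> C (Suc i) u s v \<and> \<not> C i u s v" for i u s v
  \<comment> \<open>\<open>P i\<close> need not have least or greatest elements; \<open>al\<close>
    and \<open>be\<close> are elements of it beyond which all others are \<open>close\<close> at
    scale \<open>s\<close>.\<close>
  define al where "al i u s = choice (\<lambda>a. P i u s a \<and> (\<forall>v. P i u s v \<and> v < a \<longrightarrow> close s v a))" for i u s
  define be where "be i u s = choice (\<lambda>a. P i u s a \<and> (\<forall>v. P i u s v \<and> a < v \<longrightarrow> close s v a))" for i u s
  \<comment> \<open>In the last two clauses \<open>s\<close> is bound by \<open>ev\<close>, so these
    exceptional \<open>v\<close> are the same at every stage of the curve.\<close>
  define K where "K i u s v \<longleftrightarrow> (P i u s (al i u s) \<and> P i u s (be i u s) \<and> al i u s \<le> v \<and> v \<le> be i u s)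
     \<or> ev (\<lambda>s. close s v (al i u s)) \<or> ev (\<lambda>s. close s v (be i u s))" for i u s v
  \<comment> \<open>Membership is demanded only of those \<open>v\<close> for which it holds almost
    surely at this \<open>s\<close>; for a fixed \<open>v\<close> this is the case for all small
    \<open>s\<close>.\<close>
  define S' where "S' u s x \<longleftrightarrow> (\<forall>v. G (S (v # u) s) \<and> (\<exists>i<k. K i u s v) \<longrightarrow> S (v # u) s x)" for u s x
  have Cd: "dpred (\<lambda>e. C i (u e) (s e) (v e))" if "dtup u" "dfun s" "dfun v" for i u s v
    unfolding C_def
    by (intro dpred_dquant[OF G] dpred_alt Sd dtup_Cons dtup_rename[OF that(1)] dfun_rename[OF that(2)]
        dfun_rename[OF that(3)] dfun_var dtup_block)
  have Pd: "dpred (\<lambda>e. P i (u e) (s e) (v e))" if "dtup u" "dfun s" "dfun v" for i u s v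
    unfolding P_def by (intro dintros Cd that)
  have ald: "dfun (\<lambda>e. al i (u e) (s e))" if "dtup u" "dfun s" for i u s
    unfolding al_def by (intro dintros Pd dtup_rename[OF that(1)] dfun_rename[OF that(2)])
  have bed: "dfun (\<lambda>e. be i (u e) (s e))" if "dtup u" "dfun s" for i u s
    unfolding be_def by (intro dintros Pd dtup_rename[OF that(1)] dfun_rename[OF that(2)])
  have Kd: "dpred (\<lambda>e. K i (u e) (s e) (v e))" if "dtup u" "dfun s" "dfun v" for i u s v
    unfolding K_def by (intro dintros Pd ald bed that dtup_rename[OF that(1)] dfun_rename[OF that(3)])
  have S'd: "dpred (\<lambda>e. S' (u e) (s e) (x e))" if "dtup u" "dfun s" "dtup x" for u s x
    unfolding S'_def
    by (intro dpred_all dpred_imp dpred_conj dpred_dquant[OF G] dpred_ex_less Sd Kd dtup_Cons dfun_var dtup_block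
        dtup_rename[OF that(1)] dfun_rename[OF that(2)] dtup_rename[OF that(3)])
  have piece: "G (\<lambda>x. \<forall>v. G (S (v # u) s) \<and> K i u s v \<longrightarrow> S (v # u) s x)" if u: "length u = m" for i u s
  proof -
    \<comment> \<open>Since \<open>alt\<close> is upward closed, \<open>alt (Suc i)\<close> at
      \<open>al\<close> and the failure of \<open>alt i\<close> at \<open>be\<close> place the whole
      interval in one piece for almost all \<open>x\<close>. Membership for \<open>v0\<close> then
      spreads to all of it.\<close>
    have 1: "G (\<lambda>x. \<forall>v. G (S (v # u) s) \<and> P i u s (al i u s) \<and> P i u s (be i u s) \<and> al i u s \<le> v \<and> v \<le> be i u s
       \<longrightarrow> S (v # u) s x)"
    proof (cases "\<exists>v0. G (S (v0 # u) s) \<and> P i u s (al i u s) \<and> P i u s (be i u s) \<and> al i u s \<le> v0 \<and> v0 \<le> be i u s")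
      case True
      then obtain v0 where v0: "G (S (v0 # u) s)" "P i u s (al i u s)" "P i u s (be i u s)" "al i u s \<le> v0" "v0 \<le> be i u s"
        by blast
      have "dpred (\<lambda>e. alt i (\<lambda>v. S (v # u) s (map e [0..<n])) (be i u s))"
        by (intro dintros Sd)
      then have "G (\<lambda>x. \<not> alt i (\<lambda>v. S (v # u) s x) (be i u s))"
        using dquant_decides[OF G, of "\<lambda>x. alt i (\<lambda>v. S (v # u) s x) (be i u s)"] v0(3) unfolding P_def C_def by blast
      moreover have "G (\<lambda>x. alt (Suc i) (\<lambda>v. S (v # u) s x) (al i u s))" using v0(2) unfolding P_def C_def by blast
      ultimately have "G (\<lambda>x. (\<not> alt i (\<lambda>v. S (v # u) s x) (be i u s) \<and> alt (Suc i) (\<lambda>v. S (v # u) s x) (al i u s)) \<and> S (v0 # u) s x)"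
        using v0(1) by (intro dquant_conj[OF G])
      then show ?thesis
      proof (rule dquant_mono[OF G], intro allI impI)
        fix x v assume x: "(\<not> alt i (\<lambda>v. S (v # u) s x) (be i u s) \<and> alt (Suc i) (\<lambda>v. S (v # u) s x) (al i u s)) \<and> S (v0 # u) s x"
          and v: "G (S (v # u) s) \<and> P i u s (al i u s) \<and> P i u s (be i u s) \<and> al i u s \<le> v \<and> v \<le> be i u s"
        have "\<not> alt i (\<lambda>v. S (v # u) s x) w \<and> alt (Suc i) (\<lambda>v. S (v # u) s x) w" if "al i u s \<le> w" "w \<le> be i u s" for w
          using x alt_up that by blast
        then show "S (v # u) s x" using alt_const[of i "\<lambda>v. S (v # u) s x" v v0] v v0 x by blast
      qed
    next
      case False then show ?thesis by (intro dquant_True[OF G]) blast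
    qed
    \<comment> \<open>At most one \<open>v\<close> is eventually close to the moving point
      \<open>f s\<close>, so only one condition is imposed.\<close>
    have 2: "G (\<lambda>x. \<forall>v. G (S (v # u) s) \<and> ev (\<lambda>s. close s v (f s)) \<longrightarrow> S (v # u) s x)" for f
    proof (cases "\<exists>v0. G (S (v0 # u) s) \<and> ev (\<lambda>s. close s v0 (f s))")
      case True
      then obtain v0 where v0: "G (S (v0 # u) s)" "ev (\<lambda>s. close s v0 (f s))" by blast
      have "v = v0" if "ev (\<lambda>s. close s v (f s))" for v
        using ev_imp_ex[OF ev_conj[OF ev_conj[OF that v0(2)] ev_not_both_close[of v v0]]] by blast
      then show ?thesis by (intro dquant_mono[OF G v0(1)]) blast
    next
      case False then show ?thesis by (intro dquant_True[OF G]) blast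
    qed
    define H where "H f x \<longleftrightarrow> (\<forall>v. G (S (v # u) s) \<and> f v \<longrightarrow> S (v # u) s x)" for f x
    define f1 f2 f3 where "f1 v \<longleftrightarrow> P i u s (al i u s) \<and> P i u s (be i u s) \<and> al i u s \<le> v \<and> v \<le> be i u s"
      "f2 v \<longleftrightarrow> ev (\<lambda>s. close s v (al i u s))" "f3 v \<longleftrightarrow> ev (\<lambda>s. close s v (be i u s))" for v
    have "G (H f1)" "G (H f2)" "G (H f3)" unfolding H_def f1_f2_f3_def by (rule 1 2)+
    then have "G (\<lambda>x. H f1 x \<and> H f2 x \<and> H f3 x)" by (intro dquant_conj[OF G])
    then have "G (H (K i u s))"
    proof (rule dquant_mono[OF G])
      fix x assume "H f1 x \<and> H f2 x \<and> H f3 x"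
      moreover have "K i u s v \<longleftrightarrow> f1 v \<or> f2 v \<or> f3 v" for v unfolding K_def f1_f2_f3_def ..
      ultimately show "H (K i u s) x" unfolding H_def by blast
    qed
    then show ?thesis unfolding H_def .
  qed
  have 1: "G (S' u s)" if u: "length u = m" for u s
  proof -
    have "G (\<lambda>x. \<forall>i<k. \<forall>v. G (S (v # u) s) \<and> K i u s v \<longrightarrow> S (v # u) s x)"
      by (rule dquant_all_less[OF G piece[OF u]])
    then show ?thesis by (rule dquant_mono[OF G]) (unfold S'_def, blast)
  qed
  have 2: "ev (\<lambda>s. \<exists>i<k. K i u s v)" if u: "length u = m" for u v
  proof -
    \<comment> \<open>\<open>C\<close> is false at level 0 and true at level \<open>k\<close>, so it
      becomes true at some step.\<close>
    have "\<exists>i<k. P i u s v" for s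
    proof (rule ccontr)
      assume n: "\<not> (\<exists>i<k. P i u s v)"
      have "\<not> C i u s v" if "i \<le> k" for i
        using that
      proof (induction i)
        case 0 then show ?case unfolding C_def using dquant_imp_ex[OF G] by auto
      next
        case (Suc i) then show ?case using n unfolding P_def by auto
      qed
      moreover have "C k u s v" unfolding C_def by (rule dquant_True[OF G]) (use k u in blast)
      ultimately show False by blast
    qed
    \<comment> \<open>The index found for each \<open>s\<close> becomes a fixed one for all small
      \<open>s\<close>.\<close>
    then have "\<exists>i<k. ev (P' i)" if "P' = (\<lambda>i s. P i u s v)" for P'
      unfolding that by (intro ev_ex_less Pd dintros ev_True)
    then obtain i where i: "i < k" "ev (\<lambda>s. P i u s v)" by blast
    have Pc: "dpred (\<lambda>e. P i u s (e 0))" for s by (intro Pd dintros)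
    have a: "P i u s (al i u s) \<and> (\<forall>v. P i u s v \<and> v < al i u s \<longrightarrow> close s v (al i u s))"
      if p: "P i u s v" "0 < s" for s
    proof -
      have "dpred (\<lambda>e. P i u s (e 0) \<and> (\<forall>v. P i u s v \<and> v < e 0 \<longrightarrow> close s v (e 0)))"
        by (intro dintros Pd)
      moreover obtain a where "P i u s a \<and> (\<forall>v. P i u s v \<and> v < a \<longrightarrow> close s v a)"
        using ex_close_left[OF Pc p] by blast
      ultimately show ?thesis
        unfolding al_def by (rule choice_in[of "\<lambda>a. P i u s a \<and> (\<forall>v. P i u s v \<and> v < a \<longrightarrow> close s v a)"])
    qed
    have b: "P i u s (be i u s) \<and> (\<forall>v. P i u s v \<and> be i u s < v \<longrightarrow> close s v (be i u s))"
      if p: "P i u s v" "0 < s" for s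
    proof -
      have "dpred (\<lambda>e. P i u s (e 0) \<and> (\<forall>v. P i u s v \<and> e 0 < v \<longrightarrow> close s v (e 0)))"
        by (intro dintros Pd)
      moreover obtain a where "P i u s a \<and> (\<forall>v. P i u s v \<and> a < v \<longrightarrow> close s v a)"
        using ex_close_right[OF Pc p] by blast
      ultimately show ?thesis
        unfolding be_def by (rule choice_in[of "\<lambda>a. P i u s a \<and> (\<forall>v. P i u s v \<and> a < v \<longrightarrow> close s v a)"])
    qed
    \<comment> \<open>An element eventually below \<open>al\<close> or above \<open>be\<close> is
      eventually close to that end, hence an exception; any other eventually lies between the
      two.\<close>
    have "ev (\<lambda>s. K i u s v)"
    proof (cases "ev (\<lambda>s. v < al i u s)")
      case True
      have "ev (\<lambda>s. close s v (al i u s))"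
        by (rule ev_mono[OF ev_conj[OF True i(2)]]) (use a in blast)
      then show ?thesis unfolding K_def by (intro ev_True) blast
    next
      case False
      have "dpred (\<lambda>e. v < al i u (e 0))" by (intro dintros ald)
      then have na: "ev (\<lambda>s. \<not> v < al i u s)" using ev_decides[of "\<lambda>s. v < al i u s"] False by blast
      show ?thesis
      proof (cases "ev (\<lambda>s. be i u s < v)")
        case True
        have "ev (\<lambda>s. close s v (be i u s))"
          by (rule ev_mono[OF ev_conj[OF True i(2)]]) (use b in blast)
        then show ?thesis unfolding K_def by (intro ev_True) blast
      next
        case False
        have "dpred (\<lambda>e. be i u (e 0) < v)" by (intro dintros bed)
        then have "ev (\<lambda>s. \<not> be i u s < v)" using ev_decides[of "\<lambda>s. be i u s < v"] False by blast
        from ev_conj[OF ev_conj[OF na this] i(2)] show ?thesis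
          by (rule ev_mono) (use a b in \<open>auto simp: K_def not_less\<close>)
      qed
    qed
    then show ?thesis by (rule ev_mono) (use i in blast)
  qed
  have "ev (\<lambda>s. G (S' u s))" if "length u = m" for u by (rule ev_True) (rule 1[OF that])
  from Suc.IH[of S', OF S'd this] obtain \<gamma> where \<gamma>: "dtup (\<lambda>e. \<gamma> (e 0))"
    "\<And>u. length u = m \<Longrightarrow> ev (\<lambda>s. length (\<gamma> s) = n \<and> S' u s (\<gamma> s))" by blast
  have "ev (\<lambda>s. length (\<gamma> s) = n \<and> S u s (\<gamma> s))" if lu: "length u = Suc m" for u
  proof -
    obtain v u' where u: "u = v # u'" "length u' = m" using lu by (cases u) auto
    show ?thesis
      by (rule ev_mono[OF ev_conj[OF \<gamma>(2)[OF u(2)] ev_conj[OF Suc.prems(2)[OF lu] 2[OF u(2), of v]]]])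
        (use u(1) in \<open>auto simp: S'_def\<close>)
  qed
  then show ?case using \<gamma>(1) by blast
qed

section \<open>Types of directed families\<close>

text \<open>\<open>H\<close> is generated by the sets \<open>Z u\<close> together with all definably
  varying final segments \<open>E x\<close> for the new coordinate that meet every
  \<open>Z u\<close> over almost all \<open>x\<close>.\<close>

lemma dquant_extend:
  assumes G: "dquant j G"
    and Z: "\<And>u x. dtup u \<Longrightarrow> dtup x \<Longrightarrow> dpred (\<lambda>e. Z (u e) (x e))"
    and \<Omega>: "definable M m \<Omega>" "u0 \<in> \<Omega>"
    and dir: "\<And>u u'. u \<in> \<Omega> \<Longrightarrow> u' \<in> \<Omega> \<Longrightarrow> \<exists>v\<in>\<Omega>. \<forall>x. Z v x \<longrightarrow> Z u x \<and> Z u' x"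
    and compat: "\<And>u. u \<in> \<Omega> \<Longrightarrow> G (\<lambda>x. \<exists>y. Z u (y # x))"
  shows "\<exists>H. dquant (Suc j) H \<and> (\<forall>u\<in>\<Omega>. H (Z u))"
proof -
  define Edef where "Edef E \<longleftrightarrow> dpred (\<lambda>e. E (map e [0..<j]) (e j))" for E :: "'a list \<Rightarrow> 'a \<Rightarrow> bool"
  define up where "up E \<longleftrightarrow> (\<forall>x y y'. E x y \<and> y \<le> y' \<longrightarrow> E x y')" for E :: "'a list \<Rightarrow> 'a \<Rightarrow> bool"
  \<comment> \<open>The explicit length puts the quantifier over \<open>u\<close> into a form in
    which it preserves definability.\<close>
  define pos where "pos E \<longleftrightarrow> (\<forall>u. length u = m \<longrightarrow> u \<in> \<Omega> \<longrightarrow> G (\<lambda>x. \<exists>y. E x y \<and> Z u (y # x)))" for E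
  define H where "H T \<longleftrightarrow> (\<exists>E u. Edef E \<and> up E \<and> pos E \<and> u \<in> \<Omega> \<and> G (\<lambda>x. \<forall>y. E x y \<and> Z u (y # x) \<longrightarrow> T (y # x)))" for T
  have len: "length u = m" if "u \<in> \<Omega>" for u using \<Omega>(1) that unfolding definable_def tuples_def by auto
  have Ed: "dpred (\<lambda>e. E (map (\<lambda>i. e (f i)) [0..<j]) (e a))" if "Edef E" for E f a
  proof -
    let ?\<sigma> = "\<lambda>i. if i < j then f i else a"
    have eq: "map (\<lambda>i. e (?\<sigma> i)) [0..<j] = map (\<lambda>i. e (f i)) [0..<j]" for e :: "nat \<Rightarrow> 'a"
      by (rule map_cong) auto
    from dpred_rename[OF that[unfolded Edef_def], of ?\<sigma>, unfolded eq] show ?thesis by simp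
  qed
  have posD: "G (\<lambda>x. \<exists>y. E x y \<and> Z u (y # x))" if "pos E" "u \<in> \<Omega>" for E u
    using that len unfolding pos_def by blast
  have H_mono: "H Q" if HP: "H P" and PQ: "\<And>x. length x = Suc j \<Longrightarrow> P x \<Longrightarrow> Q x" for P Q
  proof -
    obtain E u where E: "Edef E" "up E" "pos E" "u \<in> \<Omega>" "G (\<lambda>x. \<forall>y. E x y \<and> Z u (y # x) \<longrightarrow> P (y # x))"
      using HP unfolding H_def by blast
    have "G (\<lambda>x. \<forall>y. E x y \<and> Z u (y # x) \<longrightarrow> Q (y # x))"
      by (rule dquant_mono[OF G E(5)]) (use PQ in auto)
    then show ?thesis unfolding H_def using E by blast
  qed
  have H_conj: "H (\<lambda>x. P x \<and> Q x)" if HP: "H P" and HQ: "H Q" for P Q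
  proof -
    have *: "H (\<lambda>x. P x \<and> Q x)"
      if E: "Edef E" "up E" "pos E" "u \<in> \<Omega>" "G (\<lambda>x. \<forall>y. E x y \<and> Z u (y # x) \<longrightarrow> P (y # x))"
        and E': "u' \<in> \<Omega>" "G (\<lambda>x. \<forall>y. E' x y \<and> Z u' (y # x) \<longrightarrow> Q (y # x))"
        and EE: "G (\<lambda>x. \<forall>y. E x y \<longrightarrow> E' x y)" for P Q E E' u u'
    proof -
      obtain v where v: "v \<in> \<Omega>" "\<forall>x. Z v x \<longrightarrow> Z u x \<and> Z u' x" using dir E(4) E'(1) by blast
      have "G (\<lambda>x. \<forall>y. E x y \<and> Z v (y # x) \<longrightarrow> P (y # x) \<and> Q (y # x))"
        by (rule dquant_mono[OF G dquant_conj[OF G E(5) dquant_conj[OF G E'(2) EE]]]) (use v(2) in simp)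
      then show ?thesis unfolding H_def using E v(1) by blast
    qed
    obtain E u where E: "Edef E" "up E" "pos E" "u \<in> \<Omega>" "G (\<lambda>x. \<forall>y. E x y \<and> Z u (y # x) \<longrightarrow> P (y # x))"
      using HP unfolding H_def by blast
    obtain E' u' where E': "Edef E'" "up E'" "pos E'" "u' \<in> \<Omega>" "G (\<lambda>x. \<forall>y. E' x y \<and> Z u' (y # x) \<longrightarrow> Q (y # x))"
      using HQ unfolding H_def by blast
    \<comment> \<open>Final segments are comparable, and \<open>G\<close> decides which of
      \<open>E x\<close> and \<open>E' x\<close> is almost surely contained in the other; the
      smaller one serves for the conjunction.\<close>
    have "dpred (\<lambda>e. \<forall>y. E (map e [0..<j]) y \<longrightarrow> E' (map e [0..<j]) y)"
      by (intro dpred_all dpred_imp Ed[OF E(1)] Ed[OF E'(1)])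
    from dquant_decides[OF G this]
    show ?thesis
    proof
      assume "G (\<lambda>x. \<forall>y. E x y \<longrightarrow> E' x y)"
      from *[OF E E'(4,5) this] show ?thesis .
    next
      assume "G (\<lambda>x. \<not> (\<forall>y. E x y \<longrightarrow> E' x y))"
      then have "G (\<lambda>x. \<forall>y. E' x y \<longrightarrow> E x y)"
      proof (rule dquant_mono[OF G], intro allI impI)
        fix x y assume "\<not> (\<forall>y. E x y \<longrightarrow> E' x y)" "E' x y"
        then obtain y' where "E x y'" "\<not> E' x y'" by blast
        then have "y' \<le> y" using \<open>E' x y\<close> E'(2) unfolding up_def by (meson linear)
        then show "E x y" using \<open>E x y'\<close> E(2) unfolding up_def by blast
      qed
      from *[OF E' E(4,5) this] show ?thesis by (rule H_mono) blast
    qed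
  qed
  have H_False: "\<not> H (\<lambda>x. False)"
  proof
    assume "H (\<lambda>x. False)"
    then obtain E u where E: "pos E" "u \<in> \<Omega>" "G (\<lambda>x. \<forall>y. E x y \<and> Z u (y # x) \<longrightarrow> False)"
      unfolding H_def by blast
    from dquant_imp_ex[OF G dquant_conj[OF G posD[OF E(1,2)] E(3)]] show False by blast
  qed
  have H_Z: "H (Z u)" if "u \<in> \<Omega>" for u
  proof -
    have "G (\<lambda>x. \<forall>y. True \<and> Z u (y # x) \<longrightarrow> Z u (y # x))" by (rule dquant_True[OF G]) blast
    moreover have "pos (\<lambda>x y. True)" unfolding pos_def using compat by simp
    moreover have "Edef (\<lambda>x y. True)" "up (\<lambda>x y. True)" unfolding Edef_def up_def by (simp_all add: dpred_const)
    ultimately show ?thesis using that unfolding H_def by blast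
  qed
  \<comment> \<open>As \<open>alt i\<close> is not compatible with the family, some
    \<open>Z u\<close> almost surely avoids it. Inside \<open>alt (Suc i)\<close> this
    \<open>Z u\<close> leaves only the \<open>i\<close>-th piece.\<close>
  have piece: "H W"
    if P: "dpred (\<lambda>e. P (map e [0..<Suc j]))"
      and i: "pos (\<lambda>x. alt (Suc i) (\<lambda>y. P (y # x)))" "\<not> pos (\<lambda>x. alt i (\<lambda>y. P (y # x)))"
      and W: "G (\<lambda>x. \<forall>y. alt (Suc i) (\<lambda>y. P (y # x)) y \<and> \<not> alt i (\<lambda>y. P (y # x)) y \<longrightarrow> W (y # x))" for P W i
  proof -
    have P': "dpred (\<lambda>e. P (e a # map (\<lambda>i. e (f i)) [0..<j]))" for a f
      using dpred_rename[OF P[unfolded map_upt_Suc_Cons], of "case_nat a f"] by simp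
    obtain u where u: "u \<in> \<Omega>" "\<not> G (\<lambda>x. \<exists>y. alt i (\<lambda>y. P (y # x)) y \<and> Z u (y # x))"
      using i(2) unfolding pos_def by blast
    have "dpred (\<lambda>e. \<exists>y. alt i (\<lambda>y. P (y # map e [0..<j])) y \<and> Z u (y # map e [0..<j]))"
      by (intro dintros P' Z)
    then have "G (\<lambda>x. \<not> (\<exists>y. alt i (\<lambda>y. P (y # x)) y \<and> Z u (y # x)))"
      using dquant_decides[OF G, of "\<lambda>x. \<exists>y. alt i (\<lambda>y. P (y # x)) y \<and> Z u (y # x)"] u(2) by blast
    from dquant_conj[OF G this W]
    have "G (\<lambda>x. \<forall>y. alt (Suc i) (\<lambda>y. P (y # x)) y \<and> Z u (y # x) \<longrightarrow> W (y # x))"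
      by (rule dquant_mono[OF G]) blast
    moreover have "Edef (\<lambda>x. alt (Suc i) (\<lambda>y. P (y # x)))" unfolding Edef_def by (intro dpred_alt P' dfun_var)
    moreover have "up (\<lambda>x. alt (Suc i) (\<lambda>y. P (y # x)))" unfolding up_def using alt_up by blast
    ultimately show ?thesis unfolding H_def using i(1) u(1) by blast
  qed
  \<comment> \<open>The empty segment \<open>alt 0\<close> is incompatible with the family, the
    whole line \<open>alt k\<close> is compatible; the type lives in the piece where compatibility
    sets in.\<close>
  have ex_piece: "\<exists>i<k. pos (\<lambda>x. alt (Suc i) (\<lambda>y. P (y # x))) \<and> \<not> pos (\<lambda>x. alt i (\<lambda>y. P (y # x)))"
    if k: "\<And>x y. length x = j \<Longrightarrow> alt k (\<lambda>y. P (y # x)) y" for P k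
  proof (rule ccontr)
    assume n: "\<not> ?thesis"
    have "\<not> pos (\<lambda>x. alt i (\<lambda>y. P (y # x)))" if "i \<le> k" for i
      using that
    proof (induction i)
      case 0
      show ?case
      proof
        assume "pos (\<lambda>x. alt 0 (\<lambda>y. P (y # x)))"
        from dquant_imp_ex[OF G posD[OF this \<Omega>(2)]] show False by simp
      qed
    next
      case (Suc i)
      then have "\<not> pos (\<lambda>x. alt i (\<lambda>y. P (y # x)))" "i < k" by simp_all
      then show ?case using n by blast
    qed
    moreover have "pos (\<lambda>x. alt k (\<lambda>y. P (y # x)))"
      unfolding pos_def
    proof (intro allI impI)
      fix u assume "u \<in> \<Omega>"
      from compat[OF this] show "G (\<lambda>x. \<exists>y. alt k (\<lambda>y. P (y # x)) y \<and> Z u (y # x))"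
        by (rule dquant_mono[OF G]) (use k in blast)
    qed
    ultimately show False by blast
  qed
  have H_alt: "H P \<longleftrightarrow> G (\<lambda>x. \<forall>y. alt (Suc i) (\<lambda>y. P (y # x)) y \<and> \<not> alt i (\<lambda>y. P (y # x)) y \<longrightarrow> P (y # x))"
    and H_decides: "H P \<or> H (\<lambda>x. \<not> P x)"
    if P: "dpred (\<lambda>e. P (map e [0..<Suc j]))"
      and i: "pos (\<lambda>x. alt (Suc i) (\<lambda>y. P (y # x)))" "\<not> pos (\<lambda>x. alt i (\<lambda>y. P (y # x)))" for P i
  proof -
    let ?Q = "\<lambda>x. \<forall>y. alt (Suc i) (\<lambda>y. P (y # x)) y \<and> \<not> alt i (\<lambda>y. P (y # x)) y \<longrightarrow> P (y # x)"
    have P': "dpred (\<lambda>e. P (e a # map (\<lambda>i. e (f i)) [0..<j]))" for a f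
      using dpred_rename[OF P[unfolded map_upt_Suc_Cons], of "case_nat a f"] by simp
    have Qd: "dpred (\<lambda>e. ?Q (map e [0..<j]))"
      by (intro dpred_all dpred_imp dpred_conj dpred_not dpred_alt P' dfun_var)
    \<comment> \<open>\<open>P\<close> is constant along the piece, so if it is not almost surely
      true there, it is almost surely false throughout.\<close>
    have 1: "H (\<lambda>x. \<not> P x)" if nQ: "\<not> G ?Q"
    proof -
      have "G (\<lambda>x. \<not> ?Q x)" using dquant_decides[OF G Qd] nQ by blast
      then have "G (\<lambda>x. \<forall>y. alt (Suc i) (\<lambda>y. P (y # x)) y \<and> \<not> alt i (\<lambda>y. P (y # x)) y \<longrightarrow> \<not> P (y # x))"
        by (rule dquant_mono[OF G]) (use alt_const[of i "\<lambda>y. P (y # _)"] in blast)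
      then show ?thesis by (rule piece[OF P i, of "\<lambda>x. \<not> P x"])
    qed
    have 2: "H P" if "G ?Q" by (rule piece[OF P i that])
    have "\<not> (H P \<and> H (\<lambda>x. \<not> P x))"
      using H_conj[of P "\<lambda>x. \<not> P x"] H_False H_mono[of "\<lambda>x. P x \<and> \<not> P x" "\<lambda>x. False"] by blast
    then show "H P \<longleftrightarrow> G ?Q" "H P \<or> H (\<lambda>x. \<not> P x)" using 1 2 by blast+
  qed
  have bound: "\<exists>k. \<forall>e x y. length x = j \<longrightarrow> alt k (\<lambda>y. T (y # x) e) y"
    if "dpred (\<lambda>e. T (map e [0..<Suc j]) (\<lambda>i. e (i + Suc j)))" for T
  proof -
    have "dpred (\<lambda>e. T (e 0 # map (\<lambda>i. e (Suc i)) [0..<j]) (\<lambda>i. e (Suc (i + j))))"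
      using that unfolding map_upt_Suc_Cons by simp
    then obtain k where k: "\<And>e y. alt k (\<lambda>y. T (y # map e [0..<j]) (\<lambda>i. e (i + j))) y"
      using uniform_alternation[of "\<lambda>e y. T (y # map e [0..<j]) (\<lambda>i. e (i + j))"] by auto
    have "alt k (\<lambda>y. T (y # x) e) y" if "length x = j" for e x y
    proof -
      have "map (\<lambda>i. if i < j then x ! i else e (i - j)) [0..<j] = x" using that by (auto intro: nth_equalityI)
      then show ?thesis using k[of "\<lambda>i. if i < j then x ! i else e (i - j)" y] by simp
    qed
    then show ?thesis by blast
  qed
  have "dquant (Suc j) H"
    unfolding dquant_def
  proof (intro conjI allI impI)
    fix T assume T: "dpred (\<lambda>e. T (map e [0..<Suc j]) (\<lambda>i. e (i + Suc j)))"
    obtain k where k: "\<And>e x y. length x = j \<Longrightarrow> alt k (\<lambda>y. T (y # x) e) y" using bound[OF T] by blast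
    \<comment> \<open>The quantifier over definable segments is gone: only finitely many
      \<open>i\<close>, the quantifier \<open>G\<close> and the set \<Omega> remain.\<close>
    have eq: "H (\<lambda>x. T x e) \<longleftrightarrow> (\<exists>i<k. pos (\<lambda>x. alt (Suc i) (\<lambda>y. T (y # x) e)) \<and> \<not> pos (\<lambda>x. alt i (\<lambda>y. T (y # x) e)) \<and>
        G (\<lambda>x. \<forall>y. alt (Suc i) (\<lambda>y. T (y # x) e) y \<and> \<not> alt i (\<lambda>y. T (y # x) e) y \<longrightarrow> T (y # x) e))" for e
      using ex_piece[of k "\<lambda>x. T x e", OF k] H_alt[OF dpred_section_tup[of T, OF T, of e]] by blast
    have T': "dpred (\<lambda>e. T (e a # map (\<lambda>i. e (f i)) [0..<j]) (\<lambda>i. e (g i)))" for a f g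
    proof -
      let ?\<sigma> = "case_nat a (\<lambda>i. if i < j then f i else g (i - j))"
      have eq: "map (\<lambda>i. e (?\<sigma> (Suc i))) [0..<j] = map (\<lambda>i. e (f i)) [0..<j]" for e :: "nat \<Rightarrow> 'a"
        by (rule map_cong) auto
      from dpred_rename[OF T[unfolded map_upt_Suc_Cons], of ?\<sigma>, unfolded eq] show ?thesis by simp
    qed
    show "dpred (\<lambda>e. H (\<lambda>x. T x e))"
      unfolding eq pos_def
      by (intro dpred_ex_less dpred_conj dpred_not dpred_all_tup dpred_imp dpred_definable[OF _ \<Omega>(1)]
          dpred_dquant[OF G] dpred_ex dpred_all dpred_alt T' Z dtup_Cons dtup_block dfun_var)
  next
    fix P Q assume "H P \<and> (\<forall>x. length x = Suc j \<and> P x \<longrightarrow> Q x)"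
    then show "H Q" using H_mono by blast
  next
    fix P Q assume "H P \<and> H Q"
    then show "H (\<lambda>x. P x \<and> Q x)" using H_conj by blast
  next
    show "\<not> H (\<lambda>x. False)" by (rule H_False)
  next
    fix P assume P: "dpred (\<lambda>e. P (map e [0..<Suc j]))"
    obtain k where "\<And>x y. length x = j \<Longrightarrow> alt k (\<lambda>y. P (y # x)) y"
      using bound[of "\<lambda>x e. P x", OF P] by blast
    from ex_piece[of k P, OF this] show "H P \<or> H (\<lambda>x. \<not> P x)" using H_decides[OF P] by blast
  qed
  then show ?thesis using H_Z by blast
qed

section \<open>From directed families to quantifiers\<close>

text \<open>Outside \<Omega> the sets \<open>S u\<close> are unconstrained, so only the conjunction
  is controlled. The fixed length of \<open>u\<close> makes the splitting of \<open>u @ x\<close>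
  unique.\<close>

lemma definable_family_iff:
  assumes "definable_family M m n \<Omega> S"
  shows "u \<in> \<Omega> \<and> x \<in> S u \<longleftrightarrow> length u = m \<and> u @ x \<in> {u @ x | u x. u \<in> \<Omega> \<and> x \<in> S u}"
proof -
  have len: "length u = m" if "u \<in> \<Omega>" for u
    using definable_subset[of m \<Omega>] assms that unfolding definable_family_def tuples_def by blast
  show ?thesis
  proof
    assume "length u = m \<and> u @ x \<in> {u @ x | u x. u \<in> \<Omega> \<and> x \<in> S u}"
    then obtain u' x' where "length u = m" "u @ x = u' @ x'" "u' \<in> \<Omega>" "x' \<in> S u'" by blast
    then show "u \<in> \<Omega> \<and> x \<in> S u" using len[of u'] by simp
  qed (use len in blast)
qed

lemma dpred_definable_family:
  assumes "definable_family M m n \<Omega> S" "dtup u" "dtup x"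
  shows "dpred (\<lambda>e. u e \<in> \<Omega> \<and> x e \<in> S (u e))"
proof -
  have "dpred (\<lambda>e. length (u e) = m \<and> u e @ x e \<in> {u @ x | u x. u \<in> \<Omega> \<and> x \<in> S u})"
    by (intro dpred_conj dpred_length dpred_definable[of _ "m + n"] dtup_append assms(2,3))
      (use assms(1) in \<open>simp add: definable_family_def\<close>)
  then show ?thesis by (simp only: definable_family_iff[OF assms(1), symmetric])
qed

lemma ex_dquant_of_directed:
  assumes fam: "definable_family M m n \<Omega> S" and dir: "downward_directed (S ` \<Omega>)"
  shows "\<exists>G. dquant n G \<and> (\<forall>u\<in>\<Omega>. G (\<lambda>x. x \<in> S u))"
proof -
  have fin_dir: "\<exists>u\<in>\<Omega>. \<forall>v\<in>V. S u \<subseteq> S v" if "finite V" "V \<subseteq> \<Omega>" for V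
  proof -
    have "finite (S ` V) \<and> S ` V \<subseteq> S ` \<Omega>" using that by blast
    then have "\<exists>B\<in>S ` \<Omega>. \<forall>A\<in>S ` V. B \<subseteq> A" using dir unfolding downward_directed_def by (elim conjE allE[of _ "S ` V"]) simp
    then show ?thesis by simp
  qed
  obtain u0 where u0: "u0 \<in> \<Omega>" using fin_dir[of "{}"] by blast
  have Slen: "length x = n" if "u \<in> \<Omega>" "x \<in> S u" for u x
    using fam that unfolding definable_family_def tuples_def by blast
  have ne: "S u \<noteq> {}" if "u \<in> \<Omega>" for u using dir that unfolding downward_directed_def by (metis imageI)
  \<comment> \<open>\<open>Z j u\<close> is the projection of \<open>S u\<close> to its last
    \<open>j\<close> coordinates; the induction runs from the one-point space up to j = n.\<close>
  define Z where "Z j u x \<longleftrightarrow> (\<exists>w. length w = n - j \<and> (u \<in> \<Omega> \<and> w @ x \<in> S u))" for j u x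
  have Zd: "dpred (\<lambda>e. Z j (u e) (x e))" if "dtup u" "dtup x" for j u x
    unfolding Z_def
    by (intro dpred_ex_tup dpred_definable_family[OF fam] dtup_append dtup_block dtup_rename[OF that(1)] dtup_rename[OF that(2)])
  have Zdir: "\<exists>v\<in>\<Omega>. \<forall>x. Z j v x \<longrightarrow> Z j u x \<and> Z j u' x" if "u \<in> \<Omega>" "u' \<in> \<Omega>" for j u u'
    using fin_dir[of "{u, u'}"] that unfolding Z_def by blast
  have "\<exists>G. dquant j G \<and> (\<forall>u\<in>\<Omega>. G (Z j u))" if "j \<le> n" for j
    using that
  proof (induction j)
    case 0
    have "dquant 0 (\<lambda>P. P [])" unfolding dquant_def by auto
    moreover have "Z 0 u []" if "u \<in> \<Omega>" for u using ne[OF that] Slen[OF that] that unfolding Z_def by auto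
    ultimately show ?case by (intro exI[of _ "\<lambda>P. P []"]) simp
  next
    case (Suc j)
    then obtain G where G: "dquant j G" "\<And>u. u \<in> \<Omega> \<Longrightarrow> G (Z j u)" by auto
    have "G (\<lambda>x. \<exists>y. Z (Suc j) u (y # x))" if "u \<in> \<Omega>" for u
    proof (rule dquant_mono[OF G(1) G(2)[OF that]])
      fix x assume "Z j u x"
      then obtain w where w: "length w = n - j" "w @ x \<in> S u" unfolding Z_def by blast
      then have "w \<noteq> []" using Suc.prems by auto
      then have "w = butlast w @ [last w]" by simp
      then have "butlast w @ last w # x \<in> S u" using w(2) by (metis append.assoc append_Cons append_Nil)
      then show "\<exists>y. Z (Suc j) u (y # x)" unfolding Z_def using that w(1)
        by (intro exI[of _ "last w"] exI[of _ "butlast w"]) auto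
    qed
    from dquant_extend[OF G(1) Zd _ u0 Zdir this] show ?case using fam unfolding definable_family_def by blast
  qed
  from this[OF order_refl] obtain G where G: "dquant n G" "\<And>u. u \<in> \<Omega> \<Longrightarrow> G (Z n u)" by blast
  have "G (\<lambda>x. x \<in> S u)" if "u \<in> \<Omega>" for u
    by (rule dquant_mono[OF G(1) G(2)[OF that]]) (simp add: Z_def)
  then show ?thesis using G(1) by blast
qed

section \<open>From complete definable types to quantifiers\<close>

text \<open>\<open>G\<close> accepts every predicate that holds on some member of \<open>p\<close>.
  This makes it monotone beyond definable predicates, while on definable ones it agrees with
  membership in \<open>p\<close>.\<close>

lemma ex_dquant_of_type:
  assumes p: "complete_type M n p" and d: "definable_type M n p"
  shows "\<exists>G. dquant n G \<and> (\<forall>A\<in>p. G (\<lambda>x. x \<in> A))"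
proof -
  define G where "G Q \<longleftrightarrow> (\<exists>A\<in>p. \<forall>x\<in>A. Q x)" for Q
  have "\<forall>A\<in>p. definable M n A" using p unfolding complete_type_def by (elim conjE)
  then have len: "length x = n" if "A \<in> p" "x \<in> A" for A x
    using definable_subset[of n A] that unfolding tuples_def by blast
  have conj: "A \<inter> B \<in> p" if "A \<in> p" "B \<in> p" for A B using p that unfolding complete_type_def by blast
  have emp: "{} \<notin> p" using p unfolding complete_type_def by blast
  have sup: "B \<in> p" if "A \<in> p" "A \<subseteq> B" "definable M n B" for A B using p that unfolding complete_type_def by blast
  have dec: "A \<in> p \<or> tuples n - A \<in> p" if "definable M n A" for A using p that unfolding complete_type_def by blast
  have def: "definable M n {x \<in> tuples n. Q x}" if "dpred (\<lambda>e. Q (map e [0..<n]))" for Q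
    by (rule definableI) (use that in \<open>auto simp: tuples_def\<close>)
  have G_iff: "G Q \<longleftrightarrow> {x \<in> tuples n. Q x} \<in> p" if "dpred (\<lambda>e. Q (map e [0..<n]))" for Q
  proof
    assume "G Q"
    then obtain A where A: "A \<in> p" "\<forall>x\<in>A. Q x" unfolding G_def by blast
    then have "A \<subseteq> {x \<in> tuples n. Q x}" using len by (auto simp: tuples_def)
    then show "{x \<in> tuples n. Q x} \<in> p" using sup A(1) def[OF that] by blast
  next
    assume "{x \<in> tuples n. Q x} \<in> p"
    then show "G Q" unfolding G_def by (rule bexI[rotated]) simp
  qed
  have "dquant n G"
    unfolding dquant_def
  proof (intro conjI allI impI)
    fix T assume T: "dpred (\<lambda>e. T (map e [0..<n]) (\<lambda>i. e (i + n)))"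
    obtain \<phi> where f: "wf_fm M \<phi>" "\<And>e. sat M e \<phi> \<longleftrightarrow> T (map e [0..<n]) (\<lambda>i. e (i + n))"
      using T unfolding dpred_def by blast
    obtain N where N: "\<And>i. i \<in> free_vars \<phi> \<Longrightarrow> i < N" using free_bound[of \<phi>] by blast
    define B where "B = {u \<in> tuples N. {v \<in> tuples n. sat M (nth (v @ u)) \<phi>} \<in> p}"
    \<comment> \<open>All free variables of \<phi> are below \<open>N\<close>, so the first
      \<open>N\<close> entries of the valuation carry every parameter that matters.\<close>
    have "formula_in M (n + N) \<phi>" using f(1) N unfolding formula_in_def by (auto intro: trans_less_add2)
    then have B: "definable M N B" using d unfolding definable_type_def B_def by blast
    have sat: "sat M (nth (v @ map e [0..<N])) \<phi> \<longleftrightarrow> T v e" if "length v = n" for v e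
    proof -
      let ?e = "\<lambda>i. if i < n then v ! i else e (i - n)"
      have "sat M (nth (v @ map e [0..<N])) \<phi> \<longleftrightarrow> sat M ?e \<phi>"
      proof (rule sat_cong)
        fix i assume "i \<in> free_vars \<phi>"
        then have "i < N" by (rule N)
        then show "(v @ map e [0..<N]) ! i = ?e i" using that by (simp add: nth_append)
      qed
      moreover have "map ?e [0..<n] = v" using that by (auto intro: nth_equalityI)
      ultimately show ?thesis by (simp add: f(2))
    qed
    have "{v \<in> tuples n. sat M (nth (v @ map e [0..<N])) \<phi>} = {v \<in> tuples n. T v e}" for e
      using sat by (auto simp: tuples_def)
    then have "G (\<lambda>x. T x e) \<longleftrightarrow> map e [0..<N] \<in> B" for e
      unfolding G_iff[of "\<lambda>x. T x e" for e, OF dpred_section_tup[of T, OF T]] B_def by (simp add: tuples_def)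
    then show "dpred (\<lambda>e. G (\<lambda>x. T x e))" using dpred_definable[OF dtup_block B] by simp
  next
    fix P Q assume PQ: "G P \<and> (\<forall>x. length x = n \<and> P x \<longrightarrow> Q x)"
    then obtain A where A: "A \<in> p" "\<forall>x\<in>A. P x" unfolding G_def by blast
    have "\<forall>x\<in>A. Q x" using PQ A(2) len[OF A(1)] by blast
    then show "G Q" unfolding G_def using A(1) by (rule bexI)
  next
    fix P Q assume "G P \<and> G Q"
    then show "G (\<lambda>x. P x \<and> Q x)" unfolding G_def using conj by (metis IntD1 IntD2)
  next
    show "\<not> G (\<lambda>x. False)" unfolding G_def using emp by (metis all_not_in_conv)
  next
    fix P assume P: "dpred (\<lambda>e. P (map e [0..<n]))"
    have "tuples n - {x \<in> tuples n. P x} = {x \<in> tuples n. \<not> P x}" by auto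
    then show "G P \<or> G (\<lambda>x. \<not> P x)" using dec[OF def[OF P]] G_iff[OF P] G_iff[OF dpred_not[OF P]] by simp
  qed
  then show ?thesis unfolding G_def by blast
qed

section \<open>The curve of a definable family\<close>

lemma ex_curve:
  assumes fam: "definable_family M m n \<Omega> S" and ne: "\<Omega> \<noteq> {}"
    and G: "dquant n G" "\<And>u. u \<in> \<Omega> \<Longrightarrow> G (\<lambda>x. x \<in> S u)"
  shows "\<exists>\<gamma>. definable_curve M n \<gamma> \<and> (\<forall>t>0. \<gamma> t \<in> \<Union>(S ` \<Omega>)) \<and>
    (\<forall>u\<in>\<Omega>. \<exists>\<epsilon>>0. \<forall>t. 0 < t \<and> t < \<epsilon> \<longrightarrow> \<gamma> t \<in> S u)"
proof -
  have \<Omega>: "definable M m \<Omega>" using fam unfolding definable_family_def by blast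
  have len: "length u = m" if "u \<in> \<Omega>" for u using definable_subset[OF \<Omega>] that unfolding tuples_def by blast
  have Slen: "length x = n" if "u \<in> \<Omega>" "x \<in> S u" for u x
    using fam that unfolding definable_family_def tuples_def by blast
  \<comment> \<open>The condition is void for \<open>u\<close> outside \<Omega>, since the curve is
    built for all tuples of length \<open>m\<close>. The repeated membership gives the conjunction
    that is known to be definable.\<close>
  define R where "R u s x \<longleftrightarrow> (u \<in> \<Omega> \<longrightarrow> u \<in> \<Omega> \<and> x \<in> S u)" for u and s :: 'a and x
  have Rd: "dpred (\<lambda>e. R (u e) (s e) (x e))" if "dtup u" "dfun s" "dtup x" for u s x
    unfolding R_def by (intro dpred_imp dpred_definable[OF that(1) \<Omega>] dpred_definable_family[OF fam that(1,3)])
  have RG: "ev (\<lambda>s. G (R u s))" if "length u = m" for u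
  proof (rule ev_True)
    fix s :: 'a
    show "G (R u s)"
    proof (cases "u \<in> \<Omega>")
      case True
      show ?thesis by (rule dquant_mono[OF G(1) G(2)[OF True]]) (simp add: R_def)
    next
      case False
      show ?thesis by (rule dquant_True[OF G(1)]) (simp add: R_def False)
    qed
  qed
  obtain \<beta> where \<beta>: "dtup (\<lambda>e. \<beta> (e 0))" "\<And>u. length u = m \<Longrightarrow> ev (\<lambda>s. length (\<beta> s) = n \<and> R u s (\<beta> s))"
    using ex_curve_of_dquant[of n G R m, OF G(1) Rd RG] by blast
  have \<beta>S: "ev (\<lambda>s. \<beta> s \<in> S u)" if "u \<in> \<Omega>" for u
    by (rule ev_mono[OF \<beta>(2)[OF len[OF that]]]) (use that in \<open>simp add: R_def\<close>)
  obtain u0 where u0: "u0 \<in> \<Omega>" using ne by blast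
  obtain \<delta> where \<delta>: "0 < \<delta>" "\<And>s. 0 < s \<Longrightarrow> s < \<delta> \<Longrightarrow> \<beta> s \<in> S u0" using \<beta>S[OF u0] unfolding ev_def by blast
  obtain s0 where s0: "0 < s0" "s0 < \<delta>" using dense[OF \<delta>(1)] by blast
  \<comment> \<open>From \<delta> on, a fixed point of \<open>S u0\<close> is used, so that every
    value lies in the union of the family.\<close>
  define \<gamma> where "\<gamma> t = (if t < \<delta> then \<beta> t else \<beta> s0)" for t
  have \<gamma>S: "\<gamma> t \<in> S u0" if "0 < t" for t using \<delta>(2) s0 that unfolding \<gamma>_def by simp
  have "definable_curve M n \<gamma>"
    unfolding definable_curve_def
  proof (intro conjI allI impI)
    show \<gamma>n: "\<gamma> t \<in> tuples n" if "0 < t" for t using Slen[OF u0 \<gamma>S[OF that]] by (simp add: tuples_def)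
    show "definable M (Suc n) {t # \<gamma> t | t. 0 < t}"
    proof (rule definableI)
      have "dpred (\<lambda>e. 0 < e 0 \<and> ((e 0 < \<delta> \<and> map (\<lambda>i. e (Suc i)) [0..<n] = \<beta> (e 0)) \<or>
          (\<not> e 0 < \<delta> \<and> map (\<lambda>i. e (Suc i)) [0..<n] = \<beta> s0)))"
        by (intro dintros \<beta>(1))
      moreover have "(0 < e 0 \<and> ((e 0 < \<delta> \<and> map (\<lambda>i. e (Suc i)) [0..<n] = \<beta> (e 0)) \<or>
          (\<not> e 0 < \<delta> \<and> map (\<lambda>i. e (Suc i)) [0..<n] = \<beta> s0))) \<longleftrightarrow> map e [0..<Suc n] \<in> {t # \<gamma> t | t. 0 < t}" for e
        unfolding map_upt_Suc_Cons \<gamma>_def by auto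
      ultimately show "dpred (\<lambda>e. map e [0..<Suc n] \<in> {t # \<gamma> t | t. 0 < t})" by simp
    qed (use \<gamma>n in \<open>auto simp: tuples_def\<close>)
  qed
  moreover have "\<gamma> t \<in> \<Union>(S ` \<Omega>)" if "0 < t" for t using \<gamma>S[OF that] u0 by blast
  moreover have "\<exists>\<epsilon>>0. \<forall>t. 0 < t \<and> t < \<epsilon> \<longrightarrow> \<gamma> t \<in> S u" if u: "u \<in> \<Omega>" for u
  proof -
    obtain \<epsilon> where e: "0 < \<epsilon>" "\<And>s. 0 < s \<Longrightarrow> s < \<epsilon> \<Longrightarrow> \<beta> s \<in> S u" using \<beta>S[OF u] unfolding ev_def by blast
    show ?thesis by (rule exI[of _ "min \<epsilon> \<delta>"]) (use e \<delta>(1) in \<open>simp add: \<gamma>_def\<close>)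
  qed
  ultimately show ?thesis by blast
qed

section \<open>The type and the directed family of a curve\<close>

context
  fixes n :: nat and \<gamma> :: "'a \<Rightarrow> 'a list"
  assumes \<gamma>: "definable_curve M n \<gamma>"
begin

text \<open>Completeness holds because definable conditions along the curve are eventually decided,
  definability because \<open>ev\<close> is a definable quantifier.\<close>

lemma ex_type_of_curve:
  "\<exists>p. complete_type M n p \<and> definable_type M n p \<and>
    (\<forall>A. definable M n A \<and> ev (\<lambda>t. \<gamma> t \<in> A) \<longrightarrow> A \<in> p)"
proof -
  define p where "p = {A. definable M n A \<and> ev (\<lambda>t. \<gamma> t \<in> A)}"
  have len: "length (\<gamma> t) = n" if "0 < t" for t using \<gamma> that unfolding definable_curve_def tuples_def by blast
  have gr: "definable M (Suc n) {t # \<gamma> t | t. 0 < t}" using \<gamma> unfolding definable_curve_def by blast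
  have sub: "A \<subseteq> tuples n" if "definable M n A" for A using that unfolding definable_def by blast
  have defI: "definable M n A" if "\<And>x. dtup x \<Longrightarrow> dpred (\<lambda>e. x e \<in> A)" "A \<subseteq> tuples n" for A
    by (rule definableI[OF that(1) that(2)]) (rule dtup_block)
  have dec: "ev (\<lambda>t. \<gamma> t \<in> A) \<or> ev (\<lambda>t. \<gamma> t \<in> tuples n - A)" if A: "definable M n A" for A
  proof -
    \<comment> \<open>Only the graph over positive \<open>t\<close> is known to be definable, so
      membership of the value at \<open>t\<close> is expressed through the graph.\<close>
    have "dpred (\<lambda>e. \<exists>x. length x = n \<and> e 0 # x \<in> {t # \<gamma> t | t. 0 < t} \<and> x \<in> A)"
      by (intro dpred_definable[OF _ gr] dpred_definable[OF _ A] dintros)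
    from ev_decides[of "\<lambda>s. \<exists>x. length x = n \<and> s # x \<in> {t # \<gamma> t | t. 0 < t} \<and> x \<in> A", OF this]
    show ?thesis
    proof (elim disjE)
      assume "ev (\<lambda>s. \<exists>x. length x = n \<and> s # x \<in> {t # \<gamma> t | t. 0 < t} \<and> x \<in> A)"
      then have "ev (\<lambda>t. \<gamma> t \<in> A)" by (rule ev_mono) auto
      then show ?thesis ..
    next
      assume "ev (\<lambda>s. \<not> (\<exists>x. length x = n \<and> s # x \<in> {t # \<gamma> t | t. 0 < t} \<and> x \<in> A))"
      then have "ev (\<lambda>t. \<gamma> t \<in> tuples n - A)" by (rule ev_mono) (use len in \<open>auto simp: tuples_def\<close>)
      then show ?thesis ..
    qed
  qed
  have "complete_type M n p"
    unfolding complete_type_def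
  proof (intro conjI ballI allI impI)
    show "tuples n \<in> p" unfolding p_def
      using len by (auto intro!: defI ev_True dpred_length simp: tuples_def)
    show "{} \<notin> p" unfolding p_def using ev_imp_ex[of "\<lambda>t. \<gamma> t \<in> {}"] by auto
    fix A assume A: "definable M n A"
    show "A \<in> p \<or> tuples n - A \<in> p"
    proof -
      have "definable M n (tuples n - A)"
      proof (rule defI)
        fix x :: "(nat \<Rightarrow> 'a) \<Rightarrow> 'a list" assume "dtup x"
        then have "dpred (\<lambda>e. length (x e) = n \<and> \<not> x e \<in> A)" using A by (intro dpred_conj dpred_length dpred_not dpred_definable)
        then show "dpred (\<lambda>e. x e \<in> tuples n - A)" by (simp add: tuples_def)
      qed auto
      then show ?thesis using dec[OF A] A unfolding p_def by blast
    qed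
  next
    fix A B assume A: "A \<in> p" and B: "B \<in> p"
    have "definable M n (A \<inter> B)"
    proof (rule defI)
      fix x :: "(nat \<Rightarrow> 'a) \<Rightarrow> 'a list" assume "dtup x"
      then have "dpred (\<lambda>e. x e \<in> A \<and> x e \<in> B)" using A B unfolding p_def by (intro dpred_conj dpred_definable) auto
      then show "dpred (\<lambda>e. x e \<in> A \<inter> B)" by simp
    qed (use A sub in \<open>auto simp: p_def\<close>)
    then show "A \<inter> B \<in> p" using A B ev_conj[of "\<lambda>t. \<gamma> t \<in> A" "\<lambda>t. \<gamma> t \<in> B"] unfolding p_def by simp
  next
    fix A B assume "A \<in> p" "definable M n B \<and> A \<subseteq> B"
    then show "B \<in> p" unfolding p_def by (auto elim: ev_mono)
  qed (simp add: p_def)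
  moreover have "definable_type M n p"
    unfolding definable_type_def
  proof (intro allI impI)
    fix k \<phi> assume f: "formula_in M (n + k) \<phi>"
    define A where "A = {z \<in> tuples (n + k). sat M (nth z) \<phi>}"
    have A: "definable M (n + k) A" using f unfolding A_def definable_def by blast
    let ?V = "\<lambda>u. {v \<in> tuples n. sat M (nth (v @ u)) \<phi>}"
    have V: "?V u = {v. length v = n \<and> v @ u \<in> A}" if "length u = k" for u
      using that by (auto simp: A_def tuples_def)
    have Vp: "?V u \<in> p \<longleftrightarrow> ev (\<lambda>t. \<exists>x. length x = n \<and> t # x \<in> {t # \<gamma> t | t. 0 < t} \<and> x @ u \<in> A)" if u: "length u = k" for u
    proof -
      have "definable M n (?V u)" unfolding V[OF u]
      proof (rule defI)
        fix x :: "(nat \<Rightarrow> 'a) \<Rightarrow> 'a list" assume "dtup x"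
        then have "dpred (\<lambda>e. length (x e) = n \<and> x e @ u \<in> A)"
          using A by (intro dpred_conj dpred_length dpred_definable dtup_append dtup_const)
        then show "dpred (\<lambda>e. x e \<in> {v. length v = n \<and> v @ u \<in> A})" by simp
      qed (auto simp: tuples_def)
      then have "?V u \<in> p \<longleftrightarrow> ev (\<lambda>t. length (\<gamma> t) = n \<and> \<gamma> t @ u \<in> A)" unfolding p_def V[OF u] by simp
      also have "\<dots> \<longleftrightarrow> ev (\<lambda>t. \<exists>x. length x = n \<and> t # x \<in> {t # \<gamma> t | t. 0 < t} \<and> x @ u \<in> A)"
        by (auto elim!: ev_mono)
      finally show ?thesis .
    qed
    show "definable M k {u \<in> tuples k. ?V u \<in> p}"
    proof (rule definableI)
      have "dpred (\<lambda>e. ev (\<lambda>t. \<exists>x. length x = n \<and> t # x \<in> {t # \<gamma> t | t. 0 < t} \<and> x @ map e [0..<k] \<in> A))"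
        by (intro dpred_definable[OF _ gr] dpred_definable[OF _ A] dintros)
      moreover have "map e [0..<k] \<in> {u \<in> tuples k. ?V u \<in> p} \<longleftrightarrow>
          ev (\<lambda>t. \<exists>x. length x = n \<and> t # x \<in> {t # \<gamma> t | t. 0 < t} \<and> x @ map e [0..<k] \<in> A)" for e
        using Vp[of "map e [0..<k]"] by (simp add: tuples_def)
      ultimately show "dpred (\<lambda>e. map e [0..<k] \<in> {u \<in> tuples k. ?V u \<in> p})" by simp
    qed auto
  qed
  ultimately show ?thesis unfolding p_def by (intro exI[of _ p] conjI) (auto simp: p_def)
qed

lemma ex_directed_of_curve:
  "\<exists>k \<Omega>' S'. definable_family M k n \<Omega>' S' \<and> downward_directed (S' ` \<Omega>') \<and>
     (\<forall>A. ev (\<lambda>t. \<gamma> t \<in> A) \<longrightarrow> (\<exists>u\<in>\<Omega>'. S' u \<subseteq> A))"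
proof -
  have len: "length (\<gamma> t) = n" if "0 < t" for t using \<gamma> that unfolding definable_curve_def tuples_def by blast
  have gr: "definable M (Suc n) {t # \<gamma> t | t. 0 < t}" using \<gamma> unfolding definable_curve_def by blast
  define \<Omega>' where "\<Omega>' = {[a] | a :: 'a. 0 < a}"
  define S' where "S' u = {\<gamma> t | t. 0 < t \<and> t < hd u}" for u
  have "definable_family M 1 n \<Omega>' S'"
    unfolding definable_family_def
  proof (intro conjI ballI)
    show "definable M 1 \<Omega>'"
    proof (rule definableI)
      have "dpred (\<lambda>e. 0 < e 0)" by (intro dintros)
      then show "dpred (\<lambda>e. map e [0..<1] \<in> \<Omega>')" by (simp add: \<Omega>'_def)
    qed (auto simp: \<Omega>'_def tuples_def)
    show "S' u \<subseteq> tuples n" for u using len by (auto simp: S'_def tuples_def)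
    show "definable M (1 + n) {u @ x | u x. u \<in> \<Omega>' \<and> x \<in> S' u}"
    proof (rule definableI)
      have "dpred (\<lambda>e. 0 < e 0 \<and> (\<exists>t. t < e 0 \<and> t # map (\<lambda>i. e (Suc i)) [0..<n] \<in> {t # \<gamma> t | t. 0 < t}))"
        by (intro dpred_definable[OF _ gr] dintros)
      moreover have "(0 < e 0 \<and> (\<exists>t. t < e 0 \<and> t # map (\<lambda>i. e (Suc i)) [0..<n] \<in> {t # \<gamma> t | t. 0 < t}))
          \<longleftrightarrow> map e [0..<Suc n] \<in> {u @ x | u x. u \<in> \<Omega>' \<and> x \<in> S' u}" for e
      proof -
        have "e 0 # map (\<lambda>i. e (Suc i)) [0..<n] = u @ x \<and> u \<in> \<Omega>' \<and> x \<in> S' u \<longleftrightarrow>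
            u = [e 0] \<and> x = map (\<lambda>i. e (Suc i)) [0..<n] \<and> 0 < e 0 \<and> x \<in> S' u" for u x
          unfolding \<Omega>'_def by auto
        then show ?thesis unfolding map_upt_Suc_Cons mem_Collect_eq by (auto simp: S'_def)
      qed
      ultimately show "dpred (\<lambda>e. map e [0..<1 + n] \<in> {u @ x | u x. u \<in> \<Omega>' \<and> x \<in> S' u})" by simp
    qed (use len in \<open>auto simp: tuples_def S'_def \<Omega>'_def\<close>)
  qed
  moreover have "downward_directed (S' ` \<Omega>')"
    unfolding downward_directed_def
  proof (intro conjI allI impI)
    show "{} \<notin> S' ` \<Omega>'" using dense unfolding S'_def \<Omega>'_def by auto blast
    fix \<F> assume "finite \<F> \<and> \<F> \<subseteq> S' ` \<Omega>'"
    then obtain C where C: "C \<subseteq> \<Omega>'" "finite C" "\<F> = S' ` C" by (metis finite_subset_image)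
    \<comment> \<open>\<open>b\<close> keeps the minimum meaningful when the given subfamily is
      empty.\<close>
    obtain b :: 'a where "0 < b" using ex_greater by blast
    let ?m = "Min (insert b (hd ` C))"
    have "0 < ?m" using C(1,2) \<open>0 < b\<close> unfolding \<Omega>'_def by (subst Min_gr_iff) auto
    moreover have "S' [?m] \<subseteq> S' c" if "c \<in> C" for c
    proof -
      have "?m \<le> hd c" using that C(2) by simp
      then show ?thesis unfolding S'_def by (auto intro: less_le_trans)
    qed
    ultimately show "\<exists>B\<in>S' ` \<Omega>'. \<forall>A\<in>\<F>. B \<subseteq> A" unfolding C(3) \<Omega>'_def by blast
  qed
  moreover have "\<exists>u\<in>\<Omega>'. S' u \<subseteq> A" if A: "ev (\<lambda>t. \<gamma> t \<in> A)" for A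
  proof -
    obtain \<delta> where "0 < \<delta>" "\<forall>t. 0 < t \<and> t < \<delta> \<longrightarrow> \<gamma> t \<in> A" using A unfolding ev_def by blast
    then show ?thesis unfolding \<Omega>'_def S'_def by (intro bexI[of _ "[\<delta>]"]) auto
  qed
  ultimately show ?thesis by blast
qed

end

end

section \<open>The equivalence of type, directed family and curve\<close>

theorem theorem5p2:
  fixes M :: "('a::linordered_group_add, 'f, 'r) expansion"
    and m n :: nat
    and \<Omega> :: "'a list set"
    and S :: "'a list \<Rightarrow> 'a list set"
  assumes "o_minimal M"
    and "expands_ordered_field M"
    and "definable_family M m n \<Omega> S"
    and "\<Omega> \<noteq> {}"
    and "finite_intersection_property (S ` \<Omega>)"
  shows
    "((\<exists>p. complete_type M n p \<and> definable_type M n p \<and> (\<forall>u\<in>\<Omega>. S u \<in> p)) \<longleftrightarrow>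
      (\<exists>k \<Omega>' S'. definable_family M k n \<Omega>' S' \<and>
         downward_directed (S' ` \<Omega>') \<and> finer (S' ` \<Omega>') (S ` \<Omega>)))
     \<and>
     ((\<exists>k \<Omega>' S'. definable_family M k n \<Omega>' S' \<and>
         downward_directed (S' ` \<Omega>') \<and> finer (S' ` \<Omega>') (S ` \<Omega>)) \<longleftrightarrow>
      (\<exists>\<gamma>. definable_curve M n \<gamma> \<and> (\<forall>t>0. \<gamma> t \<in> \<Union>(S ` \<Omega>)) \<and>
         (\<forall>u\<in>\<Omega>. \<exists>\<epsilon>>0. \<forall>t. 0 < t \<and> t < \<epsilon> \<longrightarrow> \<gamma> t \<in> S u)))"
    (is "(?type \<longleftrightarrow> ?directed) \<and> (?directed \<longleftrightarrow> ?curve)")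
proof -
  obtain F where F: "real_closed_on F" "definable_op M (add F)" "definable_op M (mult F)"
    using assms(2) unfolding expands_ordered_field_def by blast
  have "ordered_field_on F" using F(1) unfolding real_closed_on_def by blast
  note lin = linordered_field_of_ordered_field_on[OF this]
  note om = o_minimal_field.intro[OF lin o_minimal_field_axioms.intro[OF assms(1) F(2,3)]]
  have dS: "definable M n (S u)" if "u \<in> \<Omega>" for u
  proof (rule expn.definableI)
    show "S u \<subseteq> tuples n" using assms(3) that unfolding definable_family_def by blast
    show "expn.dpred M (\<lambda>e. map e [0..<n] \<in> S u)"
      using o_minimal_field.dpred_definable_family[OF om assms(3) expn.dtup_const[of M u] expn.dtup_block[of M "\<lambda>i. i" "[0..<n]"]] that
      by simp
  qed
  have 1: ?curve if ?type
  proof -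
    obtain p where p: "complete_type M n p" "definable_type M n p" "\<And>u. u \<in> \<Omega> \<Longrightarrow> S u \<in> p" using \<open>?type\<close> by blast
    obtain G where G: "o_minimal_field.dquant M n G" "\<forall>A\<in>p. G (\<lambda>x. x \<in> A)"
      using o_minimal_field.ex_dquant_of_type[OF om p(1,2)] by (elim exE conjE)
    show ?thesis
      by (rule o_minimal_field.ex_curve[OF om assms(3,4) G(1)]) (rule bspec[OF G(2) p(3)])
  qed
  have 2: ?curve if ?directed
  proof -
    obtain k \<Omega>' S' where d: "definable_family M k n \<Omega>' S'" "downward_directed (S' ` \<Omega>')" "finer (S' ` \<Omega>') (S ` \<Omega>)"
      using \<open>?directed\<close> by blast
    obtain G where G: "o_minimal_field.dquant M n G" "\<forall>u\<in>\<Omega>'. G (\<lambda>x. x \<in> S' u)"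
      using o_minimal_field.ex_dquant_of_directed[OF om d(1,2)] by (elim exE conjE)
    have "G (\<lambda>x. x \<in> S u)" if u: "u \<in> \<Omega>" for u
    proof -
      obtain v where "v \<in> \<Omega>'" "S' v \<subseteq> S u" using d(3) u unfolding finer_def by blast
      then show ?thesis
        \<comment> \<open>A finer family suffices, since \<open>G\<close> passes to larger
          sets.\<close>
        by (intro o_minimal_field.dquant_mono[OF om G(1) bspec[OF G(2)], of v "\<lambda>x. x \<in> S u"]) blast+
    qed
    then show ?thesis by (rule o_minimal_field.ex_curve[OF om assms(3,4) G(1)])
  qed
  have 3: "?type \<and> ?directed" if ?curve
  proof -
    obtain \<gamma> where g: "definable_curve M n \<gamma>" "\<And>u. u \<in> \<Omega> \<Longrightarrow> \<exists>\<epsilon>>0. \<forall>t. 0 < t \<and> t < \<epsilon> \<longrightarrow> \<gamma> t \<in> S u"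
      using \<open>?curve\<close> by blast
    have ev: "o_minimal_field.ev (\<lambda>t. \<gamma> t \<in> S u)" if "u \<in> \<Omega>" for u
      using g(2)[OF that] unfolding o_minimal_field.ev_def[OF om] .
    obtain p where p: "complete_type M n p" "definable_type M n p"
      "\<forall>A. definable M n A \<and> o_minimal_field.ev (\<lambda>t. \<gamma> t \<in> A) \<longrightarrow> A \<in> p"
      using o_minimal_field.ex_type_of_curve[OF om g(1)] by (elim exE conjE)
    have "\<forall>u\<in>\<Omega>. S u \<in> p" using p(3) dS ev by blast
    with p(1,2) have ?type by (intro exI[of _ p]) simp
    obtain k \<Omega>' S' where d: "definable_family M k n \<Omega>' S'" "downward_directed (S' ` \<Omega>')"
      "\<forall>A. o_minimal_field.ev (\<lambda>t. \<gamma> t \<in> A) \<longrightarrow> (\<exists>u\<in>\<Omega>'. S' u \<subseteq> A)"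
      using o_minimal_field.ex_directed_of_curve[OF om g(1)] by (elim exE conjE)
    have "\<exists>u\<in>\<Omega>'. S' u \<subseteq> S v" if "v \<in> \<Omega>" for v using d(3) ev[OF that] by blast
    then have "finer (S' ` \<Omega>') (S ` \<Omega>)" unfolding finer_def by simp
    with d(1,2) have ?directed by blast
    with \<open>?type\<close> show ?thesis ..
  qed
  show ?thesis using 1 2 3 by blast
qed

end
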